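(* Let $n,m$ be relatively prime positive integers with $n>2m$, let $a,b\in\mathbb{C}\setminus\{0\}$, let $P(w)=w^n+aw^m+b$, and let $S=\{w\in\mathbb{C}:P(w)=0\}$. Suppose that $S$ has exactly $n-1$ distinct elements, and write $S=\{\alpha_1,\alpha_2,\ldots,\alpha_{n-1}\}$, where $\alpha_1$ is the multiple zero of $P$ and $\alpha_2,\ldots,\alpha_{n-1}$ are the simple zeros of $P$. Let $f$ be a non-constant meromorphic function in $\mathbb{C}$ with finitely many poles and let $\mathcal{L}$ be a non-constant $L$-function. If $f$ and $\mathcal{L}$ share $(S,\infty)^*=\{(\alpha_1,\infty),(\{\alpha_2,\ldots,\alpha_{n-1}\},\infty)\}$ and share $(0,0)$, then $f\equiv\mathcal{L}$.
   Context: **$L$-functions.** An $L$-function is (the meromorphic continuation to $\mathbb{C}$ of) an element of the Selberg class, i.e. a Dirichlet series $\mathcal{L}(s)=\sum_{j=1}^{\infty}a(j)j^{-s}$ satisfying: (1) $a(j)\ll j^{\varepsilon}$ for every $\varepsilon>0$; (2) there is an integer $k_0\ge 0$ such that $(s-1)^{k_0}\mathcal{L}(s)$ is an entire function of finite order; (3) $\Lambda(s)=\omega\,\overline{\Lambda(1-\overline{s})}$, where $\Lambda(s)=\mathcal{L}(s)Q^{s}\prod_{j=1}^{K}\Gamma(\lambda_j s+\nu_j)$ with positive reals $Q,\lambda_j$ and complex numbers $\nu_j,\omega$ with $\mathrm{Re}\,\nu_j\ge 0$, $|\omega|=1$; (4) $\log\mathcal{L}(s)=\sum_{j=1}^{\infty}b(j)j^{-s}$,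 where $b(j)=0$ unless $j$ is a positive power of a prime, and $b(j)\ll j^{\theta}$ for some $\theta<1/2$. **Weighted sharing.** For $k$ a non-negative integer or $\infty$, and $\alpha\in\mathbb{C}\cup\{\infty\}$, $E_k(\alpha;f)$ is the set of all $\alpha$-points of $f$ in $\mathbb{C}$, where an $\alpha$-point of multiplicity $p$ is counted $p$ times if $p\le k$ and $k+1$ times if $p>k$. For a set $T\subset\mathbb{C}\cup\{\infty\}$, $E_f(T,k)=\bigcup_{\alpha\in T}E_k(\alpha;f)$ (points with counts). We say $f,g$ share $(T,k)$ if $E_f(T,k)=E_g(T,k)$; for $T=\{\alpha\}$ we write $(\alpha,k)$. Weight $\infty$ corresponds to counting multiplicities, weight $0$ to ignoring multiplicities. **Restricted sharing.** If $\hat S\subset\mathbb{C}$ is a finite set that is a disjoint union $\hat S=S_1\cup\cdots\cup S_r$, then $f$ and $g$ (non-constant meromorphic in $\mathbb{C}$) share $(\hat S,k)^*=\{(S_1,k_1),\ldots,(S_r,k_r)\}$ means that $f,g$ share $(S_i,k_i)$ for each $i=1,\ldots,r$, where $k=\min\{k_1,\ldots,k_r\}$. *)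

theory Defs
  imports
    "HOL-Complex_Analysis.Complex_Analysis"
    "HOL-Computational_Algebra.Polynomial"
    "HOL-Library.Extended_Nat"
    "HOL-Library.Landau_Symbols"
    "HOL-Number_Theory.Prime_Powers"
begin

text \<open>
  A meromorphic function on the complex plane is represented by a total function \<open>f\<close> with
  \<open>f nicely_meromorphic_on UNIV\<close>: there are no removable singularities, and the value at a pole
  is 0 by convention. Two such functions are therefore equal as functions iff they are
  equal as meromorphic functions, but \<open>f z = 0\<close> alone does not make \<open>z\<close> a zero.
\<close>

definition entire_finite_order :: "(complex \<Rightarrow> complex) \<Rightarrow> bool" where
  "entire_finite_order F \<longleftrightarrow>
     F holomorphic_on UNIV \<and>
     (\<exists>\<rho>::real. (\<lambda>z. norm (F z)) \<in> O[at_infinity](\<lambda>z. exp (norm z powr \<rho>)))"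

text \<open>
  The product is taken pointwise first; \<open>remove_sings\<close> then fills in the correct values, for instance
  where a zero of \<open>L\<close> cancels a pole of a Gamma factor (the library sets Gamma to 0
  at its poles). The positive reals usually written lambda are called \<open>\<mu> j\<close> here.
\<close>
definition completed_L ::
  "(complex \<Rightarrow> complex) \<Rightarrow> real \<Rightarrow> nat \<Rightarrow> (nat \<Rightarrow> real) \<Rightarrow> (nat \<Rightarrow> complex) \<Rightarrow> complex \<Rightarrow> complex" where
  "completed_L L Q K \<mu> \<nu> =
     remove_sings (\<lambda>s. L s * of_real Q powr s * (\<Prod>j=1..K. Gamma (of_real (\<mu> j) * s + \<nu> j)))"

text \<open>
  \<open>L_function L\<close>: \<open>L\<close> is the meromorphic continuation of an element of the Selberg class. Conditions
  (1) and (4) make both Dirichlet series converge absolutely for \<open>Re s > 1\<close>. In (4), the series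
  of the \<open>b j\<close> is a logarithm of \<open>L\<close> (the branch tending to 0 as \<open>Re s\<close> tends to infinity),
  not the principal value.
\<close>
definition L_function :: "(complex \<Rightarrow> complex) \<Rightarrow> bool" where
  "L_function L \<longleftrightarrow>
     L nicely_meromorphic_on UNIV \<and>
     (\<exists>a :: nat \<Rightarrow> complex.
        (\<forall>s. Re s > 1 \<longrightarrow> (\<lambda>j. a (Suc j) * of_nat (Suc j) powr (- s)) sums L s) \<and>
        \<comment> \<open>(1) Ramanujan hypothesis\<close>
        (\<forall>\<epsilon>::real. \<epsilon> > 0 \<longrightarrow> (\<lambda>j. norm (a j)) \<in> O(\<lambda>j. real j powr \<epsilon>))) \<and>
     \<comment> \<open>(2) analytic continuation\<close>
     (\<exists>(k0::nat) F. entire_finite_order F \<and> (\<forall>s. s \<noteq> 1 \<longrightarrow> F s = (s - 1) ^ k0 * L s)) \<and>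
     \<comment> \<open>(3) functional equation\<close>
     (\<exists>(Q::real) (K::nat) (\<mu>::nat \<Rightarrow> real) (\<nu>::nat \<Rightarrow> complex) (\<omega>::complex).
        Q > 0 \<and> (\<forall>j\<in>{1..K}. \<mu> j > 0 \<and> Re (\<nu> j) \<ge> 0) \<and> norm \<omega> = 1 \<and>
        (\<forall>s. completed_L L Q K \<mu> \<nu> s = \<omega> * cnj (completed_L L Q K \<mu> \<nu> (1 - cnj s)))) \<and>
     \<comment> \<open>(4) Euler product\<close>
     (\<exists>(b::nat \<Rightarrow> complex) (\<theta>::real).
        \<theta> < 1/2 \<and> (\<forall>j\<ge>1. \<not> primepow j \<longrightarrow> b j = 0) \<and>
        (\<lambda>j. norm (b j)) \<in> O(\<lambda>j. real j powr \<theta>) \<and>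
        (\<forall>s. Re s > 1 \<longrightarrow>
           (\<exists>l. (\<lambda>j. b (Suc j) * of_nat (Suc j) powr (- s)) sums l \<and> exp l = L s)))"

definition value_point :: "(complex \<Rightarrow> complex) \<Rightarrow> complex \<Rightarrow> complex \<Rightarrow> bool" where
  "value_point f \<alpha> z \<longleftrightarrow> \<not> is_pole f z \<and> f z = \<alpha>"

definition multiplicity_at :: "(complex \<Rightarrow> complex) \<Rightarrow> complex \<Rightarrow> complex \<Rightarrow> nat" where
  "multiplicity_at f \<alpha> z = nat (zorder (\<lambda>w. f w - \<alpha>) z)"

text \<open>
  Points with counts are encoded as pairs (point, truncated multiplicity). Only finite
  values \<open>\<alpha>\<close> are covered.
\<close>
definition E_value :: "enat \<Rightarrow> complex \<Rightarrow> (complex \<Rightarrow> complex) \<Rightarrow> (complex \<times> enat) set" where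
  "E_value k \<alpha> f =
     {(z, if enat p \<le> k then enat p else k + 1) | z p.
        value_point f \<alpha> z \<and> p = multiplicity_at f \<alpha> z}"

definition E_set :: "(complex \<Rightarrow> complex) \<Rightarrow> complex set \<Rightarrow> enat \<Rightarrow> (complex \<times> enat) set" where
  "E_set f T k = (\<Union>\<alpha>\<in>T. E_value k \<alpha> f)"

definition share :: "(complex \<Rightarrow> complex) \<Rightarrow> (complex \<Rightarrow> complex) \<Rightarrow> complex set \<Rightarrow> enat \<Rightarrow> bool" where
  "share f g T k \<longleftrightarrow> E_set f T k = E_set g T k"

text \<open>
  Restricted sharing with respect to the blocks \<open>(S\<^sub>i, k\<^sub>i)\<close> of a partition of a finite set.
\<close>
definition share_restricted ::
  "(complex \<Rightarrow> complex) \<Rightarrow> (complex \<Rightarrow> complex) \<Rightarrow> (complex set \<times> enat) list \<Rightarrow> bool" where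
  "share_restricted f g Ts \<longleftrightarrow> (\<forall>(T, k) \<in> set Ts. share f g T k)"

end

theory Submission
  imports Defs "HOL-Computational_Algebra.Fundamental_Theorem_Algebra"
begin

text \<open>
  Put \<open>\<alpha> = \<alpha> 1\<close>. Since \<open>f\<close> and \<open>L\<close> share \<open>\<alpha>\<close> with multiplicities, and both have finitely many poles,
  \<open>f - \<alpha> = (L - \<alpha>) h\<close> with \<open>h(z) = R(z) exp(\<phi>(z))\<close>, where \<open>R\<close> is rational and \<open>\<phi>\<close> is entire. The proof
  controls \<open>\<phi>\<close> with a quantitative form of Picard's theorem, used in place of Nevanlinna theory, and then
  plays the size of \<open>L\<close> in a left half-plane against the rarity of two values of \<open>L\<close>.

  The quantitative tool is a logarithmic form of Schottky's theorem: if \<open>F\<close> omits 0 and 1 in a disc, then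
  \<open>1 + |ln |F||\<close> changes by at most a universal factor between the centre and a point of the disc of
  half the radius (\<open>log_Schottky\<close>). Chains of discs then give bounds along paths, just as
  Harnack's inequality does for positive harmonic functions. It is applied to \<open>F = 1 - f/\<alpha>\<close> and
  \<open>G = 1 - L/\<alpha>\<close>, which take the values 0 and 1 at the same places, namely where \<open>L\<close> takes the values
  \<open>\<alpha>\<close> and 0. Such points do not exist far to the right, because a Dirichlet series is dominated there by its
  first term, nor in the two left quadrants, because the functional equation makes \<open>|L|\<close> large there
  (\<open>functional_equation_growth\<close>). As \<open>L\<close> has finite order, the number of such points in a disc of radius \<open>r\<close>
  is bounded by a power of \<open>r\<close>, so there are circles of every size that pass them at a controlled distance.

  Hence \<open>Re \<phi>\<close>, which is \<open>ln |F| - ln |G| - ln |R|\<close>, grows at most polynomially in four quadrants and is at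
  most the exponential of a polynomial everywhere. The Phragmen-Lindelof principle in the half strips
  between the quadrants makes \<open>\<phi>\<close> a polynomial (\<open>exponent_polynomial\<close>). If its degree \<open>p\<close> were at least 2,
  then \<open>Re \<phi>\<close> would be of size \<open>|z|\<^sup>p\<close> in most directions of the right half-plane but of smaller size in some
  critical direction, which the logarithmic Schottky inequality for \<open>F\<close> forbids; so
  \<open>\<phi>(z) = c0 + c1 z\<close> (\<open>exponent_linear\<close>).

  Now let \<open>f\<close> differ from \<open>L\<close>, and let \<open>e = \<alpha> 2\<close>. Where \<open>L = 0\<close> also \<open>f = 0\<close>, so \<open>h = 1\<close>; where \<open>L = e\<close>, the
  value of \<open>f\<close> is one of the \<open>\<alpha> i\<close> with \<open>i \<ge> 2\<close>, so \<open>h\<close> lies in a fixed finite set. If \<open>h\<close> is not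
  constant, it takes each non-zero value only boundedly often in a high box of fixed size
  (\<open>sparse_solutions\<close>). If \<open>h\<close> is a constant \<open>\<kappa>\<close>, which is then different from 1, \<open>L\<close> omits 0 and
  \<open>\<alpha>(1 - 1/\<kappa>)\<close> up to finitely many points. Either way \<open>L\<close> takes two values so rarely that arbitrarily high up
  there are horizontal segments, from the right half-plane to a fixed vertical line on the left, that stay at
  a fixed distance from all points with these values. Along them \<open>|ln |L||\<close> stays bounded
  (\<open>omitted_values_crossing_bound\<close>), whereas \<open>|L|\<close> tends to infinity on the vertical line. This contradiction
  proves the theorem.

  The growth on the left needs at least one Gamma factor in the functional equation. Without Gamma factors,
  \<open>L\<close> would be a Dirichlet polynomial with coefficients \<open>a j\<close>. If \<open>L\<close> is not constant, comparison of
  the two sides of the functional equation shows that the last coefficient satisfies \<open>|a M| = sqrt M\<close> with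
  \<open>M = Q\<^sup>2 \<ge> 2\<close>. By multiplicativity some Euler factor is at least as large at its top degree, but
  the bound \<open>b j = O(j\<^sup>\<theta>)\<close> with \<open>\<theta> < 1/2\<close> keeps the roots of the Euler factors too far from the origin for
  that (\<open>degree_zero_constant\<close>).
\<close>

section \<open>Functions that omit 0 and 1\<close>

text \<open>
  Write \<open>F = exp g\<close> with \<open>|Im (g x)| \<le> pi\<close>. Since \<open>F\<close> omits 1, \<open>g\<close> omits all multiples of \<open>2 pi i\<close>, in particular
  \<open>2 pi n i\<close> and \<open>- 2 pi n i\<close>, where \<open>n\<close> is chosen comparable to \<open>1 + |ln |F x||\<close>. After an affine
  rescaling that moves these two values to 1 and 0, the centre value is bounded by an absolute constant,
  so Schottky's theorem bounds the rescaled \<open>g\<close> by an absolute constant. Undoing the scaling costs a factor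
  of order \<open>n\<close>, which gives an estimate linear in \<open>ln |F|\<close>.
\<close>
lemma log_Schottky:
  obtains C :: real where "C \<ge> 1"
    "\<And>F x y \<delta>. F holomorphic_on ball x \<delta> \<Longrightarrow> (\<And>z. z \<in> ball x \<delta> \<Longrightarrow> F z \<noteq> 0 \<and> F z \<noteq> 1) \<Longrightarrow>
        dist x y \<le> \<delta> / 2 \<Longrightarrow> \<delta> > 0 \<Longrightarrow> 1 + \<bar>ln (norm (F y))\<bar> \<le> C * (1 + \<bar>ln (norm (F x))\<bar>)"
proof -
  \<comment> \<open>the constant of Schottky's theorem for centre values of norm at most 2 and radius \<open>2/3\<close>\<close>
  define C0 where "C0 = exp (pi * exp (pi * (2 + 2 * 2 + 12 * (2/3) / (1 - 2/3))))"
  define C where "C = 100 * (C0 + 1)"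
  have C0: "C0 \<ge> 1" by (simp add: C0_def)
  have "1 + \<bar>ln (norm (F y))\<bar> \<le> C * (1 + \<bar>ln (norm (F x))\<bar>)"
    if F: "F holomorphic_on ball x \<delta>" and om: "\<And>z. z \<in> ball x \<delta> \<Longrightarrow> F z \<noteq> 0 \<and> F z \<noteq> 1"
      and xy: "dist x y \<le> \<delta> / 2" and d: "\<delta> > 0" for F x y and \<delta> :: real
  proof -
    obtain g0 where g0: "g0 holomorphic_on ball x \<delta>" "\<forall>z\<in>ball x \<delta>. F z = exp (g0 z)"
      using holomorphic_logarithm_exists[OF convex_ball open_ball F _ centre_in_ball[THEN iffD2, OF d]] om
      by metis
    have Fx: "F x \<noteq> 0" using om[of x] d by auto
    define g where "g = (\<lambda>z. g0 z - g0 x + Ln (F x))"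
    have g: "g holomorphic_on ball x \<delta>" unfolding g_def by (intro holomorphic_intros g0)
    have gF: "F z = exp (g z)" if "z \<in> ball x \<delta>" for z
      using g0(2) that d Fx by (simp add: g_def exp_add exp_diff)
    have gom: "g z \<noteq> 2 * of_int k * of_real pi * \<i>" if "z \<in> ball x \<delta>" for z k
      using om[OF that] gF[OF that] exp_integer_2pi[of "of_int k"] by (auto simp: mult_ac)
    define n where "n = nat \<lceil>1 + \<bar>ln (norm (F x))\<bar>\<rceil>"
    have n: "real n \<ge> 1 + \<bar>ln (norm (F x))\<bar>" "real n \<le> 2 + \<bar>ln (norm (F x))\<bar>"
      by (auto simp: n_def) linarith+
    define w where "w = 2 * complex_of_nat n * of_real pi * \<i>"
    have nw: "norm w = 2 * n * pi" by (simp add: w_def norm_mult)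
    have w0: "w \<noteq> 0" using nw n by auto
    \<comment> \<open>the radius \<open>3/4 \<delta>\<close> leaves room to apply the theorem on a closed disc that still contains \<open>y\<close>\<close>
    define G where "G = (\<lambda>z. (g (x + of_real (3/4*\<delta>) * z) + w) / (2 * w))"
    have inb: "x + of_real (3/4*\<delta>) * z \<in> ball x \<delta>" if "z \<in> cball 0 1" for z :: complex
    proof -
      have "norm z * (3 * \<delta>) \<le> 1 * (3 * \<delta>)" using that d by (intro mult_right_mono) auto
      thus ?thesis using d by (simp add: dist_norm norm_mult mult_ac)
    qed
    have holG: "G holomorphic_on cball 0 1" unfolding G_def
      by (intro holomorphic_intros holomorphic_on_compose_gen[OF _ g, unfolded o_def]) (use inb w0 in auto)
    have Gom: "\<not> (G z = 0 \<or> G z = 1)" if "z \<in> cball 0 1" for z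
    proof
      assume "G z = 0 \<or> G z = 1"
      hence "g (x + of_real (3/4*\<delta>) * z) = -w \<or> g (x + of_real (3/4*\<delta>) * z) = w"
        using w0 by (auto simp: G_def field_simps add_eq_0_iff)
      thus False using gom[OF inb[OF that], of "int n"] gom[OF inb[OF that], of "- int n"]
        by (auto simp: w_def)
    qed
    have ngx: "norm (g x) \<le> \<bar>ln (norm (F x))\<bar> + pi"
    proof -
      have "norm (g x) \<le> \<bar>Re (g x)\<bar> + \<bar>Im (g x)\<bar>" by (rule cmod_le)
      moreover have "Re (g x) = ln (norm (F x))" using Fx by (simp add: g_def)
      moreover have "\<bar>Im (g x)\<bar> \<le> pi" using Fx mpi_less_Im_Ln[OF Fx] Im_Ln_le_pi[OF Fx] by (simp add: g_def)
      ultimately show ?thesis by simp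
    qed
    have npi: "real n * pi \<ge> real n" using pi_ge_two n(1) by (simp add: mult_le_cancel_left1)
    have pin: "real n * pi \<ge> pi" using n(1) pi_gt_zero by (simp add: mult_le_cancel_right1)
    have G0: "norm (G 0) \<le> 2"
    proof -
      have "norm (G 0) = norm (g x + w) / (4 * n * pi)" by (simp add: G_def norm_divide norm_mult nw)
      also have "norm (g x + w) \<le> norm (g x) + norm w" by (rule norm_triangle_ineq)
      also have "\<dots> \<le> real n + pi + 2 * n * pi" using ngx n nw by simp
      also have "\<dots> \<le> 2 * (4 * n * pi)" using npi pin by linarith
      finally show ?thesis using n(1) by (simp add: divide_simps split: if_splits)
    qed
    define z where "z = (y - x) / of_real (3/4*\<delta>)"
    have "of_real (3/4*\<delta>) \<noteq> (0::complex)" using d by (simp del: of_real_mult of_real_divide)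
    hence z: "x + of_real (3/4*\<delta>) * z = y"
      unfolding z_def times_divide_eq_right by (subst nonzero_mult_div_cancel_left) auto
    have "norm z = dist x y / (3/4*\<delta>)" using d by (simp only: z_def norm_divide norm_of_real dist_norm norm_minus_commute[of y x])
    also have "\<dots> \<le> 2/3" using xy d by (simp add: divide_simps)
    finally have nz: "norm z \<le> 2/3" .
    have "norm (G z) \<le> C0" unfolding C0_def
      by (rule Schottky[OF holG G0 Gom]) (use nz in auto)
    hence "norm (g y + w) \<le> C0 * (4 * n * pi)" using n(1) z by (simp add: G_def norm_divide norm_mult nw divide_simps mult_ac)
    hence "norm (g y) \<le> C0 * (4 * n * pi) + 2 * n * pi"
      using norm_triangle_ineq4[of "g y + w" w] nw by simp
    also have "\<dots> \<le> C0 * (16 * n) + 8 * n"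
    proof -
      have "pi * real n \<le> 4 * real n" using pi_less_4 by (intro mult_right_mono) auto
      moreover from this have "C0 * (pi * real n) \<le> C0 * (4 * real n)" using C0 by (intro mult_left_mono) auto
      ultimately show ?thesis by (simp add: mult_ac)
    qed
    finally have gy: "norm (g y) \<le> (16 * C0 + 8) * real n" by (simp add: algebra_simps)
    have "dist x y < \<delta>" using xy d by simp
    hence yb: "y \<in> ball x \<delta>" by simp
    have "\<bar>ln (norm (F y))\<bar> = \<bar>Re (g y)\<bar>" using gF[OF yb] by simp
    also have "\<dots> \<le> (16 * C0 + 8) * real n" using abs_Re_le_cmod gy order_trans by blast
    also have "\<dots> \<le> (16 * C0 + 8) * (2 * (1 + \<bar>ln (norm (F x))\<bar>))"
      using n C0 by (intro mult_left_mono) auto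
    also have "1 + \<dots> \<le> C * (1 + \<bar>ln (norm (F x))\<bar>)"
    proof -
      have "1 * 1 \<le> C0 * (1 + \<bar>ln (norm (F x))\<bar>)" using C0 by (intro mult_mono) auto
      thus ?thesis using mult_nonneg_nonneg[of C0 "\<bar>ln (norm (F x))\<bar>"] C0 by (simp add: C_def algebra_simps)
    qed
    finally show ?thesis by simp
  qed
  moreover have "C \<ge> 1" using C0 by (simp add: C_def)
  ultimately show ?thesis using that by blast
qed

text \<open>
  A name for the constants provided by the logarithmic Schottky inequality, so that one constant can be
  fixed and used for several functions.
\<close>
definition schottky_const :: "real \<Rightarrow> bool" where
  "schottky_const C \<longleftrightarrow> C \<ge> 1 \<and>
     (\<forall>F x y \<delta>. F holomorphic_on ball x \<delta> \<longrightarrow> (\<forall>z\<in>ball x \<delta>. F z \<noteq> 0 \<and> F z \<noteq> 1) \<longrightarrow>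
        dist x y \<le> \<delta> / 2 \<longrightarrow> \<delta> > 0 \<longrightarrow> 1 + \<bar>ln (norm (F y))\<bar> \<le> C * (1 + \<bar>ln (norm (F x))\<bar>))"

lemma schottky_const_exists: obtains C where "schottky_const C"
proof (rule log_Schottky)
  fix C :: real assume C: "C \<ge> 1"
    "\<And>F x y \<delta>. F holomorphic_on ball x \<delta> \<Longrightarrow> (\<And>z. z \<in> ball x \<delta> \<Longrightarrow> F z \<noteq> 0 \<and> F z \<noteq> 1) \<Longrightarrow>
        dist x y \<le> \<delta> / 2 \<Longrightarrow> \<delta> > 0 \<Longrightarrow> 1 + \<bar>ln (norm (F y))\<bar> \<le> C * (1 + \<bar>ln (norm (F x))\<bar>)"
  show thesis by (rule that[of C]) (use C in \<open>auto simp: schottky_const_def\<close>)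
qed

lemma schottky_constD:
  assumes "schottky_const C"
  shows "C \<ge> 1"
    and "F holomorphic_on ball x \<delta> \<Longrightarrow> (\<And>z. z \<in> ball x \<delta> \<Longrightarrow> F z \<noteq> 0 \<and> F z \<noteq> 1) \<Longrightarrow>
        dist x y \<le> \<delta> / 2 \<Longrightarrow> \<delta> > 0 \<Longrightarrow> 1 + \<bar>ln (norm (F y))\<bar> \<le> C * (1 + \<bar>ln (norm (F x))\<bar>)"
  using assms unfolding schottky_const_def by blast+

text \<open>
  A Harnack inequality compares \<open>W\<close> at points whose distance is at most half their distance to the
  boundary of the quadrant. From \<open>Complex 1 1\<close> one reaches \<open>z\<close> along the diagonal and then parallel to an axis, in
  steps that change a coordinate by a factor of at most \<open>5/4\<close>. The number of steps is of order \<open>ln |z|\<close>, and a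
  constant to that power is a power of \<open>|z|\<close>.
\<close>
lemma harnack_chain_quadrant:
  fixes C :: real and W :: "complex \<Rightarrow> real"
  assumes C: "C \<ge> 1" and W: "\<And>z. 0 < Re z \<Longrightarrow> 0 < Im z \<Longrightarrow> 1 \<le> W z"
    and harnack: "\<And>x y. 0 < Re x \<Longrightarrow> 0 < Im x \<Longrightarrow> dist x y \<le> min (Re x) (Im x) / 2 \<Longrightarrow> W y \<le> C * W x"
  obtains K N where "\<And>z. 1 \<le> Re z \<Longrightarrow> 1 \<le> Im z \<Longrightarrow> W z \<le> K * norm z ^ N"
proof -
  have diag: "W (Complex x x) \<le> C ^ j * W (Complex 1 1)" if "1 \<le> x" "x \<le> (5/4) ^ j" for x j
    using that
  proof (induction j arbitrary: x)
    case 0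
    hence "x = 1" by simp
    then show ?case by simp
  next
    case (Suc j)
    define x' where "x' = max 1 (4/5 * x)"
    have x': "1 \<le> x'" "x' \<le> (5/4)^j" "x - x' \<le> x' / 4" "x' \<le> x" using Suc.prems by (auto simp: x'_def max_def)
    have "dist (Complex x' x') (Complex x x) = sqrt 2 * (x - x')"
    proof -
      have "dist (Complex x' x') (Complex x x) = sqrt ((x' - x)\<^sup>2 + (x' - x)\<^sup>2)"
        by (simp add: dist_norm complex_norm complex_diff)
      also have "\<dots> = sqrt (2 * (x - x')\<^sup>2)" by (simp add: power2_commute)
      finally show ?thesis using x' by (simp add: real_sqrt_mult)
    qed
    also have "\<dots> \<le> 2 * (x - x')" using x' real_sqrt_le_mono[of 2 4] by (intro mult_right_mono) auto
    also have "\<dots> \<le> x' / 2" using x' by simp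
    finally have "W (Complex x x) \<le> C * W (Complex x' x')" using x' by (intro harnack) auto
    also have "\<dots> \<le> C * (C ^ j * W (Complex 1 1))" using C x' by (intro mult_left_mono Suc.IH) auto
    finally show ?case by (simp add: mult_ac)
  qed
  have up: "V (Complex x y) \<le> C ^ j * V (Complex x x)"
    if V: "\<And>x y. 0 < Re x \<Longrightarrow> 0 < Im x \<Longrightarrow> dist x y \<le> min (Re x) (Im x) / 2 \<Longrightarrow> V y \<le> C * V x"
      and "1 \<le> x" "1 \<le> y" "y \<le> x" "x \<le> (5/4)^j * y" for V :: "complex \<Rightarrow> real" and x y j
    using that(2-)
  proof (induction j arbitrary: y)
    case 0
    hence "x = y" by simp
    then show ?case by simp
  next
    case (Suc j)
    define y' where "y' = min x (5/4 * y)"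
    have y': "1 \<le> y'" "y' \<le> x" "y \<le> y'" "y' \<le> 5/4 * y" using Suc.prems by (auto simp: y'_def min_def)
    have "x \<le> (5/4)^j * y'"
    proof (cases "x \<le> 5/4*y")
      case True
      have "x * 1 \<le> x * (5/4)^j" using Suc.prems by (intro mult_left_mono) auto
      then show ?thesis using True by (simp add: y'_def mult_ac)
    qed (use Suc.prems in \<open>simp add: y'_def mult_ac\<close>)
    hence "V (Complex x y') \<le> C^j * V (Complex x x)" using Suc y' by (intro Suc.IH) auto
    moreover have "V (Complex x y) \<le> C * V (Complex x y')"
    proof (rule V)
      have "dist (Complex x y') (Complex x y) = y' - y" using y' by (simp add: dist_norm complex_diff complex_norm)
      thus "dist (Complex x y') (Complex x y) \<le> min (Re (Complex x y')) (Im (Complex x y')) / 2" using y' by auto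
    qed (use Suc.prems y' in auto)
    ultimately show ?case using C by (simp add: mult_ac) (meson dual_order.trans mult_left_mono zero_le_one order_trans)
  qed
  have up1: "W (Complex x y) \<le> C ^ j * W (Complex x x)" if "1 \<le> x" "1 \<le> y" "y \<le> x" "x \<le> (5/4)^j * y" for x y j
    by (rule up[where V = W, OF harnack that])
  have up2: "W (Complex y x) \<le> C ^ j * W (Complex x x)" if "1 \<le> x" "1 \<le> y" "y \<le> x" "x \<le> (5/4)^j * y" for x y j
  proof -
    define V where "V = (\<lambda>z. W (Complex (Im z) (Re z)))"
    have "V y \<le> C * V x" if "0 < Re x" "0 < Im x" "dist x y \<le> min (Re x) (Im x) / 2" for x y
    proof -
      have "dist (Complex (Im x) (Re x)) (Complex (Im y) (Re y)) = dist x y"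
        by (simp add: dist_norm cmod_def add.commute)
      thus ?thesis unfolding V_def using that by (intro harnack) auto
    qed
    from up[where V = V, OF this that] show ?thesis by (simp add: V_def)
  qed
  obtain N where N: "C\<^sup>2 < (5/4) ^ N" using real_arch_pow[of "5/4" "C\<^sup>2"] by auto
  define K where "K = (5/4) ^ N * W (Complex 1 1)"
  have "W z \<le> K * norm z ^ N" if z: "1 \<le> Re z" "1 \<le> Im z" for z
  proof -
    define m where "m = max (Re z) (Im z)"
    have m: "1 \<le> m" "m \<le> norm z" using z complex_Re_le_cmod[of z] abs_Im_le_cmod[of z] by (auto simp: m_def)
    define P where "P = (\<lambda>j. m \<le> (5/4::real) ^ j)"
    have "\<exists>j. P j" using real_arch_pow[of "5/4" m] unfolding P_def by (auto intro: less_imp_le)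
    \<comment> \<open>the least number of steps, so that \<open>(5/4) ^ j\<close> is still comparable to \<open>|z|\<close>\<close>
    define j where "j = (LEAST j. P j)"
    have Pj: "P j" unfolding j_def using \<open>\<exists>j. P j\<close> by (rule LeastI_ex)
    have jm: "(5/4) ^ j \<le> 5/4 * m"
    proof (cases j)
      case (Suc i)
      hence "\<not> P i" unfolding j_def by (metis lessI not_less_Least)
      thus ?thesis using Suc by (simp add: P_def)
    qed (use m in auto)
    have "W z \<le> C ^ j * W (Complex m m)"
    proof (cases "Im z \<le> Re z")
      case True
      have "Re z \<le> (5/4)^j * Im z"
      proof -
        have "Re z \<le> (5/4)^j * 1" using Pj unfolding P_def m_def by simp
        also have "\<dots> \<le> (5/4)^j * Im z" using z by (intro mult_left_mono) auto
        finally show ?thesis .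
      qed
      from up1[OF z(1) z(2) True this] True show ?thesis by (simp add: m_def)
    next
      case False
      have "Im z \<le> (5/4)^j * Re z"
      proof -
        have "Im z \<le> (5/4)^j * 1" using Pj unfolding P_def m_def by simp
        also have "\<dots> \<le> (5/4)^j * Re z" using z by (intro mult_left_mono) auto
        finally show ?thesis .
      qed
      from up2[OF z(2) z(1) _ this] False show ?thesis by (simp add: m_def)
    qed
    also have "\<dots> \<le> C ^ j * (C ^ j * W (Complex 1 1))"
      using m Pj C unfolding P_def by (intro mult_left_mono diag) auto
    also have "\<dots> = (C\<^sup>2) ^ j * W (Complex 1 1)" by (simp add: power2_eq_square power_mult_distrib)
    also have "\<dots> \<le> ((5/4)^N) ^ j * W (Complex 1 1)"
      using N W[of "Complex 1 1"] by (intro mult_right_mono power_mono) auto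
    also have "((5/4::real)^N) ^ j = ((5/4)^j) ^ N" by (metis power_mult mult.commute)
    also have "\<dots> * W (Complex 1 1) \<le> (5/4 * norm z) ^ N * W (Complex 1 1)"
      using jm m W[of "Complex 1 1"] by (intro mult_right_mono power_mono) auto
    also have "\<dots> = K * norm z ^ N" unfolding power_mult_distrib by (simp add: K_def)
    finally show ?thesis .
  qed
  thus ?thesis using that by blast
qed

text \<open>
  The quadrant has corner \<open>c\<close> and is rotated by \<open>u\<close>; the substitution \<open>z = c + u w\<close> reduces it to the first one.
\<close>
lemma omitted_values_quadrant_bound:
  fixes F :: "complex \<Rightarrow> complex" and u c :: complex
  assumes u: "norm u = 1"
    and F: "F holomorphic_on {z. Re ((z - c) / u) > 0 \<and> Im ((z - c) / u) > 0}"
    and om: "\<And>z. Re ((z - c) / u) > 0 \<Longrightarrow> Im ((z - c) / u) > 0 \<Longrightarrow> F z \<noteq> 0 \<and> F z \<noteq> 1"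
  obtains K N where "\<And>z. 1 \<le> Re ((z - c) / u) \<Longrightarrow> 1 \<le> Im ((z - c) / u) \<Longrightarrow>
      1 + \<bar>ln (norm (F z))\<bar> \<le> K * norm (z - c) ^ N"
proof -
  obtain C where SC: "schottky_const C" using schottky_const_exists by blast
  note C = schottky_constD[OF SC]
  have u0: "u \<noteq> 0" using u by auto
  define G where "G = (\<lambda>z. F (c + u * z))"
  have holG: "G holomorphic_on {z. Re z > 0 \<and> Im z > 0}" unfolding G_def
    by (intro holomorphic_on_compose_gen[OF _ F, unfolded o_def] holomorphic_intros) (use u0 in auto)
  have omG: "G z \<noteq> 0 \<and> G z \<noteq> 1" if "Re z > 0" "Im z > 0" for z
    using om[of "c + u * z"] that u0 by (simp add: G_def)
  define W where "W = (\<lambda>z. 1 + \<bar>ln (norm (G z))\<bar>)"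
  obtain K N where KN: "\<And>z. 1 \<le> Re z \<Longrightarrow> 1 \<le> Im z \<Longrightarrow> W z \<le> K * norm z ^ N"
  proof (rule harnack_chain_quadrant[OF C(1), of W])
    fix z :: complex assume "0 < Re z" "0 < Im z"
    show "1 \<le> W z" by (simp add: W_def)
  next
    fix x y :: complex assume xy: "0 < Re x" "0 < Im x" "dist x y \<le> min (Re x) (Im x) / 2"
    define \<delta> where "\<delta> = min (Re x) (Im x)"
    have sub: "Re z > 0 \<and> Im z > 0" if "z \<in> ball x \<delta>" for z
    proof -
      have "\<bar>Re (x - z)\<bar> < \<delta>" "\<bar>Im (x - z)\<bar> < \<delta>" using that abs_Re_le_cmod[of "x - z"] abs_Im_le_cmod[of "x - z"]
        by (auto simp: dist_norm)
      thus ?thesis by (auto simp: \<delta>_def)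
    qed
    show "W y \<le> C * W x" unfolding W_def
    proof (rule C(2)[where F = G and x = x and y = y and \<delta> = \<delta>])
      show "G holomorphic_on ball x \<delta>" by (rule holomorphic_on_subset[OF holG]) (use sub in auto)
      show "G z \<noteq> 0 \<and> G z \<noteq> 1" if "z \<in> ball x \<delta>" for z
        using omG[of z] sub[OF that] by blast
      show "dist x y \<le> \<delta> / 2" "\<delta> > 0" using xy by (simp_all add: \<delta>_def)
    qed
  qed blast
  show ?thesis
  proof (rule that)
    fix z assume "1 \<le> Re ((z - c) / u)" "1 \<le> Im ((z - c) / u)"
    from KN[OF this] show "1 + \<bar>ln (norm (F z))\<bar> \<le> K * norm (z - c) ^ N"
      using u0 u by (simp add: W_def G_def norm_divide)
  qed
qed

section \<open>Growth and zeros of entire functions\<close>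

text \<open>
  Borel-Caratheodory for the derivative: \<open>w = \<phi>(s + z) - \<phi>(s)\<close> has real part at most \<open>2 M\<close>, so \<open>w / (6 M - w)\<close> maps the
  unit disc into itself and fixes 0, and the Schwarz lemma bounds its derivative there.
\<close>
lemma deriv_bound_of_Re_bound:
  fixes \<phi> :: "complex \<Rightarrow> complex"
  assumes hol: "\<phi> holomorphic_on ball s 1" and M: "M > 0"
    and bd: "\<And>z. z \<in> ball s 1 \<Longrightarrow> \<bar>Re (\<phi> z)\<bar> \<le> M"
  shows "norm (deriv \<phi> s) \<le> 6 * M"
proof -
  define w where "w = (\<lambda>z. \<phi> (s + z) - \<phi> s)"
  have holw: "w holomorphic_on ball 0 1" unfolding w_def
    by (intro holomorphic_intros holomorphic_on_compose_gen[OF _ hol, unfolded o_def]) (auto simp: dist_norm)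
  have Rew: "Re (w z) \<le> 2 * M" if "z \<in> ball 0 1" for z
    using bd[of "s + z"] bd[of s] that by (auto simp: w_def dist_norm)
  define G where "G = (\<lambda>z. w z / (of_real (6 * M) - w z))"
  have nz: "of_real (6 * M) - w z \<noteq> 0" if "z \<in> ball 0 1" for z
    using Rew[OF that] M by (auto simp: complex_eq_iff)
  have holG: "G holomorphic_on ball 0 1" unfolding G_def by (intro holomorphic_intros holw) (use nz in auto)
  have G1: "norm (G z) < 1" if "norm z < 1" for z
  proof -
    have z: "z \<in> ball 0 1" using that by simp
    have "(norm (w z))\<^sup>2 < (norm (of_real (6 * M) - w z))\<^sup>2"
    proof -
      have "(6 * M - Re (w z))\<^sup>2 - (Re (w z))\<^sup>2 = 12 * M * (3 * M - Re (w z))"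
        by (simp add: power2_eq_square algebra_simps)
      also have "\<dots> > 0" using Rew[OF z] M by (intro mult_pos_pos) auto
      finally show ?thesis by (simp add: cmod_power2)
    qed
    hence "norm (w z) < norm (of_real (6 * M) - w z)" by (rule power2_less_imp_less) simp
    thus ?thesis using nz[OF z] by (simp add: G_def norm_divide)
  qed
  have "norm (deriv G 0) \<le> 1"
    by (rule Schwarz_Lemma(2)[OF holG _ G1, of 0]) (auto simp: G_def w_def)
  moreover have "deriv G 0 = deriv \<phi> s / of_real (6 * M)"
  proof (rule DERIV_imp_deriv)
    have "(\<phi> has_field_derivative deriv \<phi> s) (at (0 + s))"
      using holomorphic_derivI[OF hol, of s] by simp
    hence "((\<lambda>z. \<phi> (s + z)) has_field_derivative deriv \<phi> s) (at 0)"
      by (simp only: DERIV_shift add.commute[of s])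
    hence w': "(w has_field_derivative deriv \<phi> s) (at 0)" unfolding w_def
      using DERIV_diff[OF _ DERIV_const[of "\<phi> s"]] by fastforce
    have w0: "w 0 = 0" by (simp add: w_def)
    have "((\<lambda>z. w z / (of_real (6 * M) - w z)) has_field_derivative
        (deriv \<phi> s * (of_real (6 * M) - w 0) - w 0 * (0 - deriv \<phi> s)) /
        ((of_real (6 * M) - w 0) * (of_real (6 * M) - w 0))) (at 0)"
      by (intro DERIV_divide w' DERIV_diff DERIV_const nz) auto
    thus "(G has_field_derivative deriv \<phi> s / of_real (6 * M)) (at 0)"
      using M unfolding G_def w0 by simp
  qed
  ultimately show ?thesis using M by (simp add: norm_divide norm_mult)
qed

lemma power_le_exp_eventually:
  fixes C c \<kappa> :: real
  assumes "c > 0" "\<kappa> > 0"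
  obtains X where "\<And>x. x \<ge> X \<Longrightarrow> C * x ^ k \<le> c * exp (\<kappa> * x)"
proof -
  have "((\<lambda>x. (\<kappa> * x) ^ k / exp (\<kappa> * x)) \<longlongrightarrow> 0) at_top"
    using filterlim_compose[OF tendsto_power_div_exp_0[of k] filterlim_tendsto_pos_mult_at_top[OF tendsto_const assms(2) filterlim_ident]]
    by simp
  hence "((\<lambda>x. C / \<kappa> ^ k * ((\<kappa> * x) ^ k / exp (\<kappa> * x))) \<longlongrightarrow> 0) at_top"
    using tendsto_mult_right_zero by blast
  hence "eventually (\<lambda>x. C / \<kappa> ^ k * ((\<kappa> * x) ^ k / exp (\<kappa> * x)) < c) at_top"
    by (rule order_tendstoD) fact
  then obtain X where "\<And>x. x \<ge> X \<Longrightarrow> C / \<kappa> ^ k * ((\<kappa> * x) ^ k / exp (\<kappa> * x)) < c"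
    unfolding eventually_at_top_linorder by blast
  hence "C * x ^ k \<le> c * exp (\<kappa> * x)" if "x \<ge> X" for x
  proof -
    have "C * x ^ k = C / \<kappa> ^ k * ((\<kappa> * x) ^ k / exp (\<kappa> * x)) * exp (\<kappa> * x)"
      using assms by (simp add: power_mult_distrib)
    also have "\<dots> \<le> c * exp (\<kappa> * x)"
      using \<open>\<And>x. x \<ge> X \<Longrightarrow> _\<close>[OF that] by (intro mult_right_mono) auto
    finally show ?thesis .
  qed
  thus ?thesis using that by blast
qed

text \<open>
  After division by \<open>z ^ N\<close> the function is bounded on the boundary of the half strip. Multiplication by
  \<open>exp (- \<epsilon> cosh (z / A))\<close> beats the growth \<open>exp (C |z| ^ k)\<close>, because \<open>Re (cosh (z / A)) = cosh (x / A) cos (y / A)\<close> grows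
  exponentially and \<open>|y / A| \<le> 1 < pi / 2\<close>. The maximum principle on long rectangles and \<open>\<epsilon> \<rightarrow> 0\<close> give the bound
  inside.
\<close>
lemma phragmen_lindelof_half_strip:
  fixes g :: "complex \<Rightarrow> complex"
  assumes hol: "g holomorphic_on UNIV" and A: "A \<ge> 1"
    and crude: "\<And>z. norm z \<ge> R \<Longrightarrow> norm (g z) \<le> exp (C * norm z ^ k)"
    and side: "\<And>z. Re z \<ge> A \<Longrightarrow> \<bar>Im z\<bar> = A \<Longrightarrow> norm (g z) \<le> K * norm z ^ N"
  obtains K' where "\<And>z. Re z \<ge> A \<Longrightarrow> \<bar>Im z\<bar> \<le> A \<Longrightarrow> norm (g z) \<le> K' * norm z ^ N"
proof -
  define f where "f = (\<lambda>z. g z / z ^ N)"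
  have holf: "f holomorphic_on {z. Re z > 0}" unfolding f_def
    by (intro holomorphic_intros holomorphic_on_subset[OF hol]) auto
  have "compact (cbox (Complex A (-A)) (Complex A A))" by (rule compact_cbox)
  moreover have "continuous_on (cbox (Complex A (-A)) (Complex A A)) f"
    by (rule holomorphic_on_imp_continuous_on[OF holomorphic_on_subset[OF holf]]) (use A in \<open>auto simp: in_cbox_complex_iff\<close>)
  ultimately have "bounded (f ` cbox (Complex A (-A)) (Complex A A))"
    by (meson compact_continuous_image compact_imp_bounded)
  then obtain B0 where B0: "\<And>z. z \<in> cbox (Complex A (-A)) (Complex A A) \<Longrightarrow> norm (f z) \<le> B0"
    unfolding bounded_iff by blast
  define B where "B = max 1 (max B0 K)"
  have B: "B \<ge> 1" "B \<ge> B0" "B \<ge> K" by (auto simp: B_def)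
  \<comment> \<open>\<open>cosh (z / A)\<close>\<close>
  define h where "h = (\<lambda>z::complex. (exp (z / of_real A) + exp (- (z / of_real A))) / 2)"
  have Reh: "Re (h z) = cosh (Re z / A) * cos (Im z / A)" for z
    by (simp add: h_def Re_exp cosh_def algebra_simps)
  have cos_ge: "cos (y / A) \<ge> cos 1" "cos 1 > (0::real)" if "\<bar>y\<bar> \<le> A" for y :: real
  proof -
    have "cos 1 \<le> cos \<bar>y / A\<bar>" using that A pi_ge_two by (intro cos_monotone_0_pi_le) (auto simp: field_simps)
    thus "cos (y / A) \<ge> cos 1" by (metis cos_abs_real)
    show "cos 1 > (0::real)" using cos_gt_zero_pi[of 1] pi_gt3 by simp
  qed
  have holh: "h holomorphic_on UNIV" unfolding h_def by (intro holomorphic_intros) (use A in auto)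
  have fB: "norm (f z) \<le> B" if z: "Re z \<ge> A" "\<bar>Im z\<bar> \<le> A" for z
  proof -
    have key: "norm (f z) \<le> B * exp (\<epsilon> * Re (h z))" if e: "\<epsilon> > 0" for \<epsilon>
    proof -
      define G where "G = (\<lambda>z. f z * exp (- (of_real \<epsilon> * h z)))"
      have nG: "norm (G w) = norm (f w) * exp (- \<epsilon> * Re (h w))" for w by (simp add: G_def norm_mult)
      have "\<epsilon> * cos 1 / 2 > 0" "1 / A > 0" using e A cos_ge(2)[of 0] by auto
      then have "\<exists>X'. \<forall>x. x \<ge> X' \<longrightarrow> (\<bar>C\<bar> * 2 ^ k) * x ^ k \<le> (\<epsilon> * cos 1 / 2) * exp (1 / A * x)"
        using power_le_exp_eventually by metis
      then obtain X' where X': "\<And>x. x \<ge> X' \<Longrightarrow> (\<bar>C\<bar> * 2 ^ k) * x ^ k \<le> (\<epsilon> * cos 1 / 2) * exp (1 / A * x)" by blast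
      \<comment> \<open>the right edge of the rectangle, so far out that the damping factor wins there\<close>
      define Y where "Y = max (max X' R) (max (Re z) A)"
      have Y: "Y \<ge> X'" "Y \<ge> R" "Y \<ge> Re z" "Y \<ge> A" by (auto simp: Y_def)
      have pos: "Re (h w) \<ge> 0" if "\<bar>Im w\<bar> \<le> A" for w
        using cos_ge[OF that] by (simp add: Reh)
      define S where "S = cbox (Complex A (-A)) (Complex Y A)"
      have Sin: "w \<in> S \<longleftrightarrow> A \<le> Re w \<and> Re w \<le> Y \<and> \<bar>Im w\<bar> \<le> A" for w by (auto simp: S_def in_cbox_complex_iff)
      have holG: "G holomorphic_on S" unfolding G_def
        by (intro holomorphic_intros holomorphic_on_subset[OF holf] holomorphic_on_subset[OF holh])
           (use A Sin in force)+
      have "norm (G z) \<le> B"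
      proof (rule maximum_modulus_frontier[where f = G and \<xi> = z and S = S])
        show "G holomorphic_on interior S" using holG interior_subset holomorphic_on_subset by blast
        show "continuous_on (closure S) G" using holG by (simp add: S_def holomorphic_on_imp_continuous_on)
        show "bounded S" by (simp add: S_def)
        show "z \<in> S" using Sin z Y by auto
        fix w assume w: "w \<in> frontier S"
        have wS: "w \<in> S" using w by (simp add: S_def frontier_def)
        have wn: "w \<notin> box (Complex A (-A)) (Complex Y A)" using w by (simp add: S_def frontier_def)
        have wA: "norm w \<ge> Re w" "Re w \<ge> A" using complex_Re_le_cmod wS Sin by auto
        have le: "norm (G w) \<le> norm (f w)"
          using pos[of w] wS Sin e by (simp add: nG mult_left_le)
        consider "Re w = A" | "Re w = Y" | "\<bar>Im w\<bar> = A"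
          using wn wS Sin by (fastforce simp: in_box_complex_iff)
        thus "norm (G w) \<le> B"
        proof cases
          case 1
          hence "norm (f w) \<le> B0" using wS Sin by (intro B0) (auto simp: in_cbox_complex_iff)
          thus ?thesis using le B by linarith
        next
          case 3
          have "norm (f w) = norm (g w) / norm w ^ N" by (simp add: f_def norm_divide norm_power)
          also have "\<dots> \<le> (K * norm w ^ N) / norm w ^ N"
            using side[of w] 3 wS Sin by (intro divide_right_mono) auto
          also have "\<dots> = K" using wA A by (subst nonzero_mult_div_cancel_right) auto
          finally show ?thesis using le B by linarith
        next
          case 2
          have w0: "norm w > 0" using wA A by linarith
          have wY: "norm w \<le> 2 * Y" using cmod_le[of w] wS Sin Y 2 A by auto
          have nR: "norm w \<ge> R" using wA 2 Y by linarith
          have "norm (f w) = norm (g w) / norm w ^ N" by (simp add: f_def norm_divide norm_power)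
          also have "\<dots> \<le> norm (g w) / 1" using wA A w0 by (intro divide_left_mono) (auto intro: one_le_power)
          also have "\<dots> \<le> exp (C * norm w ^ k)" using crude[OF nR] by simp
          also have "\<dots> \<le> exp (\<bar>C\<bar> * (2 * Y) ^ k)" using mult_mono[OF abs_ge_self[of C] power_mono[OF wY norm_ge_zero, of k]] by simp
          also have "\<dots> = exp (\<bar>C\<bar> * 2 ^ k * Y ^ k)" by (simp add: power_mult_distrib)
          also have "\<dots> \<le> exp ((\<epsilon> * cos 1 / 2) * exp (1 / A * Y))" using X'[OF Y(1)] by simp
          finally have 1: "norm (f w) \<le> exp ((\<epsilon> * cos 1 / 2) * exp (Y / A))" by simp
          have "cos 1 * (exp (Y / A) / 2) \<le> cos (Im w / A) * cosh (Y / A)"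
            using cos_ge[of "Im w"] wS Sin by (intro mult_mono) (auto simp: cosh_def)
          hence "\<epsilon> * (cos 1 * (exp (Y / A) / 2)) \<le> \<epsilon> * Re (h w)"
            unfolding Reh 2 using e by (intro mult_left_mono) (auto simp: mult_ac)
          hence 2: "exp (- \<epsilon> * Re (h w)) \<le> exp (- ((\<epsilon> * cos 1 / 2) * exp (Y / A)))" by simp
          have "norm (G w) \<le> exp ((\<epsilon> * cos 1 / 2) * exp (Y / A)) * exp (- ((\<epsilon> * cos 1 / 2) * exp (Y / A)))"
            unfolding nG by (intro mult_mono 1 2) auto
          also have "\<dots> = 1" by (simp add: exp_minus)
          finally show ?thesis using B by simp
        qed
      qed
      thus ?thesis by (simp add: nG exp_minus field_simps)
    qed
    have lim: "((\<lambda>\<epsilon>. B * exp (\<epsilon> * Re (h z))) \<longlongrightarrow> B * exp (0 * Re (h z))) (at_right 0)"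
      by (intro tendsto_intros)
    have "norm (f z) \<le> B * exp (0 * Re (h z))"
      by (rule tendsto_lowerbound[OF lim]) (auto intro!: eventually_at_right_less eventually_mono[OF eventually_at_right_less] key)
    thus ?thesis by simp
  qed
  show ?thesis
  proof (rule that)
    fix z assume z: "A \<le> Re z" "\<bar>Im z\<bar> \<le> A"
    have "z \<noteq> 0" using z A by auto
    thus "norm (g z) \<le> B * norm z ^ N" using fB[OF z] by (simp add: f_def norm_divide norm_power field_simps)
  qed
qed

text \<open>
  The four quadrants leave four half strips along the axes, each of which is a rotated copy of the one in
  the Phragmen-Lindelof lemma.
\<close>
lemma poly_growth_of_quadrants:
  fixes g :: "complex \<Rightarrow> complex"
  assumes hol: "g holomorphic_on UNIV" and A: "A \<ge> 1"
    and crude: "\<And>z. norm z \<ge> R \<Longrightarrow> norm (g z) \<le> exp (C * norm z ^ k)"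
    and quad: "\<And>z. \<bar>Re z\<bar> \<ge> A \<Longrightarrow> \<bar>Im z\<bar> \<ge> A \<Longrightarrow> norm (g z) \<le> K * norm z ^ N"
  obtains K' where "\<And>z::complex. norm z \<ge> 2 * A \<Longrightarrow> norm (g z) \<le> K' * norm z ^ N"
proof -
  have rot: "\<exists>K'. \<forall>z::complex. Re z \<ge> A \<longrightarrow> \<bar>Im z\<bar> \<le> A \<longrightarrow> norm (g (u * z)) \<le> K' * norm z ^ N"
    if u: "u \<in> {1, -1, \<i>, -\<i>}" for u
  proof -
    have nu: "norm u = 1" using u by auto
    show ?thesis
    proof (rule phragmen_lindelof_half_strip[OF _ A, of "\<lambda>z. g (u * z)" R C k K N])
      show "(\<lambda>z. g (u * z)) holomorphic_on UNIV"
        by (intro holomorphic_on_compose_gen[OF _ hol, unfolded o_def] holomorphic_intros) auto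
    next
      fix z :: complex assume "R \<le> norm z"
      thus "norm (g (u * z)) \<le> exp (C * norm z ^ k)" using crude[of "u * z"] nu by (simp add: norm_mult)
    next
      fix z :: complex assume z: "A \<le> Re z" "\<bar>Im z\<bar> = A"
      show "norm (g (u * z)) \<le> K * norm z ^ N" using quad[of "u * z"] nu z A u by (auto simp: norm_mult)
    qed blast
  qed
  obtain K1 where K1: "\<And>z. Re z \<ge> A \<Longrightarrow> \<bar>Im z\<bar> \<le> A \<Longrightarrow> norm (g (1 * z)) \<le> K1 * norm z ^ N"
    using rot[of 1] by blast
  obtain K2 where K2: "\<And>z. Re z \<ge> A \<Longrightarrow> \<bar>Im z\<bar> \<le> A \<Longrightarrow> norm (g (-1 * z)) \<le> K2 * norm z ^ N"
    using rot[of "-1"] by blast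
  obtain K3 where K3: "\<And>z. Re z \<ge> A \<Longrightarrow> \<bar>Im z\<bar> \<le> A \<Longrightarrow> norm (g (\<i> * z)) \<le> K3 * norm z ^ N"
    using rot[of "\<i>"] by blast
  obtain K4 where K4: "\<And>z. Re z \<ge> A \<Longrightarrow> \<bar>Im z\<bar> \<le> A \<Longrightarrow> norm (g (-\<i> * z)) \<le> K4 * norm z ^ N"
    using rot[of "-\<i>"] by blast
  define K' where "K' = Max {K, K1, K2, K3, K4}"
  have K': "K \<le> K'" "K1 \<le> K'" "K2 \<le> K'" "K3 \<le> K'" "K4 \<le> K'" by (auto simp: K'_def)
  show ?thesis
  proof (rule that)
    fix z :: complex assume z: "norm z \<ge> 2 * A"
    have "\<bar>Re z\<bar> \<ge> A \<or> \<bar>Im z\<bar> \<ge> A" using cmod_le[of z] z by linarith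
    then consider "\<bar>Re z\<bar> \<ge> A" "\<bar>Im z\<bar> \<ge> A" | "Re z \<ge> A" "\<bar>Im z\<bar> \<le> A" | "Re z \<le> -A" "\<bar>Im z\<bar> \<le> A"
      | "Im z \<ge> A" "\<bar>Re z\<bar> \<le> A" | "Im z \<le> -A" "\<bar>Re z\<bar> \<le> A" by linarith
    hence "\<exists>k\<in>{K, K1, K2, K3, K4}. norm (g z) \<le> k * norm z ^ N"
    proof cases
      case 1 thus ?thesis using quad[of z] by auto
    next
      case 2 thus ?thesis using K1[of z] by auto
    next
      case 3 thus ?thesis using K2[of "-z"] by auto
    next
      case 4 thus ?thesis using K3[of "-\<i> * z"] by (auto simp: norm_mult)
    next
      case 5 thus ?thesis using K4[of "\<i> * z"] by (auto simp: norm_mult)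
    qed
    then obtain k where "k \<le> K'" "norm (g z) \<le> k * norm z ^ N" using K' by auto
    thus "norm (g z) \<le> K' * norm z ^ N" by (meson mult_right_mono norm_ge_zero order_trans zero_le_power)
  qed
qed

lemma factor_zeros:
  fixes g :: "complex \<Rightarrow> complex"
  assumes "finite Z" "g holomorphic_on UNIV" "\<And>z. z \<in> Z \<Longrightarrow> g z = 0"
  shows "\<exists>k. k holomorphic_on UNIV \<and> (\<forall>z. g z = k z * (\<Prod>\<zeta>\<in>Z. z - \<zeta>))"
  using assms
proof (induction Z rule: finite_induct)
  case empty
  then show ?case by force
next
  case (insert \<zeta> Z)
  obtain k where k: "k holomorphic_on UNIV" "\<And>z. g z = k z * (\<Prod>\<zeta>\<in>Z. z - \<zeta>)"
    using insert.IH[OF insert.prems(1)] insert.prems(2) by blast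
  have "(\<Prod>\<zeta>'\<in>Z. \<zeta> - \<zeta>') \<noteq> 0" using insert.hyps by auto
  hence k0: "k \<zeta> = 0" using k(2)[of \<zeta>] insert.prems(2)[of \<zeta>] by auto
  define k' where "k' = (\<lambda>z. if z = \<zeta> then deriv k \<zeta> else k z / (z - \<zeta>))"
  have "k' holomorphic_on UNIV"
    by (rule pole_theorem_open_0[OF k(1), of \<zeta>]) (auto simp: k'_def k0)
  moreover have "g z = k' z * (\<Prod>\<zeta>\<in>insert \<zeta> Z. z - \<zeta>)" for z
    using insert.hyps k0 by (simp add: k(2) k'_def)
  ultimately show ?case by blast
qed

text \<open>
  A weak form of Jensen's inequality. On the circle of radius \<open>4 r\<close> every factor of \<open>\<Prod>\<zeta>. z - \<zeta>\<close> is at least \<open>3 r\<close>, at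
  the centre at most \<open>r\<close>; so each zero costs a factor \<open>3 > e\<close> in the maximum principle for the cofactor.
\<close>
lemma jensen_card_zeros_le:
  fixes g :: "complex \<Rightarrow> complex"
  assumes Z: "finite Z" and hol: "g holomorphic_on UNIV" and g0: "\<And>z. z \<in> Z \<Longrightarrow> g z = 0"
    and r: "r > 0" and Zr: "Z \<subseteq> cball c r" and gc: "g c \<noteq> 0"
    and M: "\<And>z. dist c z = 4 * r \<Longrightarrow> norm (g z) \<le> exp M"
  shows "real (card Z) \<le> M - ln (norm (g c))"
proof -
  define n where "n = card Z"
  obtain k where k: "k holomorphic_on UNIV" "\<And>z. g z = k z * (\<Prod>\<zeta>\<in>Z. z - \<zeta>)"
    using factor_zeros[OF Z hol g0] by blast
  have "norm (k c) \<le> exp M / (3 * r) ^ n"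
  proof (rule maximum_modulus_frontier[where f = k and \<xi> = c and S = "cball c (4 * r)"])
    show "k holomorphic_on interior (cball c (4 * r))" using k(1) holomorphic_on_subset by blast
    show "continuous_on (closure (cball c (4 * r))) k"
      using k(1) holomorphic_on_imp_continuous_on continuous_on_subset by blast
    show "c \<in> cball c (4 * r)" using r by simp
    fix z assume "z \<in> frontier (cball c (4 * r))"
    hence z: "dist c z = 4 * r" using r by (auto simp: frontier_cball)
    have ge: "3 * r \<le> norm (z - \<zeta>)" if "\<zeta> \<in> Z" for \<zeta>
    proof -
      have "dist c \<zeta> \<le> r" using Zr that by auto
      thus ?thesis using dist_triangle[of c z \<zeta>] z by (simp add: dist_norm norm_minus_commute)
    qed
    have "(3 * r) ^ n \<le> norm (\<Prod>\<zeta>\<in>Z. z - \<zeta>)"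
      using prod_mono[of Z "\<lambda>_. 3 * r" "\<lambda>\<zeta>. norm (z - \<zeta>)"] ge r by (auto simp: prod_norm n_def)
    moreover have "norm (k z) * norm (\<Prod>\<zeta>\<in>Z. z - \<zeta>) \<le> exp M" using M[OF z] k(2)[of z] by (simp add: norm_mult)
    ultimately have "norm (k z) * (3 * r) ^ n \<le> exp M" by (meson mult_left_mono norm_ge_zero order_trans)
    thus "norm (k z) \<le> exp M / (3 * r) ^ n" using r by (simp add: field_simps)
  qed simp
  moreover have "norm (\<Prod>\<zeta>\<in>Z. c - \<zeta>) \<le> r ^ n"
    using prod_mono[of Z "\<lambda>\<zeta>. norm (c - \<zeta>)" "\<lambda>_. r"] Zr by (auto simp: prod_norm n_def dist_norm subset_iff)
  ultimately have "norm (g c) \<le> exp M / (3 * r) ^ n * r ^ n"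
    unfolding k(2) norm_mult using r by (intro mult_mono) auto
  also have "\<dots> = exp M / 3 ^ n" using r by (simp add: power_mult_distrib)
  finally have "norm (g c) * 3 ^ n \<le> exp M" by (simp add: field_simps)
  moreover have "norm (g c) * exp (real n) \<le> norm (g c) * 3 ^ n"
    using e_less_272 power_mono[of "exp 1" "3::real" n] exp_of_nat_mult[of n 1]
    by (intro mult_left_mono) (auto simp: exp_of_nat_mult[symmetric])
  ultimately have "norm (g c) * exp (real n) \<le> exp M" by linarith
  hence "ln (norm (g c) * exp (real n)) \<le> ln (exp M)" using gc
    by (subst ln_le_cancel_iff) auto
  thus ?thesis using gc by (simp add: ln_mult n_def)
qed

lemma card_zeros_polynomial_bound:
  fixes g :: "complex \<Rightarrow> complex"
  assumes hol: "g holomorphic_on UNIV" and nz: "g c \<noteq> 0"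
    and crude: "\<And>z. norm z \<ge> R \<Longrightarrow> norm (g z) \<le> exp (C * norm z ^ k)"
  obtains K where "\<And>r. r \<ge> 1 \<Longrightarrow> finite {z. g z = 0 \<and> norm z \<le> r}"
     "\<And>r. r \<ge> 1 \<Longrightarrow> real (card {z. g z = 0 \<and> norm z \<le> r}) \<le> K * r ^ k"
proof -
  have fin: "finite {z. g z = 0 \<and> norm z \<le> r}" for r
  proof (cases "g constant_on UNIV")
    case True
    hence "g z \<noteq> 0" for z using nz unfolding constant_on_def by (metis UNIV_I)
    thus ?thesis by simp
  next
    case False
    have "finite {z \<in> cball 0 r. g z = 0}"
      by (rule holomorphic_compact_finite_zeros[OF hol _ _ _ _ False]) auto
    thus ?thesis by (rule rev_finite_subset) auto
  qed
  \<comment> \<open>\<open>D\<close> absorbs the shift from the origin to the centre \<open>c\<close> and the range where the growth bound fails\<close>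
  define D where "D = norm c + \<bar>R\<bar> + 1"
  define K where "K = \<bar>C\<bar> * (9 * D) ^ k + \<bar>ln (norm (g c))\<bar>"
  show ?thesis
  proof (rule that[OF fin])
    fix r :: real assume r: "r \<ge> 1"
    have D: "D \<ge> 1" by (simp add: D_def)
    have rD: "r \<le> D * r" "D \<le> D * r" using r D by auto
    have "real (card {z. g z = 0 \<and> norm z \<le> r}) \<le> \<bar>C\<bar> * (9 * D * r) ^ k - ln (norm (g c))"
    proof (rule jensen_card_zeros_le[OF fin hol _ _ _ nz, of _ "D * r + D"])
      show "{z. g z = 0 \<and> norm z \<le> r} \<subseteq> cball c (D * r + D)"
      proof safe
        fix z :: complex assume "norm z \<le> r"
        thus "z \<in> cball c (D * r + D)" using norm_triangle_ineq4[of c z] rD by (simp add: dist_norm D_def)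
      qed
      show "D * r + D > 0" using rD D r by linarith
      fix z assume z: "dist c z = 4 * (D * r + D)"
      have "norm z \<ge> dist c z - norm c" "norm z \<le> dist c z + norm c"
        using norm_triangle_ineq4[of z c] norm_triangle_ineq2[of z c] norm_triangle_ineq4[of c z] norm_triangle_ineq[of "z - c" c]
        by (auto simp: dist_norm norm_minus_commute)
      moreover have "D \<ge> norm c" "D \<ge> R" "norm c \<ge> 0" using abs_ge_self[of R] norm_ge_zero[of c] unfolding D_def by linarith+
      moreover have "dist c z = 4 * (D * r) + 4 * D" using z by simp
      ultimately have zz1: "norm z \<ge> R" and zz2: "norm z \<le> 9 * (D * r)"
        using rD D r by linarith+
      note zz = zz1 zz2[unfolded mult.assoc[symmetric]]
      have "norm (g z) \<le> exp (C * norm z ^ k)" using crude zz by blast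
      also have "\<dots> \<le> exp (\<bar>C\<bar> * (9 * D * r) ^ k)" using zz by (auto intro!: mult_mono power_mono)
      finally show "norm (g z) \<le> exp (\<bar>C\<bar> * (9 * D * r) ^ k)" .
    qed auto
    also have "\<dots> \<le> \<bar>C\<bar> * (9 * D) ^ k * r ^ k + \<bar>ln (norm (g c))\<bar> * r ^ k"
      using mult_left_mono[of 1 "r ^ k" "\<bar>ln (norm (g c))\<bar>"] one_le_power[OF r, of k] by (simp add: power_mult_distrib)
    finally show "real (card {z. g z = 0 \<and> norm z \<le> r}) \<le> K * r ^ k" by (simp add: K_def algebra_simps)
  qed
qed

section \<open>Circles that avoid the exceptional points\<close>

lemma harnack_chain_circle:
  fixes F :: "complex \<Rightarrow> complex"
  assumes SC: "schottky_const C"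
    and \<rho>: "\<rho> > 0" "\<delta> > 0"
    and F: "\<And>z. norm z = \<rho> \<Longrightarrow> F holomorphic_on ball z \<delta>"
    and om: "\<And>z y. norm z = \<rho> \<Longrightarrow> y \<in> ball z \<delta> \<Longrightarrow> F y \<noteq> 0 \<and> F y \<noteq> 1"
    and J: "real J \<ge> 4 * pi * \<rho> / \<delta>"
    and zw: "norm z = \<rho>" "norm w = \<rho>"
  shows "1 + \<bar>ln (norm (F z))\<bar> \<le> C ^ J * (1 + \<bar>ln (norm (F w))\<bar>)"
proof -
  note C = schottky_constD[OF SC]
  have "J > 0" using J \<rho> by (metis divide_pos_pos gr0I mult_pos_pos not_less of_nat_0 pi_gt_zero zero_less_numeral)
  have w0: "w \<noteq> 0" using zw \<rho> by auto
  define \<theta> where "\<theta> = Arg2pi (z / w)"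
  have "norm (z / w) = 1" using zw \<rho> by (simp add: norm_divide)
  hence z: "z = w * exp (\<i> * of_real \<theta>)" and \<theta>: "0 \<le> \<theta>" "\<theta> < 2 * pi"
    using Arg2pi[of "z / w"] w0 by (auto simp: \<theta>_def is_Arg_def field_simps)
  define \<eta> where "\<eta> = \<theta> / J"
  define p where "p = (\<lambda>j::nat. w * exp (\<i> * of_real (j * \<eta>)))"
  have np: "norm (p j) = \<rho>" for j using zw by (simp add: p_def norm_mult)
  have step: "dist (p j) (p (Suc j)) \<le> \<delta> / 2" for j
  proof -
    have "p (Suc j) - p j = p j * (exp (\<i> * of_real \<eta>) - 1)"
      by (simp add: p_def algebra_simps exp_add[symmetric])
    hence "dist (p j) (p (Suc j)) = \<rho> * norm (exp (\<i> * of_real \<eta>) - 1)"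
      using np[of j] by (metis dist_commute dist_norm norm_mult)
    also have "norm (exp (\<i> * of_real \<eta>) - 1) \<le> \<bar>\<eta>\<bar>"
      using dist_exp_i_1[of \<eta>] abs_sin_x_le_abs_x[of "\<eta> / 2"] by simp
    also have "\<rho> * \<bar>\<eta>\<bar> \<le> \<rho> * (2 * pi / J)"
      using \<theta> \<rho> \<open>J > 0\<close> by (intro mult_left_mono) (auto simp: \<eta>_def divide_right_mono)
    also have "\<dots> \<le> \<delta> / 2" using J \<rho> \<open>J > 0\<close> by (simp add: field_simps)
    finally show ?thesis using \<rho> by (simp add: mult_left_mono)
  qed
  have "1 + \<bar>ln (norm (F (p j)))\<bar> \<le> C ^ j * (1 + \<bar>ln (norm (F (p 0)))\<bar>)" for j
  proof (induction j)
    case (Suc j)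
    have "1 + \<bar>ln (norm (F (p (Suc j))))\<bar> \<le> C * (1 + \<bar>ln (norm (F (p j)))\<bar>)"
      by (rule C(2)[where F = F and \<delta> = \<delta> and x = "p j" and y = "p (Suc j)"])
         (use F[OF np] om[OF np] step \<rho> in auto)
    also have "\<dots> \<le> C * (C ^ j * (1 + \<bar>ln (norm (F (p 0)))\<bar>))"
      using C(1) Suc.IH by (intro mult_left_mono) auto
    finally show ?case by (simp add: mult_ac)
  qed simp
  from this[of J] show ?thesis using z \<open>J > 0\<close> by (simp add: p_def \<eta>_def)
qed

text \<open>
  The \<open>card T + 1\<close> equidistant levels \<open>c j\<close> in \<open>[r, r + 1]\<close> have disjoint neighbourhoods, so by the pigeonhole principle
  one of these neighbourhoods contains no point of \<open>T\<close>.
\<close>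
lemma clear_level:
  fixes T :: "real set"
  assumes "finite T"
  obtains \<rho> where "r \<le> \<rho>" "\<rho> \<le> r + 1" "\<And>t. t \<in> T \<Longrightarrow> \<bar>t - \<rho>\<bar> \<ge> 1 / (2 * (real (card T) + 1))"
proof -
  define n where "n = card T"
  define e where "e = 1 / (2 * (real n + 1))"
  have e0: "e > 0" by (simp add: e_def)
  define c where "c = (\<lambda>j::nat. r + (2 * real j + 1) * e)"
  have "\<exists>j\<in>{..n}. \<forall>t\<in>T. \<bar>t - c j\<bar> \<ge> e"
  proof (rule ccontr)
    assume "\<not> ?thesis"
    hence "\<forall>j\<in>{..n}. \<exists>t\<in>T. \<bar>t - c j\<bar> < e" by force
    then obtain t where t: "\<And>j. j \<le> n \<Longrightarrow> t j \<in> T \<and> \<bar>t j - c j\<bar> < e" by (metis atMost_iff)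
    have "inj_on t {..n}"
    proof (rule inj_onI)
      fix i j assume ij: "i \<in> {..n}" "j \<in> {..n}" "t i = t j"
      have "\<bar>c i - c j\<bar> < 2 * e" using t[of i] t[of j] ij by auto
      moreover have "c i - c j = (real i - real j) * (2 * e)" by (simp add: c_def algebra_simps)
      ultimately have "\<bar>real i - real j\<bar> * (2 * e) < 1 * (2 * e)" using e0 by (simp add: abs_mult)
      hence "\<bar>real i - real j\<bar> < 1" using e0 by (subst (asm) mult_less_cancel_right) auto
      thus "i = j" by linarith
    qed
    moreover have "t ` {..n} \<subseteq> T" using t by auto
    ultimately have "card {..n} \<le> card T" using assms card_inj_on_le by blast
    thus False by (simp add: n_def)
  qed
  then obtain j where j: "j \<le> n" "\<forall>t\<in>T. \<bar>t - c j\<bar> \<ge> e" by auto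
  have "(2 * real j + 1) * e \<le> (2 * real n + 2) * e" using j e0 by (intro mult_right_mono) auto
  also have "\<dots> = 1" by (simp add: e_def field_simps)
  finally show ?thesis using that[of "c j"] j e0 by (auto simp: c_def e_def n_def)
qed

text \<open>
  \<open>Z\<close> is the set of points where the functions may take the values 0 and 1. As \<open>Z\<close> has only polynomially many
  points in discs, each interval \<open>[r, r + 1]\<close> contains a radius whose circle keeps a distance of reciprocal
  polynomial size from \<open>Z\<close>. Polynomially many Schottky steps along this circle, starting on the ray through \<open>u\<close> where
  the function is under control, give a bound \<open>exp (K r ^ N)\<close>. The radii are chosen before the function, since
  two functions have to be compared on the same circles.
\<close>
lemma omitted_values_circles_bound:
  fixes Z :: "complex set"
  assumes fin: "\<And>r. r \<ge> 1 \<Longrightarrow> finite {z\<in>Z. norm z \<le> r}"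
    and card: "\<And>r. r \<ge> 1 \<Longrightarrow> real (card {z\<in>Z. norm z \<le> r}) \<le> K0 * r ^ k0"
    and u: "norm u = 1"
  obtains \<rho> :: "real \<Rightarrow> real" where "\<And>r. r \<le> \<rho> r \<and> \<rho> r \<le> r + 1"
    "\<And>r z. r \<ge> 1 \<Longrightarrow> norm z = \<rho> r \<Longrightarrow> z \<notin> Z"
    "\<forall>(F :: complex \<Rightarrow> complex) K N R. F holomorphic_on {z. norm z > R} \<longrightarrow>
       (\<forall>z. norm z > R \<longrightarrow> z \<notin> Z \<longrightarrow> F z \<noteq> 0 \<and> F z \<noteq> 1) \<longrightarrow>
       (\<forall>t\<ge>R. 1 + \<bar>ln (norm (F (of_real t * u)))\<bar> \<le> K * t ^ N) \<longrightarrow>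
       (\<exists>R' K' N'. \<forall>r\<ge>R'. \<forall>z. norm z = \<rho> r \<longrightarrow> 1 + \<bar>ln (norm (F z))\<bar> \<le> exp (K' * r ^ N'))"
proof -
  define A where "A = (\<lambda>r. {z\<in>Z. norm z \<le> r})"
  have "\<exists>\<rho>. r \<le> \<rho> \<and> \<rho> \<le> r + 1 \<and> (\<forall>z\<in>A (r + 2). r \<ge> 1 \<longrightarrow> \<bar>norm z - \<rho>\<bar> \<ge> 1 / (2 * (real (card (A (r + 2))) + 1)))"
    for r :: real
  proof (cases "r \<ge> 1")
    case True
    \<comment> \<open>\<open>r + 2\<close> because discs of radius at most 1 around points of the circle reach that far\<close>
    define T where "T = norm ` A (r + 2)"
    have fT: "finite (A (r+2))" using fin[of "r + 2"] True by (simp add: A_def)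
    hence "finite T" by (simp add: T_def)
    then obtain \<rho> where \<rho>: "r \<le> \<rho>" "\<rho> \<le> r + 1" "\<And>t. t \<in> T \<Longrightarrow> \<bar>t - \<rho>\<bar> \<ge> 1 / (2 * (real (card T) + 1))"
      using clear_level by metis
    have "card T \<le> card (A (r + 2))" using fT by (simp add: T_def card_image_le)
    hence "1 / (2 * (real (card T) + 1)) \<ge> 1 / (2 * (real (card (A (r + 2))) + 1))"
      by (intro divide_left_mono) auto
    thus ?thesis using \<rho> by (force simp: T_def)
  qed (auto intro!: exI[of _ r])
  then obtain \<rho> where \<rho>: "\<And>r. r \<le> \<rho> r \<and> \<rho> r \<le> r + 1"
    "\<And>r z. r \<ge> 1 \<Longrightarrow> z \<in> A (r + 2) \<Longrightarrow> \<bar>norm z - \<rho> r\<bar> \<ge> 1 / (2 * (real (card (A (r + 2))) + 1))"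
    by metis
  obtain C where SC: "schottky_const C" using schottky_const_exists by blast
  note C = schottky_constD[OF SC]
  show ?thesis
  proof (rule that[OF \<rho>(1)])
    fix r :: real and z :: complex assume r: "r \<ge> 1" and z: "norm z = \<rho> r"
    show "z \<notin> Z"
    proof
      assume "z \<in> Z"
      hence "z \<in> A (r + 2)" using z \<rho>(1)[of r] by (auto simp: A_def)
      from \<rho>(2)[OF r this] z show False by simp
    qed
  next
    show "\<forall>(F :: complex \<Rightarrow> complex) K N R. F holomorphic_on {z. norm z > R} \<longrightarrow>
       (\<forall>z. norm z > R \<longrightarrow> z \<notin> Z \<longrightarrow> F z \<noteq> 0 \<and> F z \<noteq> 1) \<longrightarrow>
       (\<forall>t\<ge>R. 1 + \<bar>ln (norm (F (of_real t * u)))\<bar> \<le> K * t ^ N) \<longrightarrow>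
       (\<exists>R' K' N'. \<forall>r\<ge>R'. \<forall>z. norm z = \<rho> r \<longrightarrow> 1 + \<bar>ln (norm (F z))\<bar> \<le> exp (K' * r ^ N'))"
    proof (intro allI impI)
    fix F :: "complex \<Rightarrow> complex" and K N R
    assume F: "F holomorphic_on {z. norm z > R}"
      and om: "\<forall>z. norm z > R \<longrightarrow> z \<notin> Z \<longrightarrow> F z \<noteq> 0 \<and> F z \<noteq> 1"
      and ray: "\<forall>t\<ge>R. 1 + \<bar>ln (norm (F (of_real t * u)))\<bar> \<le> K * t ^ N"
    define R' where "R' = max (R + 1) 1"
    define D where "D = 16 * pi * (\<bar>K0\<bar> * 3 ^ k0 + 1) + 1"
    have bound: "1 + \<bar>ln (norm (F z))\<bar> \<le> exp ((ln C * D + \<bar>K\<bar> * 2 ^ N) * r ^ (k0 + 1 + N))"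
      if r: "r \<ge> R'" and z: "norm z = \<rho> r" for r z
    proof -
      have r1: "r \<ge> 1" "r \<ge> R + 1" using r by (auto simp: R'_def)
      define n where "n = card (A (r + 2))"
      define \<delta> where "\<delta> = 1 / (2 * (real n + 1))"
      have \<delta>: "\<delta> > 0" "\<delta> \<le> 1" by (auto simp: \<delta>_def)
      have \<rho>r: "r \<le> \<rho> r" "\<rho> r \<le> r + 1" using \<rho>(1) by auto
      define J where "J = nat \<lceil>4 * pi * \<rho> r / \<delta>\<rceil>"
      have away: "norm y > R" "y \<notin> Z" if "norm w = \<rho> r" "y \<in> ball w \<delta>" for w y
      proof -
        have d: "\<bar>norm y - norm w\<bar> < \<delta>" using that norm_triangle_ineq3[of y w] by (simp add: dist_norm norm_minus_commute)
        thus "norm y > R" using that \<delta> \<rho>r r1 by linarith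
        show "y \<notin> Z"
        proof
          assume "y \<in> Z"
          hence "y \<in> A (r + 2)" using d that \<delta> \<rho>r by (auto simp: A_def)
          from \<rho>(2)[OF r1(1) this] d that show False by (simp add: \<delta>_def n_def)
        qed
      qed
      have nonneg: "0 \<le> 4 * pi * \<rho> r / \<delta>" using \<rho>r r1 \<delta> by simp
      have 1: "1 + \<bar>ln (norm (F z))\<bar> \<le> C ^ J * (1 + \<bar>ln (norm (F (of_real (\<rho> r) * u)))\<bar>)"
      proof (rule harnack_chain_circle[OF SC, where F = F and z = z and w = "of_real (\<rho> r) * u" and \<delta> = \<delta> and \<rho> = "\<rho> r"])
        show "F holomorphic_on ball w \<delta>" if "norm w = \<rho> r" for w
          by (rule holomorphic_on_subset[OF F]) (use away[OF that] in auto)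
        show "F y \<noteq> 0 \<and> F y \<noteq> 1" if "norm w = \<rho> r" "y \<in> ball w \<delta>" for w y
          using om away[OF that] by blast
        show "real J \<ge> 4 * pi * \<rho> r / \<delta>" unfolding J_def by linarith
        show "norm (of_real (\<rho> r) * u) = \<rho> r" using u \<rho>r r1 by (simp add: norm_mult)
      qed (use z \<rho>r r1 \<delta> in auto)
      have "real J \<le> 4 * pi * \<rho> r / \<delta> + 1" using nonneg unfolding J_def by linarith
      also have "4 * pi * \<rho> r / \<delta> = 8 * pi * (\<rho> r * (real n + 1))" by (simp add: \<delta>_def)
      also have "\<rho> r * (real n + 1) \<le> (2 * r) * ((\<bar>K0\<bar> * 3 ^ k0 + 1) * r ^ k0)"
      proof (rule mult_mono)
        have "real n \<le> K0 * (r + 2) ^ k0" using card[of "r + 2"] r1 by (simp add: n_def A_def)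
        also have "\<dots> \<le> \<bar>K0\<bar> * (3 * r) ^ k0" using r1 by (intro mult_mono power_mono) auto
        finally have "real n \<le> \<bar>K0\<bar> * 3 ^ k0 * r ^ k0" by (simp add: power_mult_distrib)
        moreover have "1 \<le> r ^ k0" using r1 by (intro one_le_power)
        ultimately show "real n + 1 \<le> (\<bar>K0\<bar> * 3 ^ k0 + 1) * r ^ k0" by (simp add: algebra_simps)
      qed (use \<rho>r r1 in auto)
      hence "8 * pi * (\<rho> r * (real n + 1)) + 1 \<le> 8 * pi * ((2 * r) * ((\<bar>K0\<bar> * 3 ^ k0 + 1) * r ^ k0)) + 1"
        by (intro add_mono mult_left_mono) auto
      also have "\<dots> = 16 * pi * (\<bar>K0\<bar> * 3 ^ k0 + 1) * r ^ (k0 + 1) + 1" by (simp add: algebra_simps)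
      also have "\<dots> \<le> D * r ^ (k0 + 1)" using one_le_power[OF r1(1), of "k0 + 1"] by (simp add: D_def algebra_simps)
      finally have J: "real J \<le> D * r ^ (k0 + 1)" by simp
      have "C ^ J = exp (real J * ln C)" using C(1) by (simp add: exp_of_nat_mult)
      also have "\<dots> \<le> exp (D * r ^ (k0 + 1) * ln C)" using J C(1) by (simp add: mult_right_mono)
      finally have 2: "C ^ J \<le> exp (D * r ^ (k0 + 1) * ln C)" .
      have "1 + \<bar>ln (norm (F (of_real (\<rho> r) * u)))\<bar> \<le> K * \<rho> r ^ N" using ray \<rho>r r1 by simp
      also have "\<dots> \<le> \<bar>K\<bar> * (2 * r) ^ N" using \<rho>r r1 by (intro mult_mono power_mono) auto
      also have "\<dots> \<le> exp (\<bar>K\<bar> * 2 ^ N * r ^ N)" using exp_ge_add_one_self[of "\<bar>K\<bar> * 2 ^ N * r ^ N"] unfolding power_mult_distrib mult.assoc by linarith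
      finally have 3: "1 + \<bar>ln (norm (F (of_real (\<rho> r) * u)))\<bar> \<le> exp (\<bar>K\<bar> * 2 ^ N * r ^ N)" .
      have "1 + \<bar>ln (norm (F z))\<bar> \<le> exp (D * r ^ (k0 + 1) * ln C) * exp (\<bar>K\<bar> * 2 ^ N * r ^ N)"
        by (rule order_trans[OF 1 mult_mono[OF 2 3]]) auto
      also have "\<dots> = exp (ln C * D * r ^ (k0 + 1) + \<bar>K\<bar> * 2 ^ N * r ^ N)" by (simp add: exp_add mult_ac)
      also have "\<dots> \<le> exp (ln C * D * r ^ (k0 + 1 + N) + \<bar>K\<bar> * 2 ^ N * r ^ (k0 + 1 + N))"
      proof -
        have "D \<ge> 0" by (auto simp: D_def)
        hence "ln C * D * r ^ (k0 + 1) \<le> ln C * D * r ^ (k0 + 1 + N)"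
          using C(1) r1 by (intro mult_left_mono power_increasing) auto
        moreover have "\<bar>K\<bar> * 2 ^ N * r ^ N \<le> \<bar>K\<bar> * 2 ^ N * r ^ (k0 + 1 + N)"
          using r1 by (intro mult_left_mono power_increasing) auto
        ultimately show ?thesis by simp
      qed
      finally show ?thesis by (simp add: algebra_simps)
    qed
    thus "\<exists>R' K' N'. \<forall>r\<ge>R'. \<forall>z. norm z = \<rho> r \<longrightarrow> 1 + \<bar>ln (norm (F z))\<bar> \<le> exp (K' * r ^ N')" by blast
    qed
  qed
qed

section \<open>Quotients of meromorphic functions with the same zeros\<close>

lemma zorder_prod_powi:
  fixes k :: "complex \<Rightarrow> int"
  assumes "finite X"
  shows "zorder (\<lambda>z. \<Prod>x\<in>X. (z - x) powi k x) w = (if w \<in> X then k w else 0)"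
proof -
  have zo: "zorder (\<lambda>z. z - x) w = (if x = w then 1 else 0)" for x :: complex
  proof (cases "x = w")
    case True
    have "zorder (\<lambda>z. z - w) w = 1"
      by (rule zorder_eqI[of UNIV _ "\<lambda>_. 1"]) auto
    thus ?thesis using True by simp
  next
    case False
    have "zorder (\<lambda>z. z - x) w = 0" by (rule zorder_eq_0I) (use False in \<open>auto intro!: analytic_intros\<close>)
    thus ?thesis using False by simp
  qed
  have ne: "eventually (\<lambda>z. z - x \<noteq> 0) (at w)" for x :: complex
    using eventually_neq_at_within[of x w UNIV] by auto
  have "zorder (\<lambda>z. \<Prod>x\<in>X. (z - x) powi k x) w = (\<Sum>x\<in>X. zorder (\<lambda>z. (z - x) powi k x) w)"
  proof (rule zorder_prod)
    show "(\<lambda>z. (z - x) powi k x) meromorphic_on {w}" for x by (intro meromorphic_intros)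
    have "eventually (\<lambda>z. \<forall>x\<in>X. z - x \<noteq> 0) (at w)" using assms ne by (simp add: eventually_ball_finite)
    thus "eventually (\<lambda>z. (\<Prod>x\<in>X. (z - x) powi k x) \<noteq> 0) (at w)"
      by eventually_elim (use assms in auto)
  qed
  also have "\<dots> = (\<Sum>x\<in>X. if x = w then k w else 0)"
  proof (rule sum.cong)
    fix x
    have "zorder (\<lambda>z. (z - x) powi k x) w = k x * zorder (\<lambda>z. z - x) w"
      by (rule zorder_power_int) (use ne[of x] in \<open>auto intro!: meromorphic_intros simp: eventually_frequently\<close>)
    thus "zorder (\<lambda>z. (z - x) powi k x) w = (if x = w then k w else 0)" by (simp add: zo)
  qed simp
  also have "\<dots> = (if w \<in> X then k w else 0)" using assms by simp
  finally show ?thesis .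
qed

text \<open>
  The vanishing of all orders makes the singularities of \<open>M\<close> removable and the completed function free
  of zeros, so it has a global logarithm.
\<close>
lemma meromorphic_without_zeros_poles_exp:
  assumes M: "M meromorphic_on UNIV" and nz: "\<And>z. frequently (\<lambda>w. M w \<noteq> 0) (at z)"
    and z0: "\<And>z. zorder M z = 0"
  obtains \<phi> where "\<phi> holomorphic_on UNIV" "\<And>z. remove_sings M z = exp (\<phi> z)"
proof -
  define E where "E = remove_sings M"
  have E: "E nicely_meromorphic_on UNIV" unfolding E_def by (rule remove_sings_nicely_meromorphic[OF M])
  have iso: "isolated_singularity_at M z" "not_essential M z" for z
    using M meromorphic_on_subset[of M UNIV "{z}"] by (auto simp: meromorphic_at_iff)
  have np: "\<not> is_pole M z" for z
    using isolated_pole_imp_neg_zorder[OF iso(1), of z] z0[of z] by auto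
  have Ean: "remove_sings M analytic_on {z}" for z
  proof -
    obtain c where "M \<midarrow>z\<rightarrow> c" using iso[of z] np[of z] by (auto simp: not_essential_def)
    thus ?thesis using iso[of z] by (intro remove_sings_analytic_at)
  qed
  have "remove_sings M analytic_on UNIV" by (subst analytic_on_analytic_at) (use Ean in blast)
  hence hol: "E holomorphic_on UNIV" unfolding E_def by (rule analytic_imp_holomorphic)
  have "E z \<noteq> 0" for z
  proof -
    have ev: "eventually (\<lambda>w. E w = M w) (at z)" unfolding E_def
      by (rule eventually_remove_sings_eq_at[OF iso(1)])
    have "frequently (\<lambda>w. E w \<noteq> 0) (at z)"
      using frequently_eventually_frequently[OF nz[of z] ev] by (rule frequently_elim1) auto
    moreover have "zorder E z = 0" unfolding E_def using iso[of z] z0[of z] by simp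
    ultimately show ?thesis using zorder_eq_0_iff[OF Ean[of z]] by (simp add: E_def)
  qed
  then obtain \<phi> where "\<phi> holomorphic_on UNIV" "\<And>z. exp (\<phi> z) = E z"
    using holomorphic_logarithm_exists[OF convex_UNIV open_UNIV hol, of 0] by auto
  thus ?thesis using that by (simp add: E_def)
qed

lemma nicely_meromorphic_frequently_neq:
  assumes "F nicely_meromorphic_on UNIV" "\<not> F constant_on UNIV"
  shows "frequently (\<lambda>w. F w \<noteq> (c::complex)) (at z)"
proof (rule ccontr)
  assume "\<not> ?thesis"
  hence "eventually (\<lambda>w. F w = c) (at z)" by (simp add: frequently_def)
  hence "frequently (\<lambda>w. F w = c) (at z)" by (simp add: eventually_frequently)
  hence "F w = c" for w
    using frequently_eq_meromorphic_imp_constant[OF _ assms(1), of c z w] by auto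
  thus False using assms(2) by (auto simp: constant_on_def)
qed

text \<open>
  \<open>X\<close> contains the points where zeros or poles need not match; the orders of \<open>F / G\<close> at these points are the exponents
  of the rational factor, and what is left has neither zeros nor poles.
\<close>
lemma meromorphic_same_zeros_quotient:
  fixes F G :: "complex \<Rightarrow> complex"
  assumes F: "F meromorphic_on UNIV" "\<And>z. frequently (\<lambda>w. F w \<noteq> 0) (at z)"
    and G: "G meromorphic_on UNIV" "\<And>z. frequently (\<lambda>w. G w \<noteq> 0) (at z)"
    and X: "finite X"
    and an: "\<And>z. z \<notin> X \<Longrightarrow> F analytic_on {z}" "\<And>z. z \<notin> X \<Longrightarrow> G analytic_on {z}"
    and zeros: "\<And>z. z \<notin> X \<Longrightarrow> F z = 0 \<longleftrightarrow> G z = 0"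
    and zo: "\<And>z. z \<notin> X \<Longrightarrow> F z = 0 \<Longrightarrow> zorder F z = zorder G z"
  obtains \<phi> k where "\<phi> holomorphic_on UNIV"
    "\<And>z. z \<notin> X \<Longrightarrow> F z = G z * (\<Prod>x\<in>X. (z - x) powi k x) * exp (\<phi> z)"
proof -
  define k where "k = (\<lambda>x. zorder F x - zorder G x)"
  define R where "R = (\<lambda>z. \<Prod>x\<in>X. (z - x) powi k x)"
  define M where "M = (\<lambda>z. F z / G z / R z)"
  have mF: "F meromorphic_on {z}" and mG: "G meromorphic_on {z}" for z
    using F(1) G(1) meromorphic_on_subset[of _ UNIV "{z}"] by auto
  have mR: "R meromorphic_on A" for A unfolding R_def by (intro meromorphic_intros)
  have fF: "frequently (\<lambda>w. F w \<noteq> 0) (at z)" and fG: "frequently (\<lambda>w. G w \<noteq> 0) (at z)" for z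
    by (rule F(2), rule G(2))
  have evX: "eventually (\<lambda>w. w \<notin> X) (at z)" for z
    using islimpt_finite[OF X, of z] unfolding islimpt_iff_eventually not_not .
  have Rnz: "R w \<noteq> 0" if "w \<notin> X" for w using that X by (auto simp: R_def)
  have fR: "frequently (\<lambda>w. R w \<noteq> 0) (at z)" for z
  proof (rule eventually_frequently)
    show "eventually (\<lambda>w. R w \<noteq> 0) (at z)" by (rule eventually_mono[OF evX[of z]]) (use Rnz in auto)
  qed simp
  have evG: "eventually (\<lambda>w. G w \<noteq> 0) (at z)" for z
    using non_zero_neighbour[OF _ _ fG] mG[of z] unfolding meromorphic_at_iff by simp
  have evF: "eventually (\<lambda>w. F w \<noteq> 0) (at z)" for z
    using non_zero_neighbour[OF _ _ fF] mF[of z] unfolding meromorphic_at_iff by simp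
  have evM: "eventually (\<lambda>w. F w / G w \<noteq> 0) (at z)" for z
    using evF[of z] evG[of z] by eventually_elim auto
  have zF: "zorder F z = zorder G z" if "z \<notin> X" for z
  proof (cases "F z = 0")
    case False
    thus ?thesis using zorder_eq_0I an that zeros by metis
  qed (use zo that in auto)
  obtain \<phi> where \<phi>: "\<phi> holomorphic_on UNIV" "\<And>z. remove_sings M z = exp (\<phi> z)"
  proof (rule meromorphic_without_zeros_poles_exp[of M])
    show "M meromorphic_on UNIV" unfolding M_def
      by (intro meromorphic_intros mR F(1) G(1))
    show "frequently (\<lambda>w. M w \<noteq> 0) (at z)" for z
    proof (rule eventually_frequently[OF at_neq_bot])
      show "eventually (\<lambda>w. M w \<noteq> 0) (at z)"
        using evM[of z] evX[of z] by eventually_elim (use Rnz in \<open>auto simp: M_def\<close>)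
    qed
    show "zorder M z = 0" for z
    proof -
      have "zorder (\<lambda>w. F w / G w / R w) z = zorder (\<lambda>w. F w / G w) z - zorder R z"
      proof (rule zorder_divide)
      show "(\<lambda>w. F w / G w) meromorphic_on {z}" by (intro meromorphic_intros mF mG)
      show "frequently (\<lambda>w. F w / G w \<noteq> 0) (at z)"
        using evM[of z] by (intro eventually_frequently) auto
    qed (rule mR fR)+
      also have "zorder (\<lambda>w. F w / G w) z = zorder F z - zorder G z"
        by (intro zorder_divide mF mG fF fG)
      also have "zorder R z = (if z \<in> X then k z else 0)" unfolding R_def by (rule zorder_prod_powi[OF X])
      finally show ?thesis using zF[of z] by (simp add: k_def M_def)
    qed
  qed blast
  show ?thesis
  proof (rule that[OF \<phi>(1)])
    fix z assume z: "z \<notin> X"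
    show "F z = G z * (\<Prod>x\<in>X. (z - x) powi k x) * exp (\<phi> z)"
    proof (cases "G z = 0")
      case True
      thus ?thesis using zeros[OF z] by simp
    next
      case False
      have Ran: "R analytic_on {z}" unfolding R_def
        by (intro analytic_intros) (use z in auto)
      have "M analytic_on {z}" unfolding M_def
        by (intro analytic_intros an Ran) (use z False Rnz in auto)
      hence "M z = exp (\<phi> z)" using \<phi>(2)[of z] by simp
      thus ?thesis using False Rnz[OF z] by (simp add: M_def R_def field_simps)
    qed
  qed
qed

section \<open>The exponent is a polynomial of degree at most one\<close>

text \<open>
  The units in \<open>U\<close> rotate the first quadrant to the other three.
\<close>
lemma omitted_values_quadrants_bound:
  fixes F :: "complex \<Rightarrow> complex"
  assumes A: "A \<ge> 0"
    and F: "F holomorphic_on {z. \<bar>Re z\<bar> > A \<and> \<bar>Im z\<bar> > A}"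
    and om: "\<And>z. \<bar>Re z\<bar> > A \<Longrightarrow> \<bar>Im z\<bar> > A \<Longrightarrow> F z \<noteq> 0 \<and> F z \<noteq> 1"
  obtains K N where "K \<ge> 0" "\<And>z. \<bar>Re z\<bar> \<ge> A + 1 \<Longrightarrow> \<bar>Im z\<bar> \<ge> A + 1 \<Longrightarrow> 1 + \<bar>ln (norm (F z))\<bar> \<le> K * norm z ^ N"
proof -
  define U where "U = {1, -1, \<i>, -\<i>}"
  have U: "norm u = 1" "u \<noteq> 0" if "u \<in> U" for u using that by (auto simp: U_def)
  define c where "c = (\<lambda>u. u * Complex A A)"
  have quot: "Re ((z - c u) / u) = Re (z / u) - A" "Im ((z - c u) / u) = Im (z / u) - A" if "u \<in> U" for u z
    using U[OF that] by (simp_all add: c_def diff_divide_distrib)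
  have cases: "\<bar>Re z\<bar> = Re (z / u) \<and> \<bar>Im z\<bar> = Im (z / u) \<or> \<bar>Im z\<bar> = Re (z / u) \<and> \<bar>Re z\<bar> = Im (z / u)"
    if "u \<in> U" "Re (z / u) > 0" "Im (z / u) > 0" for u z
    using that by (auto simp: U_def Re_divide Im_divide)
  have "\<exists>K N. \<forall>z. 1 \<le> Re ((z - c u) / u) \<longrightarrow> 1 \<le> Im ((z - c u) / u) \<longrightarrow> 1 + \<bar>ln (norm (F z))\<bar> \<le> K * norm (z - c u) ^ N"
    if u: "u \<in> U" for u
  proof (rule omitted_values_quadrant_bound[of u F "c u"])
    show "norm u = 1" using U u by auto
    have *: "\<bar>Re z\<bar> > A \<and> \<bar>Im z\<bar> > A" if "Re ((z - c u) / u) > 0" "Im ((z - c u) / u) > 0" for z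
      using cases[OF u, of z] that quot[OF u, of z] A by auto
    show "F holomorphic_on {z. 0 < Re ((z - c u) / u) \<and> 0 < Im ((z - c u) / u)}"
      by (rule holomorphic_on_subset[OF F]) (use * in blast)
    show "F z \<noteq> 0 \<and> F z \<noteq> 1" if "Re ((z - c u) / u) > 0" "Im ((z - c u) / u) > 0" for z
      using om *[OF that] by blast
  qed blast
  then obtain K N where KN: "\<And>u z. u \<in> U \<Longrightarrow> 1 \<le> Re ((z - c u) / u) \<Longrightarrow> 1 \<le> Im ((z - c u) / u) \<Longrightarrow>
      1 + \<bar>ln (norm (F z))\<bar> \<le> K u * norm (z - c u) ^ N u" by metis
  define N' where "N' = (\<Sum>u\<in>U. N u)"
  define K' where "K' = (\<Sum>u\<in>U. \<bar>K u\<bar>) * 3 ^ N'"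
  have fU: "finite U" by (simp add: U_def)
  show ?thesis
  proof (rule that)
    show "K' \<ge> 0" by (auto simp: K'_def intro!: mult_nonneg_nonneg sum_nonneg)
    fix z assume z: "\<bar>Re z\<bar> \<ge> A + 1" "\<bar>Im z\<bar> \<ge> A + 1"
    have "\<exists>u\<in>U. Re (z / u) \<ge> A + 1 \<and> Im (z / u) \<ge> A + 1"
    proof -
      have q: "Re (z / 1) = Re z" "Im (z / 1) = Im z" "Re (z / (-1)) = - Re z" "Im (z / (-1)) = - Im z"
         "Re (z / \<i>) = Im z" "Im (z / \<i>) = - Re z" "Re (z / (-\<i>)) = - Im z" "Im (z / (-\<i>)) = Re z"
        by (simp_all add: Re_divide Im_divide)
      consider "Re z \<ge> A + 1" "Im z \<ge> A + 1" | "Re z \<le> -(A + 1)" "Im z \<ge> A + 1"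
        | "Re z \<ge> A + 1" "Im z \<le> -(A + 1)" | "Re z \<le> -(A + 1)" "Im z \<le> -(A + 1)" using z by linarith
      thus ?thesis
      proof cases
        case 1 thus ?thesis using q by (intro bexI[of _ 1]) (auto simp: U_def)
      next
        case 2 thus ?thesis using q by (intro bexI[of _ \<i>]) (auto simp: U_def)
      next
        case 3 thus ?thesis using q by (intro bexI[of _ "-\<i>"]) (auto simp: U_def)
      next
        case 4 thus ?thesis using q by (intro bexI[of _ "-1"]) (auto simp: U_def)
      qed
    qed
    then obtain u where u: "u \<in> U" "Re (z / u) \<ge> A + 1" "Im (z / u) \<ge> A + 1" by blast
    have nz: "norm z \<ge> A + 1" using z abs_Re_le_cmod[of z] by linarith
    have "norm (c u) \<le> 2 * A" using U[OF u(1)] cmod_le[of "Complex A A"] A by (simp add: c_def norm_mult)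
    hence n3: "norm (z - c u) \<le> 3 * norm z" using norm_triangle_ineq4[of z "c u"] nz by linarith
    have "1 + \<bar>ln (norm (F z))\<bar> \<le> K u * norm (z - c u) ^ N u"
      by (rule KN[OF u(1)]) (use quot[OF u(1)] u in auto)
    also have "\<dots> \<le> \<bar>K u\<bar> * (3 * norm z) ^ N u" using n3 by (intro mult_mono power_mono) auto
    also have "\<dots> \<le> (\<Sum>u\<in>U. \<bar>K u\<bar>) * (3 * norm z) ^ N'"
    proof (intro mult_mono power_increasing)
      show "\<bar>K u\<bar> \<le> (\<Sum>u\<in>U. \<bar>K u\<bar>)" using fU u by (intro member_le_sum) auto
      show "N u \<le> N'" unfolding N'_def using fU u by (intro member_le_sum) auto
    qed (use nz A in \<open>auto intro!: sum_nonneg\<close>)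
    also have "\<dots> = K' * norm z ^ N'" by (simp add: K'_def power_mult_distrib)
    finally show "1 + \<bar>ln (norm (F z))\<bar> \<le> K' * norm z ^ N'" .
  qed
qed

lemma ln_prod_powi_bound:
  fixes k :: "complex \<Rightarrow> int"
  assumes X: "finite X" "\<And>x. x \<in> X \<Longrightarrow> norm x \<le> R" and z: "norm z \<ge> R + 1" "R \<ge> 0"
  shows "\<bar>ln (norm (\<Prod>x\<in>X. (z - x) powi k x))\<bar> \<le> (\<Sum>x\<in>X. \<bar>of_int (k x)\<bar>) * ln (2 * norm z)"
proof -
  have b: "1 \<le> norm (z - x)" "norm (z - x) \<le> 2 * norm z" if "x \<in> X" for x
    using X(2)[OF that] z norm_triangle_ineq2[of z x] norm_triangle_ineq4[of z x] by auto
  have nz: "z - x \<noteq> 0" if "x \<in> X" for x using b[OF that] by auto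
  have "ln (norm (\<Prod>x\<in>X. (z - x) powi k x)) = (\<Sum>x\<in>X. ln (norm ((z - x) powi k x)))"
    unfolding prod_norm[symmetric] by (rule ln_prod[OF X(1)]) (use nz in auto)
  also have "\<dots> = (\<Sum>x\<in>X. of_int (k x) * ln (norm (z - x)))"
  proof (intro sum.cong refl)
    fix x assume "x \<in> X"
    hence "norm (z - x) > 0" using nz by simp
    thus "ln (norm ((z - x) powi k x)) = of_int (k x) * ln (norm (z - x))"
      by (simp add: norm_power_int powr_real_of_int'[symmetric] ln_powr)
  qed
  also have "\<bar>\<dots>\<bar> \<le> (\<Sum>x\<in>X. \<bar>of_int (k x)\<bar> * ln (2 * norm z))"
  proof (rule order_trans[OF sum_abs sum_mono])
    fix x assume x: "x \<in> X"
    have "0 \<le> ln (norm (z - x))" "ln (norm (z - x)) \<le> ln (2 * norm z)" using b[OF x] by (auto intro!: ln_mono)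
    thus "\<bar>of_int (k x) * ln (norm (z - x))\<bar> \<le> \<bar>of_int (k x)\<bar> * ln (2 * norm z)"
      by (simp add: abs_mult mult_left_mono)
  qed
  finally show ?thesis by (simp add: sum_distrib_right)
qed

text \<open>
  The maximum principle for \<open>exp \<phi>\<close> and \<open>exp (- \<phi>)\<close>.
\<close>
lemma Re_bound_max_principle:
  assumes hol: "\<phi> holomorphic_on UNIV" and r: "r > 0"
    and bd: "\<And>z. norm z = r \<Longrightarrow> \<bar>Re (\<phi> z)\<bar> \<le> M" and z: "norm z \<le> r"
  shows "\<bar>Re (\<phi> z)\<bar> \<le> M"
proof -
  have "norm (exp (c * \<phi> z)) \<le> exp M" if c: "c = 1 \<or> c = -1" for c :: complex
  proof (rule maximum_modulus_frontier[where f = "\<lambda>z. exp (c * \<phi> z)" and S = "cball 0 r" and \<xi> = z])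
    have h: "(\<lambda>z. exp (c * \<phi> z)) holomorphic_on UNIV" by (intro holomorphic_intros hol)
    show "(\<lambda>z. exp (c * \<phi> z)) holomorphic_on interior (cball 0 r)" using h holomorphic_on_subset by blast
    show "continuous_on (closure (cball 0 r)) (\<lambda>z. exp (c * \<phi> z))"
      using h holomorphic_on_imp_continuous_on continuous_on_subset by blast
    fix w assume "w \<in> frontier (cball (0::complex) r)"
    hence "norm w = r" using r by (simp add: frontier_cball)
    from bd[OF this] show "norm (exp (c * \<phi> w)) \<le> exp M" using c by auto
  qed (use z in auto)
  from this[of 1] this[of "-1"] show ?thesis by auto
qed

text \<open>
  Collects the terms of the growth estimate for the exponent below into one exponential.
\<close>
lemma sum_exp_le:
  fixes a b c :: real
  assumes "a \<ge> 0" "b \<ge> 0" "c \<ge> 0"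
  shows "6 * (exp a + exp b + c) \<le> exp (18 + a + b + c)"
proof -
  have "exp a \<le> exp (a + b + c)" "exp b \<le> exp (a + b + c)" using assms by auto
  moreover have "c \<le> exp (a + b + c)"
    using exp_ge_add_one_self[of "a + b + c"] assms by linarith
  ultimately have "exp a + exp b + c \<le> 3 * exp (a + b + c)" by linarith
  hence "6 * (exp a + exp b + c) \<le> 18 * exp (a + b + c)" by simp
  also have "\<dots> \<le> exp 18 * exp (a + b + c)"
    using exp_ge_add_one_self[of 18] by (intro mult_right_mono) auto
  finally show ?thesis by (simp add: exp_add mult_ac)
qed

text \<open>
  \<open>Re \<phi> = ln |F| - ln |G| - ln |R|\<close> off \<open>Z\<close>, where \<open>R\<close> is the rational factor. In the quadrants \<open>F\<close> and \<open>G\<close> omit 0 and 1, so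
  \<open>Re \<phi>\<close> and hence \<open>\<phi>'\<close> are polynomially bounded there. On suitable circles, and by the maximum principle
  everywhere, there is a bound \<open>exp (K r ^ N)\<close>. This is the input for the Phragmen-Lindelof principle for \<open>\<phi>'\<close>, and Liouville's
  theorem finishes the proof. Passing to \<open>\<phi>'\<close> turns bounds for a real part into bounds for a norm.
\<close>
lemma exponent_polynomial:
  fixes F G \<phi> :: "complex \<Rightarrow> complex" and k :: "complex \<Rightarrow> int"
  assumes A: "A \<ge> 0" and X: "finite X" "\<And>x. x \<in> X \<Longrightarrow> norm x \<le> A"
    and hol\<phi>: "\<phi> holomorphic_on UNIV"
    and F: "F holomorphic_on {z. norm z > A}" and G: "G holomorphic_on {z. norm z > A}"
    and FG: "\<And>z. norm z > A \<Longrightarrow> F z = G z * (\<Prod>x\<in>X. (z - x) powi k x) * exp (\<phi> z)"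
    and omF: "\<And>z. norm z > A \<Longrightarrow> z \<notin> Z \<Longrightarrow> F z \<noteq> 0 \<and> F z \<noteq> 1"
    and omG: "\<And>z. norm z > A \<Longrightarrow> z \<notin> Z \<Longrightarrow> G z \<noteq> 0 \<and> G z \<noteq> 1"
    and quad: "\<And>z. \<bar>Re z\<bar> > A \<Longrightarrow> \<bar>Im z\<bar> > A \<Longrightarrow> z \<notin> Z"
    and fin: "\<And>r. r \<ge> 1 \<Longrightarrow> finite {z\<in>Z. norm z \<le> r}"
    and card: "\<And>r. r \<ge> 1 \<Longrightarrow> real (card {z\<in>Z. norm z \<le> r}) \<le> K0 * r ^ k0"
  obtains n c where "\<And>z. \<phi> z = (\<Sum>i\<le>n. c i * z ^ i)"
proof -
  have out: "norm z > A" if "\<bar>Re z\<bar> > A" for z using that abs_Re_le_cmod[of z] by linarith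
  obtain KF NF where KF: "KF \<ge> 0" "\<And>z. \<bar>Re z\<bar> \<ge> A + 1 \<Longrightarrow> \<bar>Im z\<bar> \<ge> A + 1 \<Longrightarrow> 1 + \<bar>ln (norm (F z))\<bar> \<le> KF * norm z ^ NF"
  proof (rule omitted_values_quadrants_bound[OF A, of F])
    show "F holomorphic_on {z. \<bar>Re z\<bar> > A \<and> \<bar>Im z\<bar> > A}" by (rule holomorphic_on_subset[OF F]) (use out in auto)
    show "F z \<noteq> 0 \<and> F z \<noteq> 1" if "\<bar>Re z\<bar> > A" "\<bar>Im z\<bar> > A" for z using omF[OF out quad] that by blast
  qed blast
  obtain KG NG where KG: "KG \<ge> 0" "\<And>z. \<bar>Re z\<bar> \<ge> A + 1 \<Longrightarrow> \<bar>Im z\<bar> \<ge> A + 1 \<Longrightarrow> 1 + \<bar>ln (norm (G z))\<bar> \<le> KG * norm z ^ NG"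
  proof (rule omitted_values_quadrants_bound[OF A, of G])
    show "G holomorphic_on {z. \<bar>Re z\<bar> > A \<and> \<bar>Im z\<bar> > A}" by (rule holomorphic_on_subset[OF G]) (use out in auto)
    show "G z \<noteq> 0 \<and> G z \<noteq> 1" if "\<bar>Re z\<bar> > A" "\<bar>Im z\<bar> > A" for z using omG[OF out quad] that by blast
  qed blast
  define k1 where "k1 = 2 * (\<Sum>x\<in>X. \<bar>real_of_int (k x)\<bar>)"
  have k1: "k1 \<ge> 0" by (auto simp: k1_def intro!: sum_nonneg)
  have Re\<phi>: "\<bar>Re (\<phi> z)\<bar> \<le> \<bar>ln (norm (F z))\<bar> + \<bar>ln (norm (G z))\<bar> + k1 * norm z"
    if z: "norm z \<ge> A + 1" "z \<notin> Z" for z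
  proof -
    define R where "R = (\<Prod>x\<in>X. (z - x) powi k x)"
    have nz: "F z \<noteq> 0" "G z \<noteq> 0" "norm z > 0" using omF[of z] omG[of z] z A by auto
    have eq: "F z = G z * R * exp (\<phi> z)" using FG[of z] z by (simp add: R_def)
    hence "R \<noteq> 0" using nz by auto
    have "ln (norm (F z)) = ln (norm (G z)) + ln (norm R) + Re (\<phi> z)"
      using nz \<open>R \<noteq> 0\<close> unfolding eq by (simp add: norm_mult ln_mult)
    moreover have "\<bar>ln (norm R)\<bar> \<le> (\<Sum>x\<in>X. \<bar>real_of_int (k x)\<bar>) * ln (2 * norm z)"
      unfolding R_def by (rule ln_prod_powi_bound[OF X]) (use z A in auto)
    moreover have "(\<Sum>x\<in>X. \<bar>real_of_int (k x)\<bar>) * ln (2 * norm z) \<le> (\<Sum>x\<in>X. \<bar>real_of_int (k x)\<bar>) * (2 * norm z)"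
      using ln_le_minus_one[of "2 * norm z"] nz by (intro mult_left_mono sum_nonneg) auto
    ultimately show ?thesis by (simp add: k1_def mult_ac)
  qed
  define A2 where "A2 = 2 * (A + 1)"
  \<comment> \<open>the diagonal ray lies in the first quadrant, where the bounds are already polynomial\<close>
  define u where "u = Complex (1 / sqrt 2) (1 / sqrt 2)"
  have nu: "norm u = 1" by (simp add: u_def complex_norm power_divide)
  have ray: "\<bar>Re (of_real t * u)\<bar> \<ge> A + 1 \<and> \<bar>Im (of_real t * u)\<bar> \<ge> A + 1 \<and> norm (of_real t * u) = t" if "t \<ge> A2" for t
  proof -
    have "sqrt 2 \<le> 2" using real_sqrt_le_mono[of 2 4] by simp
    hence "(A + 1) * sqrt 2 \<le> (A + 1) * 2" using A by (intro mult_left_mono) auto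
    hence "(A + 1) * sqrt 2 \<le> t" using that by (simp add: A2_def)
    hence "A + 1 \<le> t / sqrt 2" by (simp add: field_simps)
    moreover have "t \<ge> 0" using that A by (simp add: A2_def)
    ultimately show ?thesis using nu by (simp add: u_def norm_mult)
  qed
  obtain \<rho> where \<rho>: "\<And>r. r \<le> \<rho> r \<and> \<rho> r \<le> r + 1" "\<And>r z. r \<ge> 1 \<Longrightarrow> norm z = \<rho> r \<Longrightarrow> z \<notin> Z"
    "\<forall>(F :: complex \<Rightarrow> complex) K N R. F holomorphic_on {z. norm z > R} \<longrightarrow>
       (\<forall>z. norm z > R \<longrightarrow> z \<notin> Z \<longrightarrow> F z \<noteq> 0 \<and> F z \<noteq> 1) \<longrightarrow>
       (\<forall>t\<ge>R. 1 + \<bar>ln (norm (F (of_real t * u)))\<bar> \<le> K * t ^ N) \<longrightarrow>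
       (\<exists>R' K' N'. \<forall>r\<ge>R'. \<forall>z. norm z = \<rho> r \<longrightarrow> 1 + \<bar>ln (norm (F z))\<bar> \<le> exp (K' * r ^ N'))"
    using omitted_values_circles_bound[OF fin card nu] by blast
  have sub: "{z :: complex. norm z > A2} \<subseteq> {z. norm z > A}" using A by (auto simp: A2_def)
  have "\<exists>R' K' N'. \<forall>r\<ge>R'. \<forall>z. norm z = \<rho> r \<longrightarrow> 1 + \<bar>ln (norm (F z))\<bar> \<le> exp (K' * r ^ N')"
  proof (rule \<rho>(3)[rule_format, of F A2 KF NF])
    show "F holomorphic_on {z. norm z > A2}" using F sub holomorphic_on_subset by blast
    show "F z \<noteq> 0 \<and> F z \<noteq> 1" if "norm z > A2" "z \<notin> Z" for z using omF[of z] that sub by blast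
    show "1 + \<bar>ln (norm (F (of_real t * u)))\<bar> \<le> KF * t ^ NF" if "t \<ge> A2" for t
      using KF(2)[of "of_real t * u"] ray[OF that] by simp
  qed
  then obtain R1 K1 N1 where 1: "\<And>r z. r \<ge> R1 \<Longrightarrow> norm z = \<rho> r \<Longrightarrow> 1 + \<bar>ln (norm (F z))\<bar> \<le> exp (K1 * r ^ N1)"
    by metis
  have "\<exists>R' K' N'. \<forall>r\<ge>R'. \<forall>z. norm z = \<rho> r \<longrightarrow> 1 + \<bar>ln (norm (G z))\<bar> \<le> exp (K' * r ^ N')"
  proof (rule \<rho>(3)[rule_format, of G A2 KG NG])
    show "G holomorphic_on {z. norm z > A2}" using G sub holomorphic_on_subset by blast
    show "G z \<noteq> 0 \<and> G z \<noteq> 1" if "norm z > A2" "z \<notin> Z" for z using omG[of z] that sub by blast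
    show "1 + \<bar>ln (norm (G (of_real t * u)))\<bar> \<le> KG * t ^ NG" if "t \<ge> A2" for t
      using KG(2)[of "of_real t * u"] ray[OF that] by simp
  qed
  then obtain R2 K2 N2 where 2: "\<And>r z. r \<ge> R2 \<Longrightarrow> norm z = \<rho> r \<Longrightarrow> 1 + \<bar>ln (norm (G z))\<bar> \<le> exp (K2 * r ^ N2)"
    by metis
  define R3 where "R3 = \<bar>R1\<bar> + \<bar>R2\<bar> + A2 + 1"
  define g where "g = deriv \<phi>"
  have holg: "g holomorphic_on UNIV" unfolding g_def using hol\<phi> holomorphic_deriv by blast
  \<comment> \<open>first the bound \<open>exp (K r ^ N)\<close> for \<open>\<phi>'\<close>, from a circle that encloses the unit disc around \<open>s\<close>\<close>
  define K4 where "K4 = 18 + \<bar>K1\<bar> * 2 ^ N1 + \<bar>K2\<bar> * 2 ^ N2 + k1 * 3"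
  have crude: "norm (g s) \<le> exp (K4 * norm s ^ (N1 + N2 + 1))" if s: "norm s \<ge> R3" for s
  proof -
    define r where "r = norm s + 1"
    have r: "r \<ge> R1" "r \<ge> R2" "r \<ge> A + 1" "r \<ge> 1" "r \<le> 2 * norm s" "norm s \<ge> 1"
      using s A unfolding r_def R3_def A2_def by auto
    have \<rho>r: "r \<le> \<rho> r" "\<rho> r \<le> r + 1" using \<rho>(1) by auto
    define M where "M = exp (\<bar>K1\<bar> * r ^ N1) + exp (\<bar>K2\<bar> * r ^ N2) + k1 * (r + 1)"
    have bd: "\<bar>Re (\<phi> z)\<bar> \<le> M" if z: "norm z = \<rho> r" for z
    proof -
      have "exp (K1 * r ^ N1) \<le> exp (\<bar>K1\<bar> * r ^ N1)" "exp (K2 * r ^ N2) \<le> exp (\<bar>K2\<bar> * r ^ N2)"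
        using r by (auto intro!: mult_right_mono)
      moreover have "k1 * norm z \<le> k1 * (r + 1)" using k1 z \<rho>r by (intro mult_left_mono) auto
      moreover have "\<bar>Re (\<phi> z)\<bar> \<le> \<bar>ln (norm (F z))\<bar> + \<bar>ln (norm (G z))\<bar> + k1 * norm z"
      proof (rule Re\<phi>)
        show "norm z \<ge> A + 1" using z \<rho>r(1) r(3) by linarith
        show "z \<notin> Z" by (rule \<rho>(2)[OF r(4) z])
      qed
      ultimately show ?thesis using 1[OF r(1) z] 2[OF r(2) z] unfolding M_def by linarith
    qed
    have "norm (g s) \<le> 6 * M" unfolding g_def
    proof (rule deriv_bound_of_Re_bound)
      show "\<phi> holomorphic_on ball s 1" using hol\<phi> holomorphic_on_subset by blast
      have "exp (\<bar>K1\<bar> * r ^ N1) > 0" "exp (\<bar>K2\<bar> * r ^ N2) > 0" "k1 * (r + 1) \<ge> 0" using k1 r by auto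
      thus "M > 0" unfolding M_def by linarith
      fix z assume z: "z \<in> ball s 1"
      have "norm z \<le> norm s + 1" using z norm_triangle_ineq2[of z s] by (simp add: dist_norm norm_minus_commute)
      hence "norm z \<le> \<rho> r" using \<rho>r by (simp add: r_def)
      moreover have "\<rho> r > 0" using \<rho>r(1) r(4) by linarith
      ultimately show "\<bar>Re (\<phi> z)\<bar> \<le> M" by (intro Re_bound_max_principle[OF hol\<phi> _ bd])
    qed
    also have "\<dots> \<le> exp (18 + \<bar>K1\<bar> * r ^ N1 + \<bar>K2\<bar> * r ^ N2 + k1 * (r + 1))"
      unfolding M_def using k1 r by (intro sum_exp_le) auto
    also have "18 + \<bar>K1\<bar> * r ^ N1 + \<bar>K2\<bar> * r ^ N2 + k1 * (r + 1) \<le> K4 * norm s ^ (N1 + N2 + 1)"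
    proof -
      define S where "S = norm s ^ (N1 + N2 + 1)"
      have S1: "S \<ge> 1" unfolding S_def using r by (intro one_le_power) auto
      have pw: "norm s ^ j \<le> S" if "j \<le> N1 + N2 + 1" for j
        unfolding S_def using that r by (intro power_increasing) auto
      have "r ^ N1 \<le> (2 * norm s) ^ N1" "r ^ N2 \<le> (2 * norm s) ^ N2"
        using power_mono[OF r(5)] r(4) by simp_all
      hence "r ^ N1 \<le> 2 ^ N1 * S" "r ^ N2 \<le> 2 ^ N2 * S"
        using pw[of N1] pw[of N2] unfolding power_mult_distrib
        by (meson le_add1 le_add2 mult_left_mono order_trans zero_le_numeral zero_le_power trans_le_add1)+
      hence "\<bar>K1\<bar> * r ^ N1 \<le> \<bar>K1\<bar> * (2 ^ N1 * S)" "\<bar>K2\<bar> * r ^ N2 \<le> \<bar>K2\<bar> * (2 ^ N2 * S)"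
        by (auto intro!: mult_left_mono)
      moreover have "r + 1 \<le> 3 * S" using pw[of 1] S1 by (simp add: r_def)
      hence "k1 * (r + 1) \<le> k1 * (3 * S)" using k1 by (intro mult_left_mono)
      ultimately have "18 + \<bar>K1\<bar> * r ^ N1 + \<bar>K2\<bar> * r ^ N2 + k1 * (r + 1) \<le>
         18 * S + \<bar>K1\<bar> * (2 ^ N1 * S) + \<bar>K2\<bar> * (2 ^ N2 * S) + k1 * (3 * S)" using S1 by linarith
      also have "\<dots> = K4 * S" by (simp add: K4_def algebra_simps)
      finally show ?thesis by (simp add: S_def)
    qed
    finally show ?thesis by simp
  qed
  \<comment> \<open>now the polynomial bound in the quadrants, which are shrunk by 1 to make room for a unit disc at \<open>s\<close>\<close>
  define N where "N = NF + NG + 1"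
  define K where "K = 6 * (KF * 2 ^ N + KG * 2 ^ N + k1 * 2 ^ N + 1)"
  have quadg: "norm (g s) \<le> K * norm s ^ N" if s: "\<bar>Re s\<bar> \<ge> A + 2" "\<bar>Im s\<bar> \<ge> A + 2" for s
  proof -
    have ns: "norm s \<ge> 1" using s A abs_Re_le_cmod[of s] by linarith
    define M where "M = (KF + KG + k1) * (2 * norm s) ^ N + 1"
    have "norm (g s) \<le> 6 * M" unfolding g_def
    proof (rule deriv_bound_of_Re_bound)
      show "\<phi> holomorphic_on ball s 1" using hol\<phi> holomorphic_on_subset by blast
      have "(KF + KG + k1) * (2 * norm s) ^ N \<ge> 0" using KF(1) KG(1) k1 by simp
      thus "M > 0" unfolding M_def by linarith
      fix z assume "z \<in> ball s 1"
      hence d: "norm (z - s) < 1" by (simp add: dist_norm norm_minus_commute)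
      have "\<bar>Re z - Re s\<bar> < 1" "\<bar>Im z - Im s\<bar> < 1"
        using abs_Re_le_cmod[of "z - s"] abs_Im_le_cmod[of "z - s"] d by auto
      hence z: "\<bar>Re z\<bar> \<ge> A + 1" "\<bar>Im z\<bar> \<ge> A + 1" using s by linarith+
      have nz: "norm z \<ge> A + 1" using z abs_Re_le_cmod[of z] by linarith
      have n2: "norm z \<le> 2 * norm s" using norm_triangle_ineq2[of z s] d ns by linarith
      have "1 \<le> norm z" using nz A by linarith
      hence pw: "norm z ^ j \<le> (2 * norm s) ^ N" if "j \<le> N" for j
        using power_increasing[OF that, of "norm z"] power_mono[OF n2, of N] by simp
      have "z \<notin> Z" by (rule quad) (use z in linarith)+
      hence "\<bar>Re (\<phi> z)\<bar> \<le> \<bar>ln (norm (F z))\<bar> + \<bar>ln (norm (G z))\<bar> + k1 * norm z" by (intro Re\<phi> nz)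
      also have "\<dots> \<le> KF * norm z ^ NF + KG * norm z ^ NG + k1 * norm z ^ 1"
        using KF(2)[OF z] KG(2)[OF z] by simp
      also have "\<dots> \<le> KF * (2 * norm s) ^ N + KG * (2 * norm s) ^ N + k1 * (2 * norm s) ^ N"
        using KF(1) KG(1) k1 by (intro add_mono mult_left_mono pw) (auto simp: N_def)
      also have "\<dots> \<le> M" by (simp add: M_def algebra_simps)
      finally show "\<bar>Re (\<phi> z)\<bar> \<le> M" .
    qed
    also have "6 * M = 6 * (KF * 2 ^ N + KG * 2 ^ N + k1 * 2 ^ N) * norm s ^ N + 6"
      by (simp add: M_def power_mult_distrib algebra_simps)
    also have "\<dots> \<le> K * norm s ^ N" using one_le_power[OF ns, of N] by (simp add: K_def algebra_simps)
    finally show ?thesis .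
  qed
  obtain K' where K': "\<And>z. norm z \<ge> 2 * (A + 2) \<Longrightarrow> norm (g z) \<le> K' * norm z ^ N"
  proof (rule poly_growth_of_quadrants[OF holg _ crude quadg])
    show "A + 2 \<ge> 1" using A by simp
  qed blast+
  have "compact (cball (0::complex) (2 * (A + 2)))" by simp
  hence "bounded (g ` cball 0 (2 * (A + 2)))"
    using holg by (meson compact_continuous_image compact_imp_bounded continuous_on_subset holomorphic_on_imp_continuous_on subset_UNIV)
  then obtain B where B: "\<And>z. norm z \<le> 2 * (A + 2) \<Longrightarrow> norm (g z) \<le> B"
    unfolding bounded_iff by fastforce
  have B0: "B \<ge> 0" using B[of 0] A norm_ge_zero[of "g 0"] by (simp del: norm_ge_zero)
  have grow: "norm (\<phi> z) \<le> (norm (\<phi> 0) + B + \<bar>K'\<bar>) * norm z ^ (N + 1)" if z: "1 \<le> norm z" for z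
  proof -
    have gb: "norm (g w) \<le> B + \<bar>K'\<bar> * norm z ^ N" if w: "w \<in> cball 0 (norm z)" for w
    proof (cases "norm w \<le> 2 * (A + 2)")
      case True
      thus ?thesis using B[of w] by (simp add: add_increasing2)
    next
      case False
      hence "norm (g w) \<le> K' * norm w ^ N" by (intro K') auto
      also have "\<dots> \<le> \<bar>K'\<bar> * norm z ^ N" using w by (intro mult_mono power_mono) auto
      finally show ?thesis using B0 by linarith
    qed
    have "norm (\<phi> z - \<phi> 0) \<le> (B + \<bar>K'\<bar> * norm z ^ N) * norm (z - 0)"
    proof (rule field_differentiable_bound[where S = "cball 0 (norm z)" and f' = g])
      show "(\<phi> has_field_derivative g w) (at w within cball 0 (norm z))" if "w \<in> cball 0 (norm z)" for w
        unfolding g_def using holomorphic_derivI[OF hol\<phi>, of w] DERIV_subset by blast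
    qed (use gb in auto)
    hence "norm (\<phi> z) \<le> norm (\<phi> 0) + (B + \<bar>K'\<bar> * norm z ^ N) * norm z"
      using norm_triangle_ineq2[of "\<phi> z" "\<phi> 0"] by simp
    also have "\<dots> \<le> norm (\<phi> 0) * norm z ^ (N + 1) + (B * norm z ^ N + \<bar>K'\<bar> * norm z ^ N) * norm z"
    proof (intro add_mono mult_right_mono)
      show "norm (\<phi> 0) \<le> norm (\<phi> 0) * norm z ^ (N + 1)"
        using mult_left_mono[OF one_le_power[OF z, of "N+1"], of "norm (\<phi> 0)"] by simp
      show "B \<le> B * norm z ^ N" using mult_left_mono[OF one_le_power[OF z, of N] B0] by simp
    qed auto
    also have "\<dots> = (norm (\<phi> 0) + B + \<bar>K'\<bar>) * norm z ^ (N + 1)" by (simp add: algebra_simps)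
    finally show ?thesis .
  qed
  show ?thesis
    by (rule that[of "\<lambda>i. (deriv ^^ i) \<phi> 0 / fact i" "N + 1"]) (rule Liouville_polynomial[OF hol\<phi> grow])
qed

text \<open>
  Suppose \<open>\<phi>\<close> has degree \<open>p \<ge> 2\<close> with leading coefficient \<open>c p\<close>. As \<open>ln |G|\<close> and the rational factor contribute only
  \<open>O(T)\<close>, \<open>|ln |F (T \<omega>)|| / T ^ p\<close> tends to \<open>|Re (c p * \<omega> ^ p)|\<close> in every direction \<open>\<omega>\<close> of the right half-plane. By the
  logarithmic Schottky inequality these limits are comparable in nearby directions, so if one of them vanishes, all
  directions nearby have limit 0. But \<open>Re (c p * cis t ^ p)\<close> has an isolated zero with \<open>|t| \<le> pi / 4\<close>, since its zeros
  have spacing \<open>pi / p \<le> pi / 2\<close>.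
\<close>
lemma exponent_linear:
  fixes F G \<phi> :: "complex \<Rightarrow> complex" and k :: "complex \<Rightarrow> int" and c :: "nat \<Rightarrow> complex"
  assumes A: "A \<ge> 0" and X: "finite X" "\<And>x. x \<in> X \<Longrightarrow> norm x \<le> A"
    and F: "F holomorphic_on {z. Re z > A}"
    and FG: "\<And>z. Re z > A \<Longrightarrow> F z = G z * (\<Prod>x\<in>X. (z - x) powi k x) * exp (\<phi> z)"
    and omF: "\<And>z. Re z > A \<Longrightarrow> F z \<noteq> 0 \<and> F z \<noteq> 1"
    and bdG: "\<And>z. Re z > A \<Longrightarrow> \<bar>ln (norm (G z))\<bar> \<le> KG * norm z"
    and \<phi>: "\<And>z. \<phi> z = (\<Sum>i\<le>n. c i * z ^ i)"
  obtains c0 c1 where "\<And>z. \<phi> z = c0 + c1 * z"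
proof (cases "\<exists>i\<in>{2..n}. c i \<noteq> 0")
  case False
  have "\<phi> z = c 0 + (if n = 0 then 0 else c 1) * z" for z
  proof (cases "n = 0")
    case False
    have "(\<Sum>i\<le>n. c i * z ^ i) = (\<Sum>i\<in>{0,1}. c i * z ^ i)"
      by (rule sum.mono_neutral_right) (use False \<open>\<not> (\<exists>i\<in>{2..n}. c i \<noteq> 0)\<close> in \<open>auto simp: not_less_eq_eq\<close>)
    thus ?thesis using False by (simp add: \<phi>)
  qed (simp add: \<phi>)
  thus ?thesis using that by blast
next
  case True
  define S where "S = {i\<in>{2..n}. c i \<noteq> 0}"
  have S: "finite S" "S \<noteq> {}" using True by (auto simp: S_def)
  define p where "p = Max S"
  have p: "p \<in> S" unfolding p_def by (rule Max_in[OF S])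
  hence p2: "p \<ge> 2" "p \<le> n" and cp: "c p \<noteq> 0" by (auto simp: S_def)
  have hi: "c i = 0" if "p < i" "i \<le> n" for i
  proof (rule ccontr)
    assume "c i \<noteq> 0"
    hence "i \<in> S" using that p2 by (auto simp: S_def)
    hence "i \<le> p" unfolding p_def by (rule Max_ge[OF S(1)])
    thus False using that by simp
  qed
  have \<phi>p: "\<phi> z = (\<Sum>i\<le>p. c i * z ^ i)" for z
    unfolding \<phi> by (rule sum.mono_neutral_right) (use p2 hi in auto)
  have nX: "norm z > A" if "Re z > A" for z using that complex_Re_le_cmod[of z] by linarith
  have inv0: "((\<lambda>T::real. (1 / T) ^ j) \<longlongrightarrow> 0) at_top" if "j > 0" for j :: nat
    using tendsto_power[of "\<lambda>T::real. 1 / T" 0 at_top j] that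
      tendsto_divide_0[OF tendsto_const filterlim_at_top_imp_at_infinity[OF filterlim_ident], of 1]
    by (auto simp: zero_power)
  have lim: "((\<lambda>T. \<bar>ln (norm (F (of_real T * \<omega>)))\<bar> / T ^ p) \<longlongrightarrow> \<bar>Re (c p * \<omega> ^ p)\<bar>) at_top"
    if \<omega>: "norm \<omega> = 1" "Re \<omega> > 0" for \<omega>
  proof -
    have "((\<lambda>T. \<Sum>i\<le>p. c i * \<omega> ^ i * of_real ((1 / T) ^ (p - i))) \<longlongrightarrow> (\<Sum>i\<le>p. if i = p then c p * \<omega> ^ p else 0)) at_top"
    proof (rule tendsto_sum)
      fix i assume "i \<in> {..p}"
      show "((\<lambda>T. c i * \<omega> ^ i * of_real ((1 / T) ^ (p - i))) \<longlongrightarrow> (if i = p then c p * \<omega> ^ p else 0)) at_top"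
      proof (cases "i = p")
        case False
        hence "p - i > 0" using \<open>i \<in> {..p}\<close> by auto
        from tendsto_of_real[OF inv0[OF this], where ?'a = complex]
        have "((\<lambda>T. c i * \<omega> ^ i * of_real ((1 / T) ^ (p - i))) \<longlongrightarrow> c i * \<omega> ^ i * of_real 0) at_top"
          by (rule tendsto_mult[OF tendsto_const])
        thus ?thesis using False by simp
      qed simp
    qed
    hence 1: "((\<lambda>T. Re (\<Sum>i\<le>p. c i * \<omega> ^ i * of_real ((1 / T) ^ (p - i)))) \<longlongrightarrow> Re (c p * \<omega> ^ p)) at_top"
      by (intro tendsto_Re) simp
    define K where "K = \<bar>KG\<bar> + 2 * (\<Sum>x\<in>X. \<bar>real_of_int (k x)\<bar>)"
    define T0 where "T0 = (A + 2) / Re \<omega>"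
    define e where "e = (\<lambda>T. ln (norm (F (of_real T * \<omega>))) - Re (\<phi> (of_real T * \<omega>)))"
    have T: "T > 0 \<and> Re (of_real T * \<omega>) \<ge> A + 2 \<and> norm (of_real T * \<omega>) = T" if "T \<ge> T0" for T
    proof -
      have "T0 > 0" using A \<omega> by (simp add: T0_def)
      moreover from this have "T > 0" using that by linarith
      ultimately show ?thesis using that \<omega> by (simp add: T0_def norm_mult field_simps)
    qed
    have eb: "\<bar>e T\<bar> \<le> K * T" if "T \<ge> T0" for T
    proof -
      define z where "z = of_real T * \<omega>"
      have z: "Re z \<ge> A + 2" "norm z = T" "T > 0" using T[OF that] by (auto simp: z_def)
      define R where "R = (\<Prod>x\<in>X. (z - x) powi k x)"
      have eq: "F z = G z * R * exp (\<phi> z)" using FG[of z] z by (simp add: R_def)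
      have nz: "G z \<noteq> 0" "R \<noteq> 0" using omF[of z] z eq by auto
      have "ln (norm (F z)) = ln (norm (G z)) + ln (norm R) + Re (\<phi> z)"
        using nz unfolding eq by (simp add: norm_mult ln_mult)
      moreover have "\<bar>ln (norm R)\<bar> \<le> (\<Sum>x\<in>X. \<bar>real_of_int (k x)\<bar>) * ln (2 * norm z)"
        unfolding R_def by (rule ln_prod_powi_bound[OF X]) (use z A complex_Re_le_cmod[of z] in auto)
      moreover have "(\<Sum>x\<in>X. \<bar>real_of_int (k x)\<bar>) * ln (2 * norm z) \<le> (\<Sum>x\<in>X. \<bar>real_of_int (k x)\<bar>) * (2 * T)"
        using ln_le_minus_one[of "2 * norm z"] z by (intro mult_left_mono sum_nonneg) auto
      moreover have "\<bar>ln (norm (G z))\<bar> \<le> KG * T" using bdG[of z] z by simp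
      moreover have "KG * T \<le> \<bar>KG\<bar> * T" using z by (intro mult_right_mono) auto
      moreover have "e T = ln (norm (F z)) - Re (\<phi> z)" by (simp add: e_def z_def)
      ultimately have "\<bar>e T\<bar> \<le> \<bar>KG\<bar> * T + (\<Sum>x\<in>X. \<bar>real_of_int (k x)\<bar>) * (2 * T)" by linarith
      thus ?thesis by (simp add: K_def algebra_simps)
    qed
    have 2: "((\<lambda>T. e T / T ^ p) \<longlongrightarrow> 0) at_top"
    proof (rule Lim_null_comparison)
      have "((\<lambda>T. K * (1 / T) ^ (p - 1)) \<longlongrightarrow> K * 0) at_top"
        by (intro tendsto_mult tendsto_const inv0) (use p2 in auto)
      thus "((\<lambda>T. K * (1 / T) ^ (p - 1)) \<longlongrightarrow> 0) at_top" by simp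
      show "eventually (\<lambda>T. norm (e T / T ^ p) \<le> K * (1 / T) ^ (p - 1)) at_top"
        using eventually_ge_at_top[of T0]
      proof eventually_elim
        case (elim T)
        have T0: "T > 0" using T[OF elim] by auto
        have Tp: "T ^ p = T * T ^ (p - 1)" using p2 by (metis Suc_diff_1 le_trans not_less_eq_eq one_le_numeral power_Suc zero_less_iff_neq_zero not_one_le_zero numeral_2_eq_2 less_numeral_extra(1) zero_less_Suc order_less_le_trans)
        have "norm (e T / T ^ p) = \<bar>e T\<bar> / T ^ p" using T0 by simp
        also have "\<dots> \<le> (K * T) / T ^ p" using eb[OF elim] T0 by (intro divide_right_mono) auto
        also have "\<dots> = K * (1 / T) ^ (p - 1)" using T0 by (simp add: Tp power_one_over divide_simps)
        finally show ?case .
      qed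
    qed
    have "((\<lambda>T. \<bar>Re (\<Sum>i\<le>p. c i * \<omega> ^ i * of_real ((1 / T) ^ (p - i))) + e T / T ^ p\<bar>) \<longlongrightarrow> \<bar>Re (c p * \<omega> ^ p) + 0\<bar>) at_top"
      by (intro tendsto_rabs tendsto_add 1 2)
    moreover have "eventually (\<lambda>T. \<bar>Re (\<Sum>i\<le>p. c i * \<omega> ^ i * of_real ((1 / T) ^ (p - i))) + e T / T ^ p\<bar> =
        \<bar>ln (norm (F (of_real T * \<omega>)))\<bar> / T ^ p) at_top"
      using eventually_ge_at_top[of T0]
    proof eventually_elim
      case (elim T)
      have T0: "T > 0" using T[OF elim] by auto
      have "(\<Sum>i\<le>p. c i * \<omega> ^ i * of_real ((1 / T) ^ (p - i))) = (\<Sum>i\<le>p. c i * (of_real T * \<omega>) ^ i / of_real (T ^ p))"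
      proof (rule sum.cong)
        fix i assume "i \<in> {..p}"
        hence "T ^ p = T ^ i * T ^ (p - i)" by (simp flip: power_add)
        thus "c i * \<omega> ^ i * of_real ((1 / T) ^ (p - i)) = c i * (of_real T * \<omega>) ^ i / of_real (T ^ p)"
          using T0 by (simp add: power_mult_distrib power_one_over field_simps)
      qed simp
      also have "\<dots> = \<phi> (of_real T * \<omega>) / of_real (T ^ p)" by (simp add: \<phi>p sum_divide_distrib)
      finally have "Re (\<Sum>i\<le>p. c i * \<omega> ^ i * of_real ((1 / T) ^ (p - i))) + e T / T ^ p = ln (norm (F (of_real T * \<omega>))) / T ^ p"
        unfolding e_def by (simp add: Re_divide_of_real diff_divide_distrib del: of_real_power)
      thus ?case using T0 by simp
    qed
    ultimately show ?thesis by (simp add: tendsto_cong)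
  qed
  obtain C where SC: "schottky_const C" using schottky_const_exists by blast
  have key: "\<bar>Re (c p * \<omega>' ^ p)\<bar> \<le> C * \<bar>Re (c p * \<omega> ^ p)\<bar>"
    if \<omega>: "norm \<omega> = 1" "Re \<omega> > 0" "norm \<omega>' = 1" "Re \<omega>' > 0" "dist \<omega> \<omega>' \<le> Re \<omega> / 4" for \<omega> \<omega>'
  proof -
    have i0: "((\<lambda>T::real. 1 / T ^ p) \<longlongrightarrow> 0) at_top" using inv0[of p] p2 by (simp add: power_one_over)
    have "((\<lambda>T. C * (1 / T ^ p + \<bar>ln (norm (F (of_real T * \<omega>)))\<bar> / T ^ p)) \<longlongrightarrow> C * (0 + \<bar>Re (c p * \<omega> ^ p)\<bar>)) at_top"
      by (intro tendsto_mult tendsto_add tendsto_const i0 lim \<omega>)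
    moreover have "((\<lambda>T. 1 / T ^ p + \<bar>ln (norm (F (of_real T * \<omega>')))\<bar> / T ^ p) \<longlongrightarrow> 0 + \<bar>Re (c p * \<omega>' ^ p)\<bar>) at_top"
      by (intro tendsto_add i0 lim \<omega>)
    moreover have "eventually (\<lambda>T. 1 / T ^ p + \<bar>ln (norm (F (of_real T * \<omega>')))\<bar> / T ^ p \<le>
       C * (1 / T ^ p + \<bar>ln (norm (F (of_real T * \<omega>)))\<bar> / T ^ p)) at_top"
      using eventually_ge_at_top[of "2 * (A + 1) / Re \<omega>"]
    proof eventually_elim
      case (elim T)
      hence TA: "T * Re \<omega> / 2 \<ge> A + 1" using \<omega> by (simp add: field_simps)
      hence T0: "T > 0" using A \<omega> by (smt (verit) zero_less_mult_pos2 field_sum_of_halves)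
      have sub: "Re z > A" if "z \<in> ball (of_real T * \<omega>) (T * Re \<omega> / 2)" for z
      proof -
        have "\<bar>Re (of_real T * \<omega> - z)\<bar> < T * Re \<omega> / 2" using that abs_Re_le_cmod[of "of_real T * \<omega> - z"] by (simp add: dist_norm)
        hence "\<bar>T * Re \<omega> - Re z\<bar> < T * Re \<omega> / 2" by simp
        thus ?thesis using TA by linarith
      qed
      have "1 + \<bar>ln (norm (F (of_real T * \<omega>')))\<bar> \<le> C * (1 + \<bar>ln (norm (F (of_real T * \<omega>)))\<bar>)"
      proof (rule schottky_constD(2)[OF SC, where F = F and \<delta> = "T * Re \<omega> / 2" and x = "of_real T * \<omega>" and y = "of_real T * \<omega>'"])
        show "F holomorphic_on ball (of_real T * \<omega>) (T * Re \<omega> / 2)"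
          by (rule holomorphic_on_subset[OF F]) (use sub in blast)
        show "F z \<noteq> 0 \<and> F z \<noteq> 1" if "z \<in> ball (of_real T * \<omega>) (T * Re \<omega> / 2)" for z
          using omF[OF sub[OF that]] .
        have "dist (of_real T * \<omega>) (of_real T * \<omega>') = T * dist \<omega> \<omega>'"
          using T0 by (simp add: dist_norm norm_mult flip: right_diff_distrib)
        also have "\<dots> \<le> T * (Re \<omega> / 4)" using \<omega>(5) T0 by (intro mult_left_mono) auto
        finally show "dist (of_real T * \<omega>) (of_real T * \<omega>') \<le> T * Re \<omega> / 2 / 2" by simp
        show "0 < T * Re \<omega> / 2" using T0 \<omega> by simp
      qed
      hence "(1 + \<bar>ln (norm (F (of_real T * \<omega>')))\<bar>) / T ^ p \<le> C * (1 + \<bar>ln (norm (F (of_real T * \<omega>)))\<bar>) / T ^ p"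
        using T0 by (intro divide_right_mono) auto
      thus ?case by (simp add: add_divide_distrib distrib_left)
    qed
    ultimately have "0 + \<bar>Re (c p * \<omega>' ^ p)\<bar> \<le> C * (0 + \<bar>Re (c p * \<omega> ^ p)\<bar>)"
      by (intro tendsto_le[OF trivial_limit_at_top_linorder])
    thus ?thesis by simp
  qed
  define \<gamma> where "\<gamma> = Arg (c p)"
  have \<gamma>: "-pi < \<gamma>" "\<gamma> \<le> pi" "c p = of_real (norm (c p)) * cis \<gamma>"
    using Arg_bounded[of "c p"] cp rcis_cmod_Arg[of "c p"] by (auto simp: \<gamma>_def rcis_def)
  have Recis: "Re (c p * cis t ^ p) = norm (c p) * cos (\<gamma> + p * t)" for t :: real
  proof -
    have "c p * cis t ^ p = of_real (norm (c p)) * cis (\<gamma> + p * t)"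
    proof -
      have "cis \<gamma> * cis t ^ p = cis (\<gamma> + p * t)" unfolding Complex.DeMoivre by (simp add: cis_mult)
      thus ?thesis by (subst \<gamma>(3)) (simp only: mult.assoc)
    qed
    thus ?thesis by simp
  qed
  \<comment> \<open>the critical direction: the argument of \<open>c p * cis \<theta> ^ p\<close> is \<open>pi / 2\<close> or \<open>- pi / 2\<close>, whichever is closer to \<open>\<gamma>\<close>\<close>
  define \<theta> where "\<theta> = ((if \<gamma> \<ge> 0 then pi / 2 else - pi / 2) - \<gamma>) / p"
  have p0: "real p > 0" using p2 by simp
  have \<theta>p: "\<gamma> + p * \<theta> = (if \<gamma> \<ge> 0 then pi / 2 else - pi / 2)" using p0 by (simp add: \<theta>_def)
  have "\<bar>(if \<gamma> \<ge> 0 then pi / 2 else - pi / 2) - \<gamma>\<bar> \<le> pi / 2"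
    unfolding abs_le_iff using \<gamma>(1,2) by (auto split: if_splits)
  hence "\<bar>\<theta>\<bar> \<le> (pi / 2) / p" using p0 unfolding \<theta>_def abs_divide by (intro frac_le) auto
  also have "\<dots> \<le> (pi / 2) / 2" using p2 by (intro divide_left_mono) auto
  finally have \<theta>: "\<bar>\<theta>\<bar> \<le> pi / 4" by simp
  have pos: "cos t > 0" if "\<bar>t\<bar> < pi / 2" for t using that by (intro cos_gt_zero_pi) auto
  have "\<bar>\<theta>\<bar> < pi / 2" using \<theta> pi_gt_zero by linarith
  hence Re\<theta>: "Re (cis \<theta>) > 0" using pos by simp
  have "isCont (\<lambda>t. dist (cis \<theta>) (cis t)) \<theta>" unfolding cis_conv_exp by (intro continuous_intros)
  hence "((\<lambda>t. dist (cis \<theta>) (cis t)) \<longlongrightarrow> dist (cis \<theta>) (cis \<theta>)) (at \<theta>)" by (simp add: isCont_def)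
  hence "eventually (\<lambda>t. dist (cis \<theta>) (cis t) < Re (cis \<theta>) / 4) (at \<theta>)"
    by (rule order_tendstoD) (use Re\<theta> in simp)
  then obtain d where d: "d > 0" "\<And>t. t \<noteq> \<theta> \<Longrightarrow> dist t \<theta> < d \<Longrightarrow> dist (cis \<theta>) (cis t) < Re (cis \<theta>) / 4"
    unfolding eventually_at by auto
  \<comment> \<open>\<open>p * \<epsilon>\<close> is less than \<open>pi\<close>, so the rotated direction is not critical again\<close>
  define \<epsilon> where "\<epsilon> = min (d / 2) (1 / (2 * p))"
  have "\<epsilon> \<le> 1 / (2 * p)" by (simp add: \<epsilon>_def)
  moreover have "1 / (2 * real p) \<le> 1 / 2" using p2 by (simp add: divide_simps)
  moreover have "real p * (1 / (2 * p)) = 1 / 2" using p0 by simp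
  ultimately have \<epsilon>1: "p * \<epsilon> \<le> 1/2" "\<epsilon> \<le> 1/2"
    using p0 mult_left_mono[of \<epsilon> "1 / (2 * p)" "real p"] by linarith+
  have \<epsilon>: "\<epsilon> > 0" "\<epsilon> < d" "p * \<epsilon> \<le> 1/2" "\<epsilon> \<le> 1/2"
    using d p0 \<epsilon>1 by (auto simp: \<epsilon>_def min_less_iff_disj)
  have "\<bar>Re (c p * cis (\<theta> + \<epsilon>) ^ p)\<bar> \<le> C * \<bar>Re (c p * cis \<theta> ^ p)\<bar>"
  proof (rule key)
    have "\<bar>\<theta> + \<epsilon>\<bar> < pi / 2" using \<theta> \<epsilon> pi_gt3 by linarith
    thus "Re (cis (\<theta> + \<epsilon>)) > 0" using pos by simp
    show "dist (cis \<theta>) (cis (\<theta> + \<epsilon>)) \<le> Re (cis \<theta>) / 4"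
      using d(2)[of "\<theta> + \<epsilon>"] \<epsilon> by (simp add: dist_norm)
  qed (use Re\<theta> in auto)
  also have "Re (c p * cis \<theta> ^ p) = 0" unfolding Recis \<theta>p by simp
  finally have "Re (c p * cis (\<theta> + \<epsilon>) ^ p) = 0" by simp
  hence "cos (\<gamma> + p * (\<theta> + \<epsilon>)) = 0" unfolding Recis using cp by simp
  hence "cos ((if \<gamma> \<ge> 0 then pi / 2 else - pi / 2) + p * \<epsilon>) = 0" using \<theta>p by (simp add: distrib_left add.assoc[symmetric])
  hence "sin (p * \<epsilon>) = 0" by (auto simp: cos_add split: if_splits)
  moreover have "sin (p * \<epsilon>) > 0" using \<epsilon> p0 pi_gt3 by (intro sin_gt_zero) auto
  ultimately show ?thesis by simp
qed

section \<open>Rarely taken values and horizontal crossings\<close>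

text \<open>
  Points at distance at least \<open>d\<close> lie in different cells of a square grid of mesh \<open>d / 2\<close>.
\<close>
lemma card_separated_box:
  fixes B :: "complex set" and a b d T :: real
  assumes d: "d > 0"
    and box: "\<And>z. z \<in> B \<Longrightarrow> a \<le> Re z \<and> Re z \<le> b \<and> T \<le> Im z \<and> Im z \<le> T + 3"
    and sep: "\<And>z w. z \<in> B \<Longrightarrow> w \<in> B \<Longrightarrow> z \<noteq> w \<Longrightarrow> dist z w \<ge> d"
  shows "finite B \<and> card B \<le> card ({\<lfloor>2 * a / d\<rfloor>..\<lfloor>2 * b / d\<rfloor>} \<times> {0..\<lfloor>6 / d\<rfloor>})"
proof -
  define q where "q = (\<lambda>z. (\<lfloor>2 * Re z / d\<rfloor>, \<lfloor>2 * (Im z - T) / d\<rfloor>))"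
  have inj: "inj_on q B"
  proof (rule inj_onI, rule ccontr)
    fix z w assume zw: "z \<in> B" "w \<in> B" "q z = q w" "z \<noteq> w"
    have "\<bar>2 * Re z / d - 2 * Re w / d\<bar> < 1" "\<bar>2 * (Im z - T) / d - 2 * (Im w - T) / d\<bar> < 1"
      using zw(3) unfolding q_def prod.inject by linarith+
    moreover have "2 * Re z / d - 2 * Re w / d = 2 * Re (z - w) / d"
      by (simp add: diff_divide_distrib right_diff_distrib)
    moreover have "2 * (Im z - T) / d - 2 * (Im w - T) / d = 2 * Im (z - w) / d"
      unfolding diff_divide_distrib[symmetric] by (simp add: algebra_simps)
    ultimately have "\<bar>2 * Re (z - w) / d\<bar> < 1" "\<bar>2 * Im (z - w) / d\<bar> < 1" by metis+
    hence "\<bar>Re (z - w)\<bar> < d / 2" "\<bar>Im (z - w)\<bar> < d / 2"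
      using d unfolding abs_divide abs_mult by (simp_all add: pos_divide_less_eq del: minus_complex.sel)
    hence "dist z w < d" using cmod_le[of "z - w"] by (simp add: dist_norm)
    thus False using sep[OF zw(1,2,4)] by simp
  qed
  have sub: "q ` B \<subseteq> {\<lfloor>2 * a / d\<rfloor>..\<lfloor>2 * b / d\<rfloor>} \<times> {0..\<lfloor>6 / d\<rfloor>}"
  proof (rule image_subsetI)
    fix z assume "z \<in> B"
    note bz = box[OF this]
    have "2 * a / d \<le> 2 * Re z / d" "2 * Re z / d \<le> 2 * b / d" "0 \<le> 2 * (Im z - T) / d" "2 * (Im z - T) / d \<le> 6 / d"
      using bz d by (auto intro!: divide_right_mono)
    thus "q z \<in> {\<lfloor>2 * a / d\<rfloor>..\<lfloor>2 * b / d\<rfloor>} \<times> {0..\<lfloor>6 / d\<rfloor>}"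
      by (auto simp: q_def intro!: floor_mono)
  qed
  show ?thesis using card_inj_on_le[OF inj sub] inj_on_finite[OF inj sub] by simp
qed

lemma finite_solutions_rational:
  fixes k :: "complex \<Rightarrow> int" and v :: complex
  assumes X: "finite X" and nc: "z0 \<notin> X" "(\<Prod>x\<in>X. (z0 - x) powi k x) \<noteq> v"
  shows "finite {z. z \<notin> X \<and> (\<Prod>x\<in>X. (z - x) powi k x) = v}"
proof -
  define P where "P = (\<Prod>x\<in>X. [:-x, 1:] ^ nat (k x))"
  define Q where "Q = (\<Prod>x\<in>X. [:-x, 1:] ^ nat (- k x))"
  have pq: "(\<Prod>x\<in>X. (z - x) powi k x) = v \<longleftrightarrow> poly (P - smult v Q) z = 0" if "z \<notin> X" for z
  proof -
    have "(z - x) powi k x = (z - x) ^ nat (k x) / (z - x) ^ nat (- k x)" for x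
      by (cases "k x \<ge> 0") (auto simp: power_int_def field_simps)
    hence "(\<Prod>x\<in>X. (z - x) powi k x) = poly P z / poly Q z"
      by (simp add: P_def Q_def poly_prod prod_dividef)
    moreover have "poly Q z \<noteq> 0" using that X by (auto simp: Q_def poly_prod)
    ultimately have "poly P z = (\<Prod>x\<in>X. (z - x) powi k x) * poly Q z" "poly Q z \<noteq> 0" by (auto simp: field_simps)
    thus ?thesis by simp
  qed
  have "P - smult v Q \<noteq> 0" using pq[OF nc(1)] nc(2) by auto
  hence "finite {z. poly (P - smult v Q) z = 0}" by (rule poly_roots_finite)
  thus ?thesis by (rule rev_finite_subset) (use pq in auto)
qed

text \<open>
  If \<open>c1 = 0\<close>, then \<open>h\<close> is rational and the set of solutions is finite. Otherwise two solutions \<open>z\<close> and \<open>w\<close> high up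
  satisfy \<open>exp E = 1\<close> with \<open>E = c1 (w - z) + \<Sum>x. k x * Ln ((w - x) / (z - x))\<close>, where the sum is small compared with the first
  term. If \<open>z\<close> and \<open>w\<close> are distinct and close, \<open>E\<close> is non-zero and of norm less than \<open>2 pi\<close>, which is
  impossible. So the solutions are separated.
\<close>
lemma sparse_solutions:
  fixes X :: "complex set" and k :: "complex \<Rightarrow> int" and c0 c1 v :: complex
  defines "h \<equiv> (\<lambda>z. (\<Prod>x\<in>X. (z - x) powi k x) * exp (c0 + c1 * z))"
  assumes X: "finite X" and v: "v \<noteq> 0" and nc: "z0 \<notin> X" "h z0 \<noteq> v"
  obtains M T0 where "\<And>T. T \<ge> T0 \<Longrightarrow> finite {z. a \<le> Re z \<and> Re z \<le> b \<and> T \<le> Im z \<and> Im z \<le> T + 3 \<and> h z = v} \<and>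
      card {z. a \<le> Re z \<and> Re z \<le> b \<and> T \<le> Im z \<and> Im z \<le> T + 3 \<and> h z = v} \<le> (M::nat)"
proof -
  obtain R where R: "R \<ge> 0" "\<And>x. x \<in> X \<Longrightarrow> norm x \<le> R"
    using finite_imp_bounded[OF X] unfolding bounded_iff by (metis abs_ge_self abs_ge_zero order_trans)
  show ?thesis
  proof (cases "c1 = 0")
    case True
    define w where "w = v / exp c0"
    have eq: "h z = v \<longleftrightarrow> (\<Prod>x\<in>X. (z - x) powi k x) = w" for z
      using True by (simp add: h_def w_def field_simps)
    have fin: "finite {z. z \<notin> X \<and> (\<Prod>x\<in>X. (z - x) powi k x) = w}"
      by (rule finite_solutions_rational[OF X nc(1)]) (use nc eq in auto)
    then obtain R' where R': "\<And>z. z \<notin> X \<Longrightarrow> h z = v \<Longrightarrow> norm z \<le> R'"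
      using finite_imp_bounded[OF fin] unfolding bounded_iff eq by blast
    have "{z. a \<le> Re z \<and> Re z \<le> b \<and> T \<le> Im z \<and> Im z \<le> T + 3 \<and> h z = v} = {}" if "T \<ge> \<bar>R\<bar> + \<bar>R'\<bar> + 1" for T
    proof -
      have False if z: "T \<le> Im z" "h z = v" for z
      proof -
        have "norm z \<ge> T" using z abs_Im_le_cmod[of z] by linarith
        moreover from this have "z \<notin> X" using R(2)[of z] \<open>T \<ge> \<bar>R\<bar> + \<bar>R'\<bar> + 1\<close> by auto
        ultimately show False using R'[of z] z \<open>T \<ge> \<bar>R\<bar> + \<bar>R'\<bar> + 1\<close> by auto
      qed
      thus ?thesis by blast
    qed
    note empty = this
    show ?thesis
    proof (rule that[of "\<bar>R\<bar> + \<bar>R'\<bar> + 1" 0])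
      fix T assume T: "T \<ge> \<bar>R\<bar> + \<bar>R'\<bar> + 1"
      show "finite {z. a \<le> Re z \<and> Re z \<le> b \<and> T \<le> Im z \<and> Im z \<le> T + 3 \<and> h z = v} \<and>
        card {z. a \<le> Re z \<and> Re z \<le> b \<and> T \<le> Im z \<and> Im z \<le> T + 3 \<and> h z = v} \<le> 0"
        unfolding empty[OF T] by simp
    qed
  next
    case False
    define s where "s = (\<Sum>x\<in>X. \<bar>real_of_int (k x)\<bar>)"
    have s0: "s \<ge> 0" by (auto simp: s_def intro!: sum_nonneg)
    define d where "d = min 1 (1 / norm c1)"
    have d: "d > 0" "d \<le> 1" "d * norm c1 \<le> 1" using False by (auto simp: d_def min_def field_simps)
    \<comment> \<open>this height makes the sum at most half of \<open>|c1 (w - z)|\<close>\<close>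
    define T0 where "T0 = R + 3 + 4 * s / norm c1"
    have sep: "dist z w \<ge> d" if zw: "Im z \<ge> T0" "Im w \<ge> T0" "h z = v" "h w = v" "z \<noteq> w" for z w
    proof (rule ccontr)
      assume "\<not> dist z w \<ge> d"
      hence zwd: "norm (w - z) < d" by (simp add: dist_norm norm_minus_commute)
      define t where "t = (\<lambda>x. (w - z) / (z - x))"
      have far: "norm (z - x) \<ge> 3 + 4 * s / norm c1" if "x \<in> X" for x
        using norm_triangle_ineq2[of z x] abs_Im_le_cmod[of z] zw(1) R(2)[OF that] by (simp add: T0_def)
      have nzc: "norm c1 > 0" using False by simp
      have far3: "norm (z - x) \<ge> 3" if "x \<in> X" for x
      proof -
        have "4 * s / norm c1 \<ge> 0" using s0 by simp
        thus ?thesis using far[OF that] by linarith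
      qed
      have t: "norm (t x) < 1 / 2" "s * norm (t x) \<le> norm c1 / 4 * norm (w - z)" if x: "x \<in> X" for x
      proof -
        have nt: "norm (t x) = norm (w - z) / norm (z - x)" by (simp add: t_def norm_divide)
        also have "\<dots> \<le> 1 / 3" using zwd d far3[OF x] by (intro frac_le) auto
        finally show "norm (t x) < 1 / 2" by simp
        have "4 * s / norm c1 \<le> norm (z - x)" using far[OF x] by linarith
        hence "4 * s \<le> norm c1 * norm (z - x)" using nzc by (simp add: pos_divide_le_eq mult.commute)
        hence "s / norm (z - x) \<le> norm c1 / 4"
          using less_le_trans[OF _ far3[OF x], of 0] by (simp add: pos_divide_le_eq mult.commute)
        from mult_right_mono[OF this, of "norm (w - z)"]
        show "s * norm (t x) \<le> norm c1 / 4 * norm (w - z)" by (simp add: nt)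
      qed
      have nz: "z - x \<noteq> 0" if "x \<in> X" for x using far3[OF that] by auto
      have nt1: "1 + t x \<noteq> 0" if "x \<in> X" for x
        using t(1)[OF that] by (metis add_eq_0_iff norm_minus_cancel norm_one not_less one_le_numeral half_bounded_equal less_irrefl less_divide_eq_1_pos order.strict_trans zero_less_numeral one_less_numeral_iff semiring_norm(76))
      define E where "E = c1 * (w - z) + (\<Sum>x\<in>X. of_int (k x) * Ln (1 + t x))"
      have "exp E * h z = h w"
      proof -
        have "(w - x) powi k x = exp (of_int (k x) * Ln (1 + t x)) * (z - x) powi k x" if x: "x \<in> X" for x
        proof -
          have "exp (of_int (k x) * Ln (1 + t x)) = (1 + t x) powi k x"
            using nt1[OF x] by (simp add: exp_power_int[symmetric] mult.commute)
          also have "\<dots> * (z - x) powi k x = ((1 + t x) * (z - x)) powi k x" by (simp add: power_int_mult_distrib)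
          also have "(1 + t x) * (z - x) = w - x" using nz[OF x] by (simp add: t_def field_simps)
          finally show ?thesis by simp
        qed
        hence "(\<Prod>x\<in>X. (w - x) powi k x) = exp (\<Sum>x\<in>X. of_int (k x) * Ln (1 + t x)) * (\<Prod>x\<in>X. (z - x) powi k x)"
          by (simp add: exp_sum[OF X] prod.distrib)
        moreover have "exp (c0 + c1 * w) = exp (c1 * (w - z)) * exp (c0 + c1 * z)"
          by (simp add: exp_add[symmetric] algebra_simps)
        ultimately show ?thesis by (simp add: h_def E_def exp_add mult_ac)
      qed
      hence "exp E = 1" using zw v by simp
      then obtain j :: int where "Re E = 0" "Im E = of_int (2 * j) * pi"
        unfolding exp_eq_1 by blast
      hence j: "E = of_real (2 * of_int j * pi) * \<i>" by (simp add: complex_eq_iff)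
      have S: "norm (E - c1 * (w - z)) \<le> norm c1 / 2 * norm (w - z)"
      proof -
        have "norm (\<Sum>x\<in>X. of_int (k x) * Ln (1 + t x)) \<le> (\<Sum>x\<in>X. \<bar>real_of_int (k x)\<bar> * (2 * norm (t x)))"
          by (intro order_trans[OF norm_sum sum_mono])
             (auto simp: norm_mult intro!: mult_left_mono norm_Ln_le t(1))
        also have "\<dots> \<le> norm c1 / 2 * norm (w - z)"
        proof (cases "s = 0")
          case True
          hence "\<forall>x\<in>X. \<bar>real_of_int (k x)\<bar> = 0" using X unfolding s_def by (subst (asm) sum_nonneg_eq_0_iff) auto
          thus ?thesis by simp
        next
          case False
          have "(\<Sum>x\<in>X. \<bar>real_of_int (k x)\<bar> * (2 * norm (t x))) \<le> (\<Sum>x\<in>X. \<bar>real_of_int (k x)\<bar> * (norm c1 / 2 * norm (w - z) / s))"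
            using t(2) s0 False by (intro sum_mono mult_left_mono) (auto simp: field_simps)
          also have "\<dots> = norm c1 / 2 * norm (w - z)"
            unfolding sum_distrib_right[symmetric] s_def[symmetric] using False by simp
          finally show ?thesis .
        qed
        finally show ?thesis by (simp add: E_def)
      qed
      have nwz: "norm (w - z) > 0" using zw by simp
      have "norm c1 * norm (w - z) \<le> norm E + norm c1 / 2 * norm (w - z)"
        using norm_triangle_sub[of "c1 * (w - z)" E] S by (simp add: norm_mult norm_minus_commute)
      moreover have "norm c1 * norm (w - z) > 0" using nzc nwz by simp
      ultimately have "norm E > 0" by linarith
      hence "j \<noteq> 0" using j by auto
      hence "\<bar>real_of_int j\<bar> \<ge> 1" by linarith
      hence "norm E \<ge> 2 * pi" using j pi_gt_zero by (simp add: norm_mult abs_mult)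
      moreover have "norm E \<le> norm c1 * norm (w - z) + norm c1 / 2 * norm (w - z)"
        using norm_triangle_sub[of E "c1 * (w - z)"] S by (simp add: norm_mult)
      moreover have "norm c1 * norm (w - z) \<le> norm c1 * d" using zwd by (intro mult_left_mono) auto
      ultimately show False using d(3) pi_gt3 by (simp add: mult.commute)
    qed
    define M where "M = card ({\<lfloor>2 * a / d\<rfloor>..\<lfloor>2 * b / d\<rfloor>} \<times> {0..\<lfloor>6 / d\<rfloor>})"
    show ?thesis
    proof (rule that[of T0 M])
      fix T assume T: "T \<ge> T0"
      show "finite {z. a \<le> Re z \<and> Re z \<le> b \<and> T \<le> Im z \<and> Im z \<le> T + 3 \<and> h z = v} \<and>
        card {z. a \<le> Re z \<and> Re z \<le> b \<and> T \<le> Im z \<and> Im z \<le> T + 3 \<and> h z = v} \<le> M"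
        unfolding M_def by (rule card_separated_box[OF d(1)]) (use T sep in auto)
    qed
  qed
qed

text \<open>
  \<open>Z\<close> contains the points where \<open>L\<close> takes the values 0 and 1. A box of height 3 contains at most \<open>M\<close> of them, so its
  middle third contains a horizontal line at a distance from \<open>Z\<close> that depends on \<open>M\<close> only. A number of Schottky
  steps that does not depend on \<open>T\<close> leads from the right end of this line to the left end.
\<close>
lemma omitted_values_crossing_bound:
  fixes L :: "complex \<Rightarrow> complex" and Z :: "complex set"
  assumes ab: "a < b"
    and L: "L holomorphic_on {z. Im z > T0}"
    and fin: "\<And>T. T \<ge> T0 \<Longrightarrow> finite {z\<in>Z. a - 1 \<le> Re z \<and> Re z \<le> b + 1 \<and> T \<le> Im z \<and> Im z \<le> T + 3}"
    and card: "\<And>T. T \<ge> T0 \<Longrightarrow> card {z\<in>Z. a - 1 \<le> Re z \<and> Re z \<le> b + 1 \<and> T \<le> Im z \<and> Im z \<le> T + 3} \<le> M"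
    and om: "\<And>z. Im z > T0 \<Longrightarrow> z \<notin> Z \<Longrightarrow> L z \<noteq> 0 \<and> L z \<noteq> 1"
    and right: "\<And>t. t > T0 \<Longrightarrow> \<bar>ln (norm (L (Complex b t)))\<bar> \<le> K"
  obtains K' where "\<And>T. T \<ge> T0 \<Longrightarrow> \<exists>t\<in>{T+1..T+2}. \<bar>ln (norm (L (Complex a t)))\<bar> \<le> K'"
proof -
  obtain C where SC: "schottky_const C" using schottky_const_exists by blast
  note C1 = schottky_constD(1)[OF SC]
  define \<delta> where "\<delta> = 1 / (2 * (real M + 1))"
  have \<delta>: "\<delta> > 0" "\<delta> < 1" by (auto simp: \<delta>_def divide_simps)
  define J where "J = nat \<lceil>2 * (b - a) / \<delta>\<rceil>"
  have J: "real J \<ge> 2 * (b - a) / \<delta>" unfolding J_def by linarith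
  have J0: "J > 0" using ab \<delta> by (simp add: J_def)
  show ?thesis
  proof (rule that[of "C ^ J * (1 + K)"])
    fix T assume T: "T \<ge> T0"
    define B where "B = {z\<in>Z. a - 1 \<le> Re z \<and> Re z \<le> b + 1 \<and> T \<le> Im z \<and> Im z \<le> T + 3}"
    have B: "finite B" "card B \<le> M" using fin[OF T] card[OF T] by (auto simp: B_def)
    have "finite (Im ` B)" using B by simp
    then obtain t where t: "T + 1 \<le> t" "t \<le> T + 1 + 1" "\<And>s. s \<in> Im ` B \<Longrightarrow> \<bar>s - t\<bar> \<ge> 1 / (2 * (real (card (Im ` B)) + 1))"
      using clear_level[of "Im ` B" "T + 1"] by metis
    have "card (Im ` B) \<le> M" using B card_image_le[of B Im] by linarith
    hence "1 / (2 * (real (card (Im ` B)) + 1)) \<ge> \<delta>" unfolding \<delta>_def by (intro divide_left_mono) auto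
    hence clear: "\<bar>Im z - t\<bar> \<ge> \<delta>" if "z \<in> B" for z using t(3)[of "Im z"] that by force
    define q where "q = (b - a) / J"
    define p where "p = (\<lambda>j::nat. Complex (b - real j * q) t)"
    have good: "Im z > T0 \<and> z \<notin> Z" if "z \<in> ball (p j) \<delta>" "j \<le> J" for z j
    proof -
      have d: "norm (z - p j) < \<delta>" using that by (simp add: dist_norm norm_minus_commute)
      have i: "\<bar>Im z - t\<bar> < \<delta>" "\<bar>Re z - Re (p j)\<bar> < \<delta>"
        using abs_Im_le_cmod[of "z - p j"] abs_Re_le_cmod[of "z - p j"] d by (auto simp: p_def)
      have "real j * q \<le> real J * q" using that ab by (intro mult_right_mono) (auto simp: q_def)
      moreover have "0 \<le> real j * q" using ab by (simp add: q_def)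
      moreover have "real J * q = b - a" using J0 by (simp add: q_def)
      ultimately have "a \<le> Re (p j)" "Re (p j) \<le> b" by (auto simp: p_def)
      hence "z \<notin> Z" using clear[of z] i t(1,2) \<delta> unfolding B_def by force
      thus ?thesis using i t T \<delta> by linarith
    qed
    have step: "dist (p j) (p (Suc j)) \<le> \<delta> / 2" for j
    proof -
      have "p j - p (Suc j) = of_real q" by (simp add: p_def complex_eq_iff algebra_simps)
      hence "dist (p j) (p (Suc j)) = \<bar>q\<bar>" by (simp add: dist_norm)
      also have "\<dots> = (b - a) / J" using ab by (simp add: q_def)
      also have "\<dots> \<le> \<delta> / 2" using J J0 \<delta> by (simp add: field_simps)
      finally show ?thesis .
    qed
    have "1 + \<bar>ln (norm (L (p j)))\<bar> \<le> C ^ j * (1 + \<bar>ln (norm (L (p 0)))\<bar>)" if "j \<le> J" for j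
      using that
    proof (induction j)
      case (Suc j)
      have "1 + \<bar>ln (norm (L (p (Suc j))))\<bar> \<le> C * (1 + \<bar>ln (norm (L (p j)))\<bar>)"
      proof (rule schottky_constD(2)[OF SC, where F = L and \<delta> = \<delta> and x = "p j" and y = "p (Suc j)"])
        show "L holomorphic_on ball (p j) \<delta>"
          by (rule holomorphic_on_subset[OF L]) (use good[of _ j] Suc.prems in auto)
        show "L z \<noteq> 0 \<and> L z \<noteq> 1" if "z \<in> ball (p j) \<delta>" for z using om good[OF that] Suc.prems by simp
      qed (use step \<delta> in auto)
      also have "\<dots> \<le> C * (C ^ j * (1 + \<bar>ln (norm (L (p 0)))\<bar>))" using C1 Suc by (intro mult_left_mono) auto
      finally show ?case by (simp add: mult_ac)
    qed simp
    from this[of J] have "1 + \<bar>ln (norm (L (Complex a t)))\<bar> \<le> C ^ J * (1 + \<bar>ln (norm (L (Complex b t)))\<bar>)"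
      using J0 by (simp add: p_def q_def)
    also have "\<dots> \<le> C ^ J * (1 + K)" using right[of t] t T C1 by (intro mult_left_mono) auto
    finally have "\<bar>ln (norm (L (Complex a t)))\<bar> \<le> C ^ J * (1 + K)" by linarith
    thus "\<exists>t\<in>{T+1..T+2}. \<bar>ln (norm (L (Complex a t)))\<bar> \<le> C ^ J * (1 + K)" using t by auto
  qed
qed

section \<open>Growth on the left from the functional equation\<close>

text \<open>
  In Gauss's product for \<open>Gamma\<close> the ratio \<open>|W + i| / (Re W + i)\<close> decreases when \<open>W\<close> moves to the right, whence
  \<open>|Gamma W| / Gamma (Re W)\<close> increases; and \<open>Gamma\<close> itself increases on the real axis from \<open>3/2\<close> on.
\<close>
lemma norm_Gamma_shift_ge:
  fixes W :: complex and f :: real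
  assumes W: "Re W \<ge> 3/2" and f: "f \<ge> 0"
  shows "norm (Gamma W) \<le> norm (Gamma (W + of_real f))"
proof -
  define x where "x = Re W"
  have poch: "norm (pochhammer (W + of_real f) m) * pochhammer x m \<le> norm (pochhammer W m) * pochhammer (x + f) m" for m
  proof -
    have "norm (W + of_real f + of_nat i) * (x + of_nat i) \<le> norm (W + of_nat i) * (x + f + of_nat i)" for i
    proof (rule power2_le_imp_le)
      define X y where "X = x + real i" and "y = Im W"
      have X: "X \<ge> 0" using W by (simp add: X_def x_def)
      have "X\<^sup>2 \<le> (X + f)\<^sup>2" using X f by (intro power_mono) auto
      hence "y\<^sup>2 * X\<^sup>2 \<le> y\<^sup>2 * (X + f)\<^sup>2" by (intro mult_left_mono) auto
      hence "((X + f)\<^sup>2 + y\<^sup>2) * X\<^sup>2 \<le> (X\<^sup>2 + y\<^sup>2) * (X + f)\<^sup>2" by (simp add: algebra_simps)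
      moreover have "(norm (W + of_real f + of_nat i))\<^sup>2 = (X + f)\<^sup>2 + y\<^sup>2"
        unfolding cmod_power2 X_def y_def x_def by (simp add: algebra_simps)
      moreover have "(norm (W + of_nat i))\<^sup>2 = X\<^sup>2 + y\<^sup>2"
        unfolding cmod_power2 X_def y_def x_def by simp
      moreover have "x + of_nat i = X" "x + f + of_nat i = X + f" by (simp_all add: X_def)
      ultimately show "(norm (W + of_real f + of_nat i) * (x + of_nat i))\<^sup>2 \<le> (norm (W + of_nat i) * (x + f + of_nat i))\<^sup>2"
        unfolding power_mult_distrib by (simp only:)
    qed (use W f in \<open>simp add: x_def\<close>)
    hence "(\<Prod>i=0..<m. norm (W + of_real f + of_nat i) * (x + of_nat i)) \<le> (\<Prod>i=0..<m. norm (W + of_nat i) * (x + f + of_nat i))"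
      using W by (intro prod_mono) (auto simp: x_def)
    thus ?thesis by (simp add: pochhammer_prod prod.distrib prod_norm)
  qed
  have ser: "norm (Gamma_series W n) * Gamma_series (x + f) n \<le> norm (Gamma_series (W + of_real f) n) * Gamma_series x n" for n
  proof -
    have p: "pochhammer x (n + 1) > 0" "pochhammer (x + f) (n + 1) > 0" using W f by (auto intro!: pochhammer_pos simp: x_def)
    have nz: "pochhammer W (n + 1) \<noteq> 0" "pochhammer (W + of_real f) (n + 1) \<noteq> 0"
      unfolding pochhammer_eq_0_iff using W f by (auto dest!: arg_cong[of _ _ Re])
    define e where "e = exp (x * ln (real n))"
    define e' where "e' = exp ((x + f) * ln (real n))"
    have eq: "norm (Gamma_series W n) = fact n * e / norm (pochhammer W (n + 1))"
      "norm (Gamma_series (W + of_real f) n) = fact n * e' / norm (pochhammer (W + of_real f) (n + 1))"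
      "Gamma_series x n = fact n * e / pochhammer x (n + 1)"
      "Gamma_series (x + f) n = fact n * e' / pochhammer (x + f) (n + 1)"
      by (simp_all add: Gamma_series_def norm_divide norm_mult e_def e'_def x_def)
    have "1 / (norm (pochhammer W (n + 1)) * pochhammer (x + f) (n + 1)) \<le> 1 / (norm (pochhammer (W + of_real f) (n + 1)) * pochhammer x (n + 1))"
      using poch[of "n + 1"] p nz by (intro divide_left_mono mult_pos_pos) auto
    from mult_left_mono[OF this, of "(fact n * e) * (fact n * e')"]
    show ?thesis unfolding eq by (simp add: e_def e'_def mult_ac)
  qed
  have "norm (Gamma W) * Gamma (x + f) \<le> norm (Gamma (W + of_real f)) * Gamma x"
    by (rule LIMSEQ_le[OF tendsto_mult[OF tendsto_norm[OF Gamma_series_LIMSEQ] Gamma_series_LIMSEQ]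
          tendsto_mult[OF tendsto_norm[OF Gamma_series_LIMSEQ] Gamma_series_LIMSEQ]]) (use ser in auto)
  also have "\<dots> \<le> norm (Gamma (W + of_real f)) * Gamma (x + f)"
    using Gamma_real_strict_mono[of x "x + f"] W f by (cases "f = 0") (auto simp: x_def intro!: mult_left_mono)
  finally show ?thesis using W f Gamma_real_pos[of "x + f"] by (simp add: x_def mult_le_cancel_right)
qed

text \<open>
  Each of the integer steps multiplies \<open>Gamma\<close> by a factor of norm at least \<open>|Im w|\<close>; the fractional rest of the shift takes
  place where the norm of \<open>Gamma\<close> increases to the right.
\<close>
lemma norm_Gamma_shift_imag:
  fixes w :: complex and c Y :: real
  assumes Y: "Y \<ge> 1" "\<bar>Im w\<bar> \<ge> Y" and c: "c \<ge> 0" "Re w + c \<ge> 3"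
  shows "norm (Gamma (w + of_real c)) \<ge> Y ^ nat \<lfloor>c\<rfloor> * norm (Gamma w)"
proof -
  define m where "m = nat \<lfloor>c\<rfloor>"
  have m: "real m \<le> c" "c < real m + 1" using c unfolding m_def by linarith+
  have nz: "w \<notin> \<int>\<^sub>\<le>\<^sub>0" using Y by (auto elim!: nonpos_Ints_cases)
  have "Y ^ m = (\<Prod>i=0..<m. Y)" by simp
  also have "\<dots> \<le> (\<Prod>i=0..<m. norm (w + of_nat i))"
  proof (intro prod_mono conjI)
    show "Y \<le> norm (w + of_nat i)" for i using abs_Im_le_cmod[of "w + of_nat i"] Y by simp
  qed (use Y in auto)
  also have "\<dots> = norm (pochhammer w m)" by (simp add: pochhammer_prod prod_norm)
  finally have "Y ^ m * norm (Gamma w) \<le> norm (pochhammer w m) * norm (Gamma w)" by (intro mult_right_mono) auto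
  also have "\<dots> = norm (Gamma (w + of_nat m))"
    using pochhammer_Gamma[OF nz, of m] nz by (simp add: norm_divide Gamma_eq_zero_iff)
  also have "\<dots> \<le> norm (Gamma (w + of_nat m + of_real (c - m)))"
    by (rule norm_Gamma_shift_ge) (use m c in auto)
  finally show ?thesis by (simp add: m_def algebra_simps)
qed

text \<open>
  With \<open>x = - Re s\<close> the functional equation reads
  \<open>|L s| = |L (1 - cnj s)| Q powr (1 + 2 x) \<Prod>j. |Gamma (w j + c j)| / |Gamma (w j)|\<close>, where \<open>w j = \<mu> j * s + \<nu> j\<close> and
  \<open>c j = \<mu> j (1 + 2 x)\<close>. The first factor is at least \<open>1/2\<close>, and each quotient of Gamma values is at least
  \<open>Y ^ \<lfloor>c j\<rfloor>\<close> once \<open>|Im s|\<close> is large. Here \<open>K \<ge> 1\<close> enters: for \<open>Y\<close> large the single factor \<open>j = 1\<close>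
  outweighs the power of \<open>Q\<close>.
\<close>
lemma functional_equation_growth:
  fixes L :: "complex \<Rightarrow> complex"
  assumes an: "\<And>s. s \<noteq> 1 \<Longrightarrow> L analytic_on {s}"
    and Q: "Q > 0" and K: "K \<ge> 1" and \<mu>: "\<forall>j\<in>{1..K}. \<mu> j > 0 \<and> Re (\<nu> j) \<ge> 0" and \<omega>: "norm \<omega> = 1"
    and fe: "\<forall>s. completed_L L Q K \<mu> \<nu> s = \<omega> * cnj (completed_L L Q K \<mu> \<nu> (1 - cnj s))"
    and half: "\<And>s. Re s \<ge> \<sigma>1 \<Longrightarrow> norm (L s) \<ge> 1 / 2"
  obtains A where "A \<ge> 0" "\<And>M. \<exists>B. \<forall>s. Re s \<le> - A \<longrightarrow> \<bar>Im s\<bar> \<ge> B \<longrightarrow> norm (L s) \<ge> M"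
proof -
  define raw where "raw = (\<lambda>s. L s * of_real Q powr s * (\<Prod>j=1..K. Gamma (of_real (\<mu> j) * s + \<nu> j)))"
  have comp: "completed_L L Q K \<mu> \<nu> s = raw s"
    if "s \<noteq> 1" "\<And>j. j \<in> {1..K} \<Longrightarrow> of_real (\<mu> j) * s + \<nu> j \<notin> \<int>\<^sub>\<le>\<^sub>0" for s
    unfolding completed_L_def raw_def
  proof (rule remove_sings_at_analytic)
    show "(\<lambda>s. L s * of_real Q powr s * (\<Prod>j=1..K. Gamma (of_real (\<mu> j) * s + \<nu> j))) analytic_on {s}"
      by (intro analytic_intros an) (use that Q in auto)
  qed
  \<comment> \<open>\<open>3 / \<mu> j\<close> puts \<open>w j + c j\<close> to the right of 3, and \<open>1 / \<mu> 1\<close> makes \<open>c 1 \<ge> 2\<close>, so that \<open>\<lfloor>c 1\<rfloor> \<ge> c 1 / 2\<close>\<close>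
  define A where "A = \<bar>\<sigma>1\<bar> + (\<Sum>j=1..K. 3 / \<mu> j) + 1 / \<mu> 1 + 1"
  have \<mu>pos: "\<mu> j > 0" if "j \<in> {1..K}" for j using \<mu> that by auto
  have A3: "\<mu> j * A \<ge> 3" if "j \<in> {1..K}" for j
  proof -
    have "3 / \<mu> j \<le> (\<Sum>j=1..K. 3 / \<mu> j)" using that \<mu>pos by (intro member_le_sum) (auto simp: less_imp_le)
    also have "\<dots> \<le> A" using \<mu>pos[of 1] K by (simp add: A_def)
    finally show ?thesis using \<mu>pos[OF that] by (simp add: field_simps)
  qed
  have sum0: "(\<Sum>j=1..K. 3 / \<mu> j) \<ge> 0" using \<mu>pos by (intro sum_nonneg) (auto simp: less_imp_le)
  have A1: "A \<ge> 1" "A \<ge> 0" "A \<ge> \<sigma>1" "\<mu> 1 * (1 + 2 * A) \<ge> 2"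
  proof -
    have "1 / \<mu> 1 > 0" using \<mu>pos[of 1] K by simp
    thus "A \<ge> 1" "A \<ge> 0" "A \<ge> \<sigma>1" using sum0 abs_ge_self[of \<sigma>1] unfolding A_def by linarith+
    have "A \<ge> 1 / \<mu> 1" using sum0 by (simp add: A_def)
    hence "\<mu> 1 * A \<ge> 1" using \<mu>pos[of 1] K by (simp add: field_simps)
    thus "\<mu> 1 * (1 + 2 * A) \<ge> 2" using \<mu>pos[of 1] K by (simp add: algebra_simps)
  qed
  have "\<exists>B. \<forall>s. Re s \<le> - A \<longrightarrow> \<bar>Im s\<bar> \<ge> B \<longrightarrow> norm (L s) \<ge> M" for M
  proof -
    define N where "N = 2 * \<bar>M\<bar> + 1"
    define Y where "Y = max 1 ((N / Q) powr (2 / \<mu> 1))"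
    have Y1: "Y \<ge> 1" by (simp add: Y_def)
    have NQ: "Q * Y powr (\<mu> 1 / 2) \<ge> N"
    proof -
      have "N / Q = ((N / Q) powr (2 / \<mu> 1)) powr (\<mu> 1 / 2)"
        using Q \<mu>pos[of 1] K by (simp add: powr_powr N_def)
      also have "\<dots> \<le> Y powr (\<mu> 1 / 2)" using \<mu>pos[of 1] K by (intro powr_mono2) (auto simp: Y_def)
      finally show ?thesis using Q by (simp add: field_simps)
    qed
    define B where "B = (\<Sum>j=1..K. (Y + \<bar>Im (\<nu> j)\<bar>) / \<mu> j) + 1"
    show ?thesis
    proof (intro exI[of _ B] allI impI)
      fix s assume s: "Re s \<le> - A" "\<bar>Im s\<bar> \<ge> B"
      define x where "x = - Re s"
      have x: "x \<ge> A" "x \<ge> 0" using s A1 by (auto simp: x_def)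
      define w where "w = (\<lambda>j. of_real (\<mu> j) * s + \<nu> j)"
      define c where "c = (\<lambda>j. \<mu> j * (1 + 2 * x))"
      have Imw: "\<bar>Im (w j)\<bar> \<ge> Y" if j: "j \<in> {1..K}" for j
      proof -
        have "(Y + \<bar>Im (\<nu> j)\<bar>) / \<mu> j \<le> (\<Sum>j=1..K. (Y + \<bar>Im (\<nu> j)\<bar>) / \<mu> j)"
          using j \<mu>pos Y1 by (intro member_le_sum) (auto simp: less_imp_le)
        hence "(Y + \<bar>Im (\<nu> j)\<bar>) / \<mu> j \<le> \<bar>Im s\<bar>" using s(2) by (simp add: B_def)
        hence "Y + \<bar>Im (\<nu> j)\<bar> \<le> \<mu> j * \<bar>Im s\<bar>" using \<mu>pos[OF j] by (simp add: field_simps)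
        moreover have "\<mu> j * \<bar>Im s\<bar> = \<bar>\<mu> j * Im s\<bar>" using \<mu>pos[OF j] by (simp add: abs_mult)
        moreover have "Im (w j) = \<mu> j * Im s + Im (\<nu> j)" by (simp add: w_def)
        ultimately show ?thesis by linarith
      qed
      define s' where "s' = 1 - cnj s"
      have ws': "of_real (\<mu> j) * s' + \<nu> j = w j + of_real (c j)" for j
        by (simp add: w_def c_def s'_def x_def complex_eq_iff algebra_simps)
      have Rewc: "Re (w j + of_real (c j)) \<ge> 3" if j: "j \<in> {1..K}" for j
      proof -
        have "Re (w j + of_real (c j)) = \<mu> j * (1 + x) + Re (\<nu> j)"
          by (simp add: w_def c_def x_def algebra_simps)
        also have "\<dots> \<ge> \<mu> j * A"
        proof -
          have "\<mu> j * A \<le> \<mu> j * (1 + x)" using x \<mu>pos[OF j] by (intro mult_left_mono) auto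
          moreover have "Re (\<nu> j) \<ge> 0" using \<mu> j by blast
          ultimately show ?thesis by linarith
        qed
        finally show ?thesis using A3[OF j] by linarith
      qed
      have nz1: "w j \<notin> \<int>\<^sub>\<le>\<^sub>0" if "j \<in> {1..K}" for j using Imw[OF that] Y1 by (auto elim!: nonpos_Ints_cases)
      have nz2: "w j + of_real (c j) \<notin> \<int>\<^sub>\<le>\<^sub>0" if "j \<in> {1..K}" for j
      proof
        assume "w j + of_real (c j) \<in> \<int>\<^sub>\<le>\<^sub>0"
        then obtain i where "w j + of_real (c j) = of_int i" "i \<le> 0" by (rule nonpos_Ints_cases)
        thus False using Rewc[OF that] by simp
      qed
      have s1: "s \<noteq> 1" using s A1 by auto
      have Re_s': "Re s' = 1 + x" by (simp add: s'_def x_def)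
      have "Re s' > 1" using Re_s' x A1 by linarith
      hence s'1: "s' \<noteq> 1" by auto
      have "raw s = \<omega> * cnj (raw s')"
      proof -
        have "completed_L L Q K \<mu> \<nu> s = raw s" by (rule comp[OF s1]) (use nz1 in \<open>simp add: w_def\<close>)
        moreover have "completed_L L Q K \<mu> \<nu> s' = raw s'"
          by (rule comp[OF s'1]) (unfold ws', rule nz2)
        ultimately show ?thesis using fe[rule_format, of s] by (simp add: s'_def)
      qed
      hence "norm (raw s) = norm (raw s')" using \<omega> by (simp add: norm_mult)
      hence eq: "norm (L s) * Q powr (-x) * (\<Prod>j=1..K. norm (Gamma (w j))) =
        norm (L s') * Q powr (1 + x) * (\<Prod>j=1..K. norm (Gamma (w j + of_real (c j))))"
    proof -
        have "raw s = L s * of_real Q powr s * (\<Prod>j=1..K. Gamma (w j))" by (simp add: raw_def w_def)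
        moreover have "raw s' = L s' * of_real Q powr s' * (\<Prod>j=1..K. Gamma (w j + of_real (c j)))"
          by (simp add: raw_def ws')
        moreover have "norm (of_real Q powr s) = Q powr (-x)" "norm (of_real Q powr s') = Q powr (1 + x)"
          using Q Re_s' by (simp_all add: norm_powr_real_powr x_def)
        ultimately show ?thesis using \<open>norm (raw s) = norm (raw s')\<close> by (simp add: norm_mult prod_norm)
      qed
      define G where "G = (\<Prod>j=1..K. norm (Gamma (w j)))"
      have G0: "G > 0" unfolding G_def using nz1 by (intro prod_pos) (auto simp: Gamma_eq_zero_iff)
      have c0: "c j \<ge> 0" if "j \<in> {1..K}" for j using \<mu>pos[OF that] x by (simp add: c_def)
      have "Y ^ nat \<lfloor>c 1\<rfloor> * G \<le> (\<Prod>j=1..K. Y ^ nat \<lfloor>c j\<rfloor> * norm (Gamma (w j)))"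
      proof -
        have "Y ^ nat \<lfloor>c 1\<rfloor> * 1 \<le> Y ^ nat \<lfloor>c 1\<rfloor> * (\<Prod>j\<in>{1..K} - {1}. Y ^ nat \<lfloor>c j\<rfloor>)"
          using Y1 by (intro mult_left_mono prod_ge_1) auto
        also have "\<dots> = (\<Prod>j=1..K. Y ^ nat \<lfloor>c j\<rfloor>)" using K by (subst prod.remove[of _ 1]) auto
        finally show ?thesis using G0 by (simp add: prod.distrib G_def mult_right_mono)
      qed
      also have "\<dots> \<le> (\<Prod>j=1..K. norm (Gamma (w j + of_real (c j))))"
        using norm_Gamma_shift_imag[OF Y1 Imw c0] Rewc Y1 by (intro prod_mono) auto
      finally have ge: "Y ^ nat \<lfloor>c 1\<rfloor> * G \<le> (\<Prod>j=1..K. norm (Gamma (w j + of_real (c j))))" .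
      have c2: "c 1 \<ge> 2"
      proof -
        have "\<mu> 1 * (1 + 2 * A) \<le> c 1" unfolding c_def using x \<mu>pos[of 1] K by (intro mult_left_mono) auto
        thus ?thesis using A1 by linarith
      qed
      have "Y powr (c 1 / 2) \<le> Y powr (real (nat \<lfloor>c 1\<rfloor>))" using c2 Y1 by (intro powr_mono) linarith+
      also have "\<dots> = Y ^ nat \<lfloor>c 1\<rfloor>" using Y1 by (simp add: powr_realpow)
      finally have Yc: "Y powr (c 1 / 2) \<le> Y ^ nat \<lfloor>c 1\<rfloor>" .
      have "norm (L s') \<ge> 1 / 2" using half[of s'] Re_s' x A1 by simp
      hence "1 / 2 * Q powr (1 + x) * (Y powr (c 1 / 2) * G) \<le>
          norm (L s') * Q powr (1 + x) * (\<Prod>j=1..K. norm (Gamma (w j + of_real (c j))))"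
        using ge Yc G0 Y1 by (intro mult_mono order_trans[OF _ ge] mult_right_mono) auto
      also have "\<dots> = norm (L s) * Q powr (-x) * G" using eq by (simp add: G_def)
      finally have "1 / 2 * Q powr (1 + x) * Y powr (c 1 / 2) \<le> norm (L s) * Q powr (-x)" using G0 by (simp add: mult.assoc[symmetric])
      hence "1 / 2 * Q powr (1 + x) * Y powr (c 1 / 2) * Q powr x \<le> norm (L s) * Q powr (-x) * Q powr x"
        by (rule mult_right_mono) simp
      also have "\<dots> = norm (L s)" using Q by (simp add: mult.assoc flip: powr_add)
      also have "1 / 2 * Q powr (1 + x) * Y powr (c 1 / 2) * Q powr x = 1 / 2 * (Q powr (1 + 2 * x) * Y powr (c 1 / 2))"
      proof -
        have "Q powr (1 + 2 * x) = Q powr (1 + x) * Q powr x"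
          using powr_add[of Q "1 + x" x] by (simp add: add.assoc)
        thus ?thesis by (simp only: mult_ac)
      qed
      also have "Q powr (1 + 2 * x) * Y powr (c 1 / 2) = (Q * Y powr (\<mu> 1 / 2)) powr (1 + 2 * x)"
        using Q Y1 by (simp add: powr_mult powr_powr c_def)
      finally have "1 / 2 * (Q * Y powr (\<mu> 1 / 2)) powr (1 + 2 * x) \<le> norm (L s)" .
      moreover have "N \<le> (Q * Y powr (\<mu> 1 / 2)) powr (1 + 2 * x)"
      proof -
        have "N powr 1 \<le> N powr (1 + 2 * x)" using x by (intro powr_mono) (auto simp: N_def)
        also have "\<dots> \<le> (Q * Y powr (\<mu> 1 / 2)) powr (1 + 2 * x)" using NQ x by (intro powr_mono2) (auto simp: N_def)
        finally show ?thesis by (simp add: N_def)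
      qed
      ultimately show "norm (L s) \<ge> M" by (simp add: N_def)
    qed
  qed
  thus ?thesis using that A1 by blast
qed

section \<open>Dirichlet series far to the right\<close>

lemma dirichlet_tail:
  fixes a :: "nat \<Rightarrow> complex"
  assumes c: "\<And>j. j \<ge> 1 \<Longrightarrow> norm (a j) \<le> c * real j"
  obtains D where "D \<ge> 0"
    "\<And>s l N. Re s \<ge> 3 \<Longrightarrow> (\<lambda>j. a (Suc j) * of_nat (Suc j) powr (- s)) sums l \<Longrightarrow>
       norm (l - (\<Sum>j<N. a (Suc j) * of_nat (Suc j) powr (- s))) \<le> D * real (Suc N) powr (3 - Re s)"
proof -
  define S where "S = (\<Sum>j. 1 / real (Suc j) ^ 2)"
  have sm: "summable (\<lambda>j. 1 / real (Suc j) ^ 2)"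
    using inverse_power_summable[of 2, where ?'a = real] by (subst summable_Suc_iff) (simp add: inverse_eq_divide)
  have c0: "c \<ge> 0" using order_trans[OF norm_ge_zero c[of 1]] by simp
  show ?thesis
  proof (rule that[of "c * S"])
    show "c * S \<ge> 0" unfolding S_def using c0 sm by (intro mult_nonneg_nonneg suminf_nonneg) auto
    fix s l and N :: nat
    assume s: "Re s \<ge> 3" and l: "(\<lambda>j. a (Suc j) * of_nat (Suc j) powr (- s)) sums l"
    define g where "g = (\<lambda>j. a (Suc j) * of_nat (Suc j) powr (- s))"
    define h where "h = (\<lambda>j. c * real (Suc N) powr (3 - Re s) * (1 / real (Suc j) ^ 2))"
    have hs: "h sums (c * real (Suc N) powr (3 - Re s) * S)" unfolding h_def S_def
      by (intro sums_mult summable_sums sm)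
    have le: "norm (g (j + N)) \<le> h (j + N)" for j
    proof -
      define n where "n = real (Suc (j + N))"
      have n: "n \<ge> real (Suc N)" "n > 0" by (auto simp: n_def)
      have "norm (g (j + N)) = norm (a (Suc (j + N))) * n powr (- Re s)"
        unfolding g_def norm_mult n_def by (subst norm_powr_real_powr) auto
      also have "\<dots> \<le> (c * n) * n powr (- Re s)" using c[of "Suc (j + N)"] by (intro mult_right_mono) (auto simp: n_def)
      also have "\<dots> = c * (n powr (3 - Re s) * (1 / n ^ 2))"
      proof -
        have "n powr (3 - Re s) = n ^ 3 * n powr (- Re s)" using powr_add[of n 3 "- Re s"] n by simp
        thus ?thesis using n by (simp add: power2_eq_square power3_eq_cube)
      qed
      also have "\<dots> \<le> c * (real (Suc N) powr (3 - Re s) * (1 / n ^ 2))"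
        using n s c0 by (intro mult_left_mono mult_right_mono powr_mono2') auto
      finally show ?thesis by (simp add: h_def n_def)
    qed
    have "(\<lambda>j. g (j + N)) sums (l - (\<Sum>j<N. g j))" using l unfolding g_def by (rule sums_split_initial_segment)
    hence "l - (\<Sum>j<N. g j) = (\<Sum>j. g (j + N))" by (simp add: sums_iff)
    also have "norm \<dots> \<le> (\<Sum>j. h (j + N))"
      by (rule norm_suminf_le[OF le]) (use hs sums_summable summable_iff_shift in blast)
    also have "\<dots> = c * real (Suc N) powr (3 - Re s) * S - (\<Sum>j<N. h j)"
      using sums_split_initial_segment[OF hs, of N] by (simp add: sums_iff)
    also have "\<dots> \<le> c * real (Suc N) powr (3 - Re s) * S"
      using c0 by (simp add: h_def sum_nonneg)
    finally show "norm (l - (\<Sum>j<N. a (Suc j) * of_nat (Suc j) powr (- s))) \<le> c * S * real (Suc N) powr (3 - Re s)"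
      by (simp add: g_def mult_ac)
  qed
qed

lemma powr_tendsto_0:
  fixes t :: real
  assumes "0 < t" "t < 1"
  shows "((\<lambda>x. t powr x) \<longlongrightarrow> 0) at_top"
proof -
  have "((\<lambda>x. exp (x * ln t)) \<longlongrightarrow> 0) at_top"
    by (rule filterlim_compose[OF exp_at_bot])
       (use assms in \<open>auto intro!: filterlim_tendsto_neg_mult_at_bot[OF tendsto_const _ filterlim_ident] simp: mult.commute[of _ "ln t"]\<close>)
  thus ?thesis using assms by (simp add: powr_def)
qed
text \<open>
  Far to the right the tail from \<open>q + 1\<close> on is negligible against the term with index \<open>q\<close>.
\<close>
lemma powr_ratio_small:
  fixes q :: nat
  assumes q: "q \<ge> 1" and e: "e > 0" and D: "D \<ge> 0"
  shows "\<exists>\<sigma>0\<ge>3. \<forall>\<sigma>\<ge>\<sigma>0. D * real (Suc q) powr (3 - \<sigma>) \<le> e * real q powr (- \<sigma>)"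
proof -
  define r where "r = real q / real (Suc q)"
  have r: "0 < r" "r < 1" using q by (auto simp: r_def)
  have "((\<lambda>\<sigma>. r powr \<sigma>) \<longlongrightarrow> 0) at_top" using r by (rule powr_tendsto_0)
  hence "((\<lambda>\<sigma>. D * real (Suc q) ^ 3 * r powr \<sigma>) \<longlongrightarrow> D * real (Suc q) ^ 3 * 0) at_top"
    by (intro tendsto_mult tendsto_const)
  hence "eventually (\<lambda>\<sigma>. D * real (Suc q) ^ 3 * r powr \<sigma> < e) at_top"
    using e by (intro order_tendstoD) auto
  then obtain \<sigma>0 where \<sigma>0: "\<And>\<sigma>. \<sigma> \<ge> \<sigma>0 \<Longrightarrow> D * real (Suc q) ^ 3 * r powr \<sigma> < e"
    unfolding eventually_at_top_linorder by blast
  show ?thesis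
  proof (intro exI[of _ "max 3 \<sigma>0"] conjI allI impI)
    fix \<sigma> assume "\<sigma> \<ge> max 3 \<sigma>0"
    hence "D * real (Suc q) ^ 3 * r powr \<sigma> \<le> e" using \<sigma>0[of \<sigma>] by simp
    hence "D * real (Suc q) ^ 3 * r powr \<sigma> * real q powr (-\<sigma>) \<le> e * real q powr (-\<sigma>)" by (rule mult_right_mono) simp
    also have "D * real (Suc q) ^ 3 * r powr \<sigma> * real q powr (-\<sigma>) = D * real (Suc q) powr (3 - \<sigma>)"
    proof -
      define a b where "a = real q" and "b = real (Suc q)"
      have ab: "a > 0" "b > 0" using q by (auto simp: a_def b_def)
      have 1: "r powr \<sigma> = a powr \<sigma> / b powr \<sigma>"
        unfolding r_def a_def b_def by (rule powr_divide)
      have 2: "a powr \<sigma> * a powr (- \<sigma>) = 1" using ab powr_add[of a \<sigma> "- \<sigma>"] by simp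
      have 3: "b powr (3 - \<sigma>) = b ^ 3 / b powr \<sigma>" using powr_diff[of b 3 \<sigma>] ab by simp
      have "D * b ^ 3 * r powr \<sigma> * a powr (- \<sigma>) = D * b ^ 3 / b powr \<sigma> * (a powr \<sigma> * a powr (- \<sigma>))"
        unfolding 1 by simp
      thus ?thesis unfolding 2 using 3 by (simp add: a_def b_def)
    qed
    finally show "D * real (Suc q) powr (3 - \<sigma>) \<le> e * real q powr (- \<sigma>)" .
  qed simp
qed

lemma dirichlet_leading_term:
  fixes a :: "nat \<Rightarrow> complex"
  assumes c: "\<And>j. j \<ge> 1 \<Longrightarrow> norm (a j) \<le> c * real j" and nz: "\<exists>j\<ge>1. a j \<noteq> 0"
  obtains q \<sigma>0 where "q \<ge> 1" "a q \<noteq> 0" "\<And>j. 1 \<le> j \<Longrightarrow> j < q \<Longrightarrow> a j = 0"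
    "\<sigma>0 \<ge> 3" "\<And>s l. Re s \<ge> \<sigma>0 \<Longrightarrow> (\<lambda>j. a (Suc j) * of_nat (Suc j) powr (- s)) sums l \<Longrightarrow>
      norm (l - a q * of_nat q powr (- s)) \<le> norm (a q) / 2 * real q powr (- Re s)"
proof -
  define q where "q = (LEAST j. j \<ge> 1 \<and> a j \<noteq> 0)"
  have q: "q \<ge> 1 \<and> a q \<noteq> 0" unfolding q_def by (rule LeastI_ex) (use nz in blast)
  have less: "a j = 0" if "1 \<le> j" "j < q" for j using not_less_Least[OF that(2)[unfolded q_def]] that by auto
  obtain D where D: "D \<ge> 0" "\<And>s l N. Re s \<ge> 3 \<Longrightarrow> (\<lambda>j. a (Suc j) * of_nat (Suc j) powr (- s)) sums l \<Longrightarrow>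
       norm (l - (\<Sum>j<N. a (Suc j) * of_nat (Suc j) powr (- s))) \<le> D * real (Suc N) powr (3 - Re s)"
    using dirichlet_tail[OF c] by blast
  obtain \<sigma>0 where \<sigma>0: "\<sigma>0 \<ge> 3" "\<And>\<sigma>. \<sigma> \<ge> \<sigma>0 \<Longrightarrow> D * real (Suc q) powr (3 - \<sigma>) \<le> norm (a q) / 2 * real q powr (- \<sigma>)"
    using powr_ratio_small[of q "norm (a q) / 2" D] q D(1) by (metis zero_less_norm_iff half_gt_zero)
  show ?thesis
  proof (rule that[of q \<sigma>0])
    fix s l assume s: "Re s \<ge> \<sigma>0" and l: "(\<lambda>j. a (Suc j) * of_nat (Suc j) powr (- s)) sums l"
    have "(\<Sum>j<q. a (Suc j) * of_nat (Suc j) powr (- s)) = (\<Sum>j\<in>{q - 1}. a (Suc j) * of_nat (Suc j) powr (- s))"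
      by (rule sum.mono_neutral_right) (use q less in \<open>auto simp: not_less_eq_eq\<close>)
    hence "(\<Sum>j<q. a (Suc j) * of_nat (Suc j) powr (- s)) = a q * of_nat q powr (- s)" using q by simp
    thus "norm (l - a q * of_nat q powr (- s)) \<le> norm (a q) / 2 * real q powr (- Re s)"
      using D(2)[of s l q] l s \<sigma>0(1) \<sigma>0(2)[of "Re s"] by simp
  qed (use q less \<sigma>0 in auto)
qed

text \<open>
  The first non-vanishing term dominates, and the logarithm of its norm is a linear function of \<open>Re s\<close>.
\<close>
lemma dirichlet_series_ln_norm_bound:
  fixes a :: "nat \<Rightarrow> complex"
  assumes c: "\<And>j. j \<ge> 1 \<Longrightarrow> norm (a j) \<le> c * real j" and nz: "\<exists>j\<ge>1. a j \<noteq> 0"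
  obtains \<sigma>0 K where "\<sigma>0 \<ge> 3" "\<And>s l. Re s \<ge> \<sigma>0 \<Longrightarrow> (\<lambda>j. a (Suc j) * of_nat (Suc j) powr (- s)) sums l \<Longrightarrow>
      l \<noteq> 0 \<and> \<bar>ln (norm l)\<bar> \<le> K * Re s"
proof -
  show ?thesis
  proof (rule dirichlet_leading_term[OF c nz])
  fix q \<sigma>0
  assume q: "q \<ge> 1" "a q \<noteq> 0" and \<sigma>0: "\<sigma>0 \<ge> 3" "\<And>s l. Re s \<ge> \<sigma>0 \<Longrightarrow> (\<lambda>j. a (Suc j) * of_nat (Suc j) powr (- s)) sums l \<Longrightarrow>
      norm (l - a q * of_nat q powr (- s)) \<le> norm (a q) / 2 * real q powr (- Re s)"
  define A where "A = norm (a q)"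
  have A: "A > 0" using q by (simp add: A_def)
  show ?thesis
  proof (rule that[of \<sigma>0 "\<bar>ln (A / 2)\<bar> + \<bar>ln (2 * A)\<bar> + ln q"])
    fix s l assume s: "Re s \<ge> \<sigma>0" and l: "(\<lambda>j. a (Suc j) * of_nat (Suc j) powr (- s)) sums l"
    define P where "P = real q powr (- Re s)"
    have P: "P > 0" "ln P = - Re s * ln q" using q by (auto simp: P_def ln_powr)
    have nq: "norm (a q * of_nat q powr (- s)) = A * P"
      unfolding norm_mult P_def A_def using q by (subst norm_powr_real_powr) auto
    have d: "norm (l - a q * of_nat q powr (- s)) \<le> A / 2 * P" using \<sigma>0(2)[OF s l] by (simp add: A_def P_def)
    have lo: "A / 2 * P \<le> norm l"
      using norm_triangle_ineq2[of "a q * of_nat q powr (- s)" l] d nq by (simp add: norm_minus_commute)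
    have hi: "norm l \<le> 2 * A * P"
      using norm_triangle_sub[of l "a q * of_nat q powr (- s)"] d nq mult_pos_pos[OF A P(1)] by (simp add: mult.assoc)
    have AP: "A / 2 * P > 0" using A P by simp
    hence l0: "norm l > 0" using lo by linarith
    have "ln (A / 2 * P) \<le> ln (norm l)" using lo AP by (intro ln_mono)
    moreover have "ln (norm l) \<le> ln (2 * A * P)" using hi l0 by (intro ln_mono) auto
    moreover have "ln (A / 2 * P) = ln (A / 2) - Re s * ln q" "ln (2 * A * P) = ln (2 * A) - Re s * ln q"
      using A P ln_mult[of "A / 2" P] ln_mult[of "2 * A" P] by simp_all
    moreover have "Re s * ln q \<ge> 0" using s \<sigma>0 q by simp
    ultimately have "\<bar>ln (norm l)\<bar> \<le> \<bar>ln (A / 2)\<bar> + \<bar>ln (2 * A)\<bar> + Re s * ln q" by linarith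
    also have "\<dots> \<le> \<bar>ln (A / 2)\<bar> * Re s + \<bar>ln (2 * A)\<bar> * Re s + Re s * ln q"
      using s \<sigma>0 by (intro add_mono mult_right_le_one_le order_refl) (auto simp: mult_le_cancel_left1)
    finally show "l \<noteq> 0 \<and> \<bar>ln (norm l)\<bar> \<le> (\<bar>ln (A / 2)\<bar> + \<bar>ln (2 * A)\<bar> + ln q) * Re s"
      using l0 by (auto simp: algebra_simps)
  qed (rule \<sigma>0)
  qed
qed

lemma bigo_powr_linear_bound:
  fixes a :: "nat \<Rightarrow> complex"
  assumes "(\<lambda>j. norm (a j)) \<in> O(\<lambda>j. real j powr e)" "e \<le> 1"
  shows "\<exists>c. \<forall>j\<ge>1. norm (a j) \<le> c * real j powr e \<and> norm (a j) \<le> c * real j"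
proof -
  obtain C where C: "C > 0" "eventually (\<lambda>j. norm (norm (a j)) \<le> C * norm (real j powr e)) sequentially"
    using landau_o.bigE[OF assms(1)] by blast
  then obtain J where J: "\<And>j. j \<ge> J \<Longrightarrow> norm (a j) \<le> C * real j powr e"
    unfolding eventually_at_top_linorder by auto
  define c where "c = C + (\<Sum>j<J. norm (a j) / real j powr e)"
  have b: "norm (a j) \<le> c * real j powr e" if j: "j \<ge> 1" for j
  proof (cases "j < J")
    case True
    have "norm (a j) / real j powr e \<le> (\<Sum>j<J. norm (a j) / real j powr e)" using True by (intro member_le_sum) auto
    hence "norm (a j) / real j powr e \<le> c" using C by (simp add: c_def)
    thus ?thesis using j by (simp add: field_simps)
  next
    case False
    have "C \<le> c" by (auto simp: c_def intro!: sum_nonneg)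
    thus ?thesis using J[of j] False mult_right_mono[of C c "real j powr e"] by simp
  qed
  have c0: "c \<ge> 0" using C by (auto simp: c_def intro!: add_nonneg_nonneg sum_nonneg)
  have "norm (a j) \<le> c * real j" if j: "j \<ge> 1" for j
  proof -
    have "real j powr e \<le> real j powr 1" using j assms(2) by (intro powr_mono) auto
    hence "c * real j powr e \<le> c * real j" using c0 j by (intro mult_left_mono) auto
    thus ?thesis using b[OF j] by linarith
  qed
  thus ?thesis using b by blast
qed

section \<open>L-functions as Dirichlet series and as functions of finite order\<close>

lemma L_function_analytic:
  assumes L: "L_function L" and s: "s \<noteq> 1"
  shows "L analytic_on {s}"
proof -
  have nm: "L nicely_meromorphic_on UNIV" using L by (auto simp: L_function_def)
  obtain k0 F where F: "entire_finite_order F" "\<And>s. s \<noteq> 1 \<Longrightarrow> F s = (s - 1) ^ k0 * L s"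
    using L unfolding L_function_def by blast
  have hF: "F holomorphic_on UNIV" using F(1) by (simp add: entire_finite_order_def)
  have "isCont F s"
    using holomorphic_on_imp_continuous_on[OF hF] by (simp add: continuous_on_eq_continuous_at)
  hence "((\<lambda>z. F z / (z - 1) ^ k0) \<longlongrightarrow> F s / (s - 1) ^ k0) (at s)"
    using s by (intro tendsto_intros) (auto simp: isCont_def)
  moreover have "eventually (\<lambda>z. F z / (z - 1) ^ k0 = L z) (at s)"
    using eventually_neq_at_within[of 1 s UNIV] by eventually_elim (simp add: F(2))
  ultimately have "(L \<longlongrightarrow> F s / (s - 1) ^ k0) (at s)" by (rule Lim_transform_eventually)
  hence "\<not> is_pole L s" unfolding is_pole_def
    using not_tendsto_and_filterlim_at_infinity[of "at s" L] by auto
  thus ?thesis using nicely_meromorphic_on_imp_analytic_at[OF nm, of s] by simp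
qed

lemma L_function_order:
  assumes L: "L_function L"
  obtains F :: "complex \<Rightarrow> complex" and k0 k :: nat and C R :: real
    where "F holomorphic_on UNIV" "\<And>s. s \<noteq> 1 \<Longrightarrow> F s = (s - 1) ^ k0 * L s"
      "C \<ge> 0" "\<And>z. norm z \<ge> R \<Longrightarrow> norm (F z) \<le> exp (C * norm z ^ k)"
proof -
  obtain k0 F where F: "entire_finite_order F" "\<And>s. s \<noteq> 1 \<Longrightarrow> F s = (s - 1) ^ k0 * L s"
    using L unfolding L_function_def by blast
  obtain \<rho> where \<rho>: "(\<lambda>z. norm (F z)) \<in> O[at_infinity](\<lambda>z. exp (norm z powr \<rho>))" and hF: "F holomorphic_on UNIV"
    using F(1) by (auto simp: entire_finite_order_def)
  obtain c where c: "c > 0" "eventually (\<lambda>z. norm (norm (F z)) \<le> c * norm (exp (norm z powr \<rho>))) at_infinity"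
    using landau_o.bigE[OF \<rho>] by blast
  then obtain b where b: "\<And>z. norm z \<ge> b \<Longrightarrow> norm (F z) \<le> c * exp (norm z powr \<rho>)"
    unfolding eventually_at_infinity by auto
  define k where "k = nat \<lceil>\<bar>\<rho>\<bar>\<rceil>"
  show ?thesis
  proof (rule that[OF hF F(2), where C = "\<bar>ln c\<bar> + 1" and k = k and R = "max 1 b"])
    fix z :: complex assume z: "norm z \<ge> max 1 b"
    have "norm z powr \<rho> \<le> norm z powr real k" using z unfolding k_def by (intro powr_mono) linarith+
    also have "\<dots> = norm z ^ k"
    proof (rule powr_realpow)
      show "norm z > 0" using z by linarith
    qed
    finally have 1: "norm z powr \<rho> \<le> norm z ^ k" .
    have 2: "1 \<le> norm z ^ k" using z by (intro one_le_power) auto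
    have "norm (F z) \<le> exp (ln c) * exp (norm z powr \<rho>)" using b[of z] z c by simp
    also have "\<dots> = exp (ln c + norm z powr \<rho>)" by (simp add: exp_add)
    also have "\<dots> \<le> exp (\<bar>ln c\<bar> * norm z ^ k + norm z ^ k)"
    proof -
      have "ln c \<le> \<bar>ln c\<bar> * norm z ^ k" using mult_left_mono[OF 2, of "\<bar>ln c\<bar>"] by linarith
      thus ?thesis using 1 by simp
    qed
    finally show "norm (F z) \<le> exp ((\<bar>ln c\<bar> + 1) * norm z ^ k)" by (simp add: algebra_simps)
  qed auto
qed

text \<open>
  \<open>L - w\<close> is a Dirichlet series as well; only the coefficient with index 1 has changed.
\<close>
lemma L_function_omits_value_right:
  assumes L: "L_function L" and nc: "\<not> L constant_on UNIV"
  obtains \<sigma>0 K where "\<sigma>0 \<ge> 3" "\<And>s. Re s \<ge> \<sigma>0 \<Longrightarrow> L s \<noteq> w \<and> \<bar>ln (norm (L s - w))\<bar> \<le> K * Re s"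
proof -
  have nm: "L nicely_meromorphic_on UNIV" using L by (auto simp: L_function_def)
  obtain a where a: "\<And>s. Re s > 1 \<Longrightarrow> (\<lambda>j. a (Suc j) * of_nat (Suc j) powr (- s)) sums L s"
    "\<forall>\<epsilon>::real. \<epsilon> > 0 \<longrightarrow> (\<lambda>j. norm (a j)) \<in> O(\<lambda>j. real j powr \<epsilon>)"
    using L unfolding L_function_def by blast
  obtain c where c: "\<And>j. j \<ge> 1 \<Longrightarrow> norm (a j) \<le> c * real j"
    using bigo_powr_linear_bound[OF a(2)[rule_format, of 1]] by fastforce
  define a' where "a' = (\<lambda>j. if j = 1 then a 1 - w else a j)"
  have sums: "(\<lambda>j. a' (Suc j) * of_nat (Suc j) powr (- s)) sums (L s - w)" if "Re s > 1" for s
  proof -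
    have "(\<lambda>j. if j = 0 then w else 0) sums w" using sums_single[of 0 "\<lambda>_. w"] by simp
    from sums_diff[OF a(1)[OF that] this] show ?thesis
      by (rule sums_cong[THEN iffD1, rotated]) (auto simp: a'_def)
  qed
  show ?thesis
  proof (rule dirichlet_series_ln_norm_bound[of a' "c + norm w"])
    fix j :: nat assume j: "j \<ge> 1"
    have "norm (a' j) \<le> norm (a j) + norm w" by (auto simp: a'_def norm_triangle_ineq4)
    also have "\<dots> \<le> c * real j + norm w * real j"
      using c[OF j] j mult_left_mono[of 1 "real j" "norm w"] by simp
    finally show "norm (a' j) \<le> (c + norm w) * real j" by (simp add: algebra_simps)
  next
    show "\<exists>j\<ge>1. a' j \<noteq> 0"
    proof (rule ccontr)
      assume "\<not> ?thesis"
      hence "a' (Suc j) = 0" for j by auto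
      hence Lw: "L s = w" if "Re s > 1" for s using sums[OF that] by (simp add: sums_iff)
      have "open {s. Re s > 1}" by (simp add: open_halfspace_Re_gt)
      hence "eventually (\<lambda>s. s \<in> {s. Re s > 1}) (nhds 2)" by (rule eventually_nhds_in_open) simp
      hence "eventually (\<lambda>s. L s = w) (at 2)"
        unfolding eventually_at_filter by eventually_elim (use Lw in auto)
      thus False using nicely_meromorphic_frequently_neq[OF nm nc, of w 2] by (simp add: frequently_def)
    qed
  next
    fix \<sigma>0 K assume *: "\<sigma>0 \<ge> 3" "\<And>s l. Re s \<ge> \<sigma>0 \<Longrightarrow> (\<lambda>j. a' (Suc j) * of_nat (Suc j) powr (- s)) sums l \<Longrightarrow>
      l \<noteq> 0 \<and> \<bar>ln (norm l)\<bar> \<le> K * Re s"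
    show ?thesis
    proof (rule that[OF *(1)])
      fix s assume "Re s \<ge> \<sigma>0"
      thus "L s \<noteq> w \<and> \<bar>ln (norm (L s - w))\<bar> \<le> K * Re s" using *(2)[OF _ sums, of s] *(1) by simp
    qed
  qed
qed

text \<open>
  The logarithm of \<open>L\<close> is a Dirichlet series without term of index 1, because 1 is not a prime power.
\<close>
lemma L_function_tends_1:
  assumes L: "L_function L" and e: "e > 0"
  obtains \<sigma>1 where "\<sigma>1 \<ge> 3" "\<And>s. Re s \<ge> \<sigma>1 \<Longrightarrow> norm (L s - 1) < e"
proof -
  obtain b \<theta> where b: "\<theta> < 1/2" "\<forall>j\<ge>1. \<not> primepow j \<longrightarrow> b j = 0"
        "(\<lambda>j. norm (b j)) \<in> O(\<lambda>j. real j powr \<theta>)"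
        "\<forall>s. Re s > 1 \<longrightarrow> (\<exists>l. (\<lambda>j. b (Suc j) * of_nat (Suc j) powr (- s)) sums l \<and> exp l = L s)"
    using L unfolding L_function_def by blast
  have "\<theta> \<le> 1" using b(1) by simp
  then obtain c where c: "\<And>j. j \<ge> 1 \<Longrightarrow> norm (b j) \<le> c * real j"
    using bigo_powr_linear_bound[OF b(3)] by metis
  obtain D where D: "D \<ge> 0" "\<And>s l N. Re s \<ge> 3 \<Longrightarrow> (\<lambda>j. b (Suc j) * of_nat (Suc j) powr (- s)) sums l \<Longrightarrow>
       norm (l - (\<Sum>j<N. b (Suc j) * of_nat (Suc j) powr (- s))) \<le> D * real (Suc N) powr (3 - Re s)"
    using dirichlet_tail[OF c] by blast
  have "isCont exp (0::complex)" by simp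
  then obtain d where d: "d > 0" "\<And>l::complex. norm l < d \<Longrightarrow> norm (exp l - 1) < e"
    unfolding continuous_at_eps_delta using e by (force simp: dist_norm)
  obtain \<sigma>0 where \<sigma>0: "\<sigma>0 \<ge> 3" "\<forall>\<sigma>\<ge>\<sigma>0. D * real (Suc 1) powr (3 - \<sigma>) \<le> d / 2 * real 1 powr (- \<sigma>)"
    using powr_ratio_small[of 1 "d / 2" D] d D(1) by auto
  show ?thesis
  proof (rule that[OF \<sigma>0(1)])
    fix s assume s: "Re s \<ge> \<sigma>0"
    have "Re s > 1" using s \<sigma>0 by simp
    then obtain l where l: "(\<lambda>j. b (Suc j) * of_nat (Suc j) powr (- s)) sums l" "exp l = L s"
      using b(4) by blast
    have "b 1 = 0" using b(2) by simp
    hence "norm l \<le> D * real (Suc 1) powr (3 - Re s)" using D(2)[OF _ l(1), of 1] s \<sigma>0(1) by simp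
    also have "\<dots> \<le> d / 2" using \<sigma>0(2) s by force
    finally have "norm l < d" using d by simp
    thus "norm (L s - 1) < e" using d(2) l(2) by metis
  qed
qed

section \<open>Functional equations without Gamma factors\<close>

text \<open>
  The Phragmen-Lindelof lemma with \<open>N = 0\<close>, for the upper (\<open>u = \<i>\<close>) or lower (\<open>u = - \<i>\<close>)
  half of a vertical strip around the critical line.
\<close>
lemma half_strip_bounded:
  fixes g :: "complex \<Rightarrow> complex"
  assumes hol: "g holomorphic_on UNIV" and A: "A \<ge> 1" and C: "C \<ge> 0"
    and crude: "\<And>z. norm z \<ge> R \<Longrightarrow> norm (g z) \<le> exp (C * norm z ^ k)"
    and side: "\<And>z. \<bar>Re z - 1 / 2\<bar> = A \<Longrightarrow> norm (g z) \<le> M" and u: "u = \<i> \<or> u = - \<i>"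
  shows "\<exists>K'. \<forall>z. \<bar>Re z - 1 / 2\<bar> \<le> A \<longrightarrow> Im z / Im u \<ge> A \<longrightarrow> norm (g z) \<le> K'"
proof (rule phragmen_lindelof_half_strip[where g = "\<lambda>z. g (1 / 2 + u * z)" and A = A and R = "\<bar>R\<bar> + 1" and C = "C * 2 ^ k" and k = k and K = M and N = 0])
  have nu: "norm u = 1" using u by auto
  show "(\<lambda>z. g (1 / 2 + u * z)) holomorphic_on UNIV"
    by (intro holomorphic_on_compose_gen[OF _ hol, unfolded o_def] holomorphic_intros) auto
  show "A \<ge> 1" by fact
  fix z :: complex assume z: "norm z \<ge> \<bar>R\<bar> + 1"
  have n: "norm (1 / 2 + u * z) \<ge> norm z - 1 / 2" "norm (1 / 2 + u * z) \<le> 2 * norm z"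
    using norm_triangle_ineq2[of "u * z" "- (1 / 2)"] norm_triangle_ineq[of "1 / 2" "u * z"] nu z
    by (simp_all add: norm_mult add.commute)
  have "norm (g (1 / 2 + u * z)) \<le> exp (C * norm (1 / 2 + u * z) ^ k)"
    by (rule crude) (use n z in linarith)
  also have "\<dots> \<le> exp (C * (2 * norm z) ^ k)" using mult_left_mono[OF power_mono[OF n(2) norm_ge_zero, of k] C] by simp
  finally show "norm (g (1 / 2 + u * z)) \<le> exp (C * 2 ^ k * norm z ^ k)" by (simp add: power_mult_distrib mult_ac)
next
  fix z :: complex assume z: "A \<le> Re z" "\<bar>Im z\<bar> = A"
  have "\<bar>Re (1 / 2 + u * z) - 1 / 2\<bar> = A" using u z by auto
  from side[OF this] show "norm (g (1 / 2 + u * z)) \<le> M * norm z ^ 0" by simp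
next
  fix K' assume *: "\<And>z. A \<le> Re z \<Longrightarrow> \<bar>Im z\<bar> \<le> A \<Longrightarrow> norm (g (1 / 2 + u * z)) \<le> K' * norm z ^ 0"
  show ?thesis
  proof (intro exI[of _ K'] allI impI)
    fix z assume z: "\<bar>Re z - 1 / 2\<bar> \<le> A" "Im z / Im u \<ge> A"
    have "A \<le> Re ((z - 1 / 2) / u)" "\<bar>Im ((z - 1 / 2) / u)\<bar> \<le> A" using u z by (auto simp: Re_divide Im_divide)
    from *[OF this] show "norm (g z) \<le> K'" using u by auto
  qed
qed

text \<open>
  Without Gamma factors the functional equation relates \<open>|L s|\<close> to \<open>|L (1 - cnj s)|\<close>. Near 1 the latter is bounded,
  because \<open>L\<close> is analytic at 0; so \<open>L\<close> has no pole at 1.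
\<close>
lemma degree_zero_entire:
  assumes L: "L_function L" and Q: "Q > 0" and \<omega>: "norm \<omega> = 1"
    and fe: "\<forall>s. completed_L L Q 0 \<mu> \<nu> s = \<omega> * cnj (completed_L L Q 0 \<mu> \<nu> (1 - cnj s))"
  shows "L holomorphic_on UNIV" "\<And>s. s \<noteq> 0 \<Longrightarrow> s \<noteq> 1 \<Longrightarrow> norm (L s) = norm (L (1 - cnj s)) * Q powr (1 - 2 * Re s)"
proof -
  have an: "L analytic_on {s}" if "s \<noteq> 1" for s using L_function_analytic[OF L that] .
  have comp: "completed_L L Q 0 \<mu> \<nu> s = L s * of_real Q powr s" if "s \<noteq> 1" for s
  proof -
    have "(\<lambda>s. L s * of_real Q powr s * (\<Prod>j=1..0. Gamma (of_real (\<mu> j) * s + \<nu> j))) analytic_on {s}"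
      by (intro analytic_intros an) (use that Q in auto)
    from remove_sings_at_analytic[OF this] show ?thesis by (simp add: completed_L_def)
  qed
  show eq: "norm (L s) = norm (L (1 - cnj s)) * Q powr (1 - 2 * Re s)" if s: "s \<noteq> 0" "s \<noteq> 1" for s
  proof -
    have "1 - cnj s \<noteq> 1" using s by auto
    hence "L s * of_real Q powr s = \<omega> * cnj (L (1 - cnj s) * of_real Q powr (1 - cnj s))"
      using fe[rule_format, of s] comp[OF s(2)] comp[of "1 - cnj s"] by simp
    from arg_cong[OF this, of norm] have "norm (L s) * Q powr (Re s) = norm (L (1 - cnj s)) * Q powr (1 - Re s)"
      using \<omega> Q by (simp add: norm_mult norm_powr_real_powr)
    hence "norm (L s) * Q powr (Re s) * Q powr (- Re s) = norm (L (1 - cnj s)) * Q powr (1 - Re s) * Q powr (- Re s)"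
      by simp
    thus ?thesis using Q by (simp add: mult.assoc flip: powr_add)
  qed
  have "\<not> is_pole L 1"
  proof
    assume "is_pole L 1"
    hence inf: "filterlim L at_infinity (at 1)" by (simp add: is_pole_def)
    have "isCont L 0" using analytic_at_imp_isCont[OF an[of 0]] by simp
    hence "(L \<longlongrightarrow> L 0) (nhds 0)" by (simp add: isCont_def tendsto_at_iff_tendsto_nhds)
    moreover have "filterlim (\<lambda>s. 1 - cnj s) (nhds 0) (at 1)"
      by (auto intro!: tendsto_eq_intros)
    ultimately have "((\<lambda>s. L (1 - cnj s)) \<longlongrightarrow> L 0) (at 1)" by (rule filterlim_compose)
    hence "((\<lambda>s. norm (L (1 - cnj s)) * Q powr (1 - 2 * Re s)) \<longlongrightarrow> norm (L 0) * Q powr (1 - 2 * Re 1)) (at 1)"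
      using Q by (intro tendsto_mult tendsto_norm tendsto_powr tendsto_diff tendsto_const tendsto_Re tendsto_ident_at) auto
    moreover have "eventually (\<lambda>s. norm (L (1 - cnj s)) * Q powr (1 - 2 * Re s) = norm (L s)) (at 1)"
      using eventually_neq_at_within[of 0 1 UNIV] eventually_neq_at_within[of 1 1 UNIV]
      by eventually_elim (rule eq[symmetric])
    ultimately have "((\<lambda>s. norm (L s)) \<longlongrightarrow> norm (L 0) * Q powr (1 - 2 * Re 1)) (at 1)"
      by (rule Lim_transform_eventually)
    moreover have "filterlim (\<lambda>s. norm (L s)) at_top (at 1)"
      using inf by (simp add: filterlim_at_infinity_conv_norm_at_top)
    ultimately show False using not_tendsto_and_filterlim_at_infinity[of "at 1" "\<lambda>s. norm (L s)"]
        filterlim_at_top_imp_at_infinity by (metis at_neq_bot)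
  qed
  hence "L analytic_on {1}"
    using nicely_meromorphic_on_imp_analytic_at[of L UNIV 1] L by (auto simp: L_function_def)
  hence "L analytic_on UNIV" using an by (subst analytic_on_analytic_at) metis
  thus "L holomorphic_on UNIV" by (rule analytic_imp_holomorphic)
qed

text \<open>
  Let \<open>P\<close> be the partial sum of the Dirichlet series up to \<open>N \<ge> Q\<^sup>2\<close> and \<open>q = N + 1\<close>. Then
  \<open>H s = (L s - P s) q powr s\<close> is bounded on the right, because \<open>q\<close> is the index of the first remaining term; it is
  bounded on the left, because there \<open>|L s|\<close> is at most of size \<open>(Q\<^sup>2) powr (- Re s)\<close> and \<open>Q\<^sup>2 < q\<close>; and it is bounded in between by
  the Phragmen-Lindelof principle. By Liouville's theorem \<open>H\<close> is constant. It tends to 0 on the left, so \<open>L = P\<close>.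
\<close>
lemma degree_zero_dirichlet_polynomial:
  assumes L: "L_function L" and Q: "Q > 0" and \<omega>: "norm \<omega> = 1"
    and fe: "\<forall>s. completed_L L Q 0 \<mu> \<nu> s = \<omega> * cnj (completed_L L Q 0 \<mu> \<nu> (1 - cnj s))"
  obtains N a where "\<And>s. L s = (\<Sum>j<N. a (Suc j) * of_nat (Suc j) powr (- s))"
proof -
  note hol = degree_zero_entire(1)[OF L Q \<omega> fe] and eq = degree_zero_entire(2)[OF L Q \<omega> fe]
  obtain a where a: "\<And>s. Re s > 1 \<Longrightarrow> (\<lambda>j. a (Suc j) * of_nat (Suc j) powr (- s)) sums L s"
    "\<forall>\<epsilon>::real. \<epsilon> > 0 \<longrightarrow> (\<lambda>j. norm (a j)) \<in> O(\<lambda>j. real j powr \<epsilon>)"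
    using L unfolding L_function_def by blast
  obtain c where c: "\<And>j. j \<ge> 1 \<Longrightarrow> norm (a j) \<le> c * real j"
    using bigo_powr_linear_bound[OF a(2)[rule_format, of 1]] by fastforce
  obtain D where D: "D \<ge> 0" "\<And>s l N. Re s \<ge> 3 \<Longrightarrow> (\<lambda>j. a (Suc j) * of_nat (Suc j) powr (- s)) sums l \<Longrightarrow>
       norm (l - (\<Sum>j<N. a (Suc j) * of_nat (Suc j) powr (- s))) \<le> D * real (Suc N) powr (3 - Re s)"
    using dirichlet_tail[OF c] by blast
  have tail: "norm (L s - (\<Sum>j<N. a (Suc j) * of_nat (Suc j) powr (- s))) \<le> D * real (Suc N) powr (3 - Re s)"
    if "Re s \<ge> 3" for s N using D(2)[OF that a(1)] that by simp
  have right: "norm (L s) \<le> D" if "Re s \<ge> 3" for s using tail[OF that, of 0] by simp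
  have left: "norm (L s) \<le> D * Q powr (1 - 2 * Re s)" if "Re s \<le> - 2" for s
  proof -
    have "norm (L s) = norm (L (1 - cnj s)) * Q powr (1 - 2 * Re s)" using that by (intro eq) auto
    also have "\<dots> \<le> D * Q powr (1 - 2 * Re s)" using that by (intro mult_right_mono right) auto
    finally show ?thesis .
  qed
  obtain F k0 k C R where F: "F holomorphic_on UNIV" "\<And>s. s \<noteq> 1 \<Longrightarrow> F s = (s - 1) ^ k0 * L s"
      "C \<ge> 0" "\<And>z. norm z \<ge> R \<Longrightarrow> norm (F z) \<le> exp (C * norm z ^ k)"
    using L_function_order[OF L] by metis
  have crude: "norm (L z) \<le> exp (C * norm z ^ k)" if z: "norm z \<ge> \<bar>R\<bar> + 2" for z
  proof -
    have "norm (z - 1) \<ge> 1" using norm_triangle_ineq2[of z 1] z by simp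
    hence "norm (L z) \<le> norm (z - 1) ^ k0 * norm (L z)" by (simp add: one_le_power mult_le_cancel_right1)
    also have "\<dots> = norm (F z)"
    proof -
      have "z \<noteq> 1" using \<open>norm (z - 1) \<ge> 1\<close> by auto
      thus ?thesis using F(2)[of z] by (simp add: norm_mult norm_power)
    qed
    also have "\<dots> \<le> exp (C * norm z ^ k)" using z by (intro F(4)) auto
    finally show ?thesis .
  qed
  \<comment> \<open>the strip \<open>- 2 \<le> Re z \<le> 3\<close> has half width \<open>5/2\<close> around the critical line\<close>
  define A where "A = (5 / 2 :: real)"
  define M where "M = max D (D * Q powr 5)"
  have side: "norm (L z) \<le> M" if "\<bar>Re z - 1 / 2\<bar> = A" for z
  proof -
    from that consider "Re z = 3" | "Re z = -2" unfolding A_def by linarith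
    thus ?thesis using right[of z] left[of z] by cases (auto simp: M_def)
  qed
  have A1: "A \<ge> 1" by (simp add: A_def)
  have hs: "\<exists>K'. \<forall>z. \<bar>Re z - 1 / 2\<bar> \<le> A \<longrightarrow> Im z / Im u \<ge> A \<longrightarrow> norm (L z) \<le> K'"
    if u: "u = \<i> \<or> u = - \<i>" for u
  proof (rule half_strip_bounded[where R = "\<bar>R\<bar> + 2" and C = C and k = k and M = M])
    show "L holomorphic_on UNIV" "A \<ge> 1" "C \<ge> 0" "u = \<i> \<or> u = - \<i>" by fact+
    fix z :: complex
    show "norm (L z) \<le> exp (C * norm z ^ k)" if "\<bar>R\<bar> + 2 \<le> norm z" using crude[OF that] .
    show "norm (L z) \<le> M" if "\<bar>Re z - 1 / 2\<bar> = A" using side[OF that] .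
  qed
  obtain K1 where K1: "\<And>z. \<bar>Re z - 1 / 2\<bar> \<le> A \<Longrightarrow> Im z / Im \<i> \<ge> A \<Longrightarrow> norm (L z) \<le> K1"
    using hs[of \<i>] by blast
  obtain K2 where K2: "\<And>z. \<bar>Re z - 1 / 2\<bar> \<le> A \<Longrightarrow> Im z / Im (-\<i>) \<ge> A \<Longrightarrow> norm (L z) \<le> K2"
    using hs[of "-\<i>"] by blast
  have "compact (cbox (Complex (-2) (-A)) (Complex 3 A))" by (rule compact_cbox)
  hence "bounded (L ` cbox (Complex (-2) (-A)) (Complex 3 A))"
    using hol by (meson compact_continuous_image compact_imp_bounded continuous_on_subset holomorphic_on_imp_continuous_on subset_UNIV)
  then obtain K3 where K3: "\<And>z. z \<in> cbox (Complex (-2) (-A)) (Complex 3 A) \<Longrightarrow> norm (L z) \<le> K3"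
    unfolding bounded_iff by blast
  define K where "K = max K1 (max K2 K3)"
  have strip: "norm (L z) \<le> K" if "-2 \<le> Re z" "Re z \<le> 3" for z
  proof -
    have r: "\<bar>Re z - 1 / 2\<bar> \<le> A" unfolding A_def abs_le_iff using that by auto
    consider "Im z \<ge> A" | "Im z \<le> - A" | "\<bar>Im z\<bar> \<le> A" by linarith
    thus ?thesis
    proof cases
      case 1 thus ?thesis using K1[OF r] by (simp add: K_def)
    next
      case 2 thus ?thesis using K2[OF r] by (simp add: K_def)
    next
      case 3 thus ?thesis using K3[of z] that by (auto simp: K_def in_cbox_complex_iff abs_le_iff le_max_iff_disj)
    qed
  qed
  define N where "N = nat \<lceil>Q\<^sup>2\<rceil>"
  define q where "q = real (Suc N)"
  have "Q\<^sup>2 < q" unfolding q_def N_def by linarith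
  moreover have "q \<ge> 1" by (simp add: q_def)
  ultimately have qQ: "Q\<^sup>2 < q" "q \<ge> 1" by auto
  define P where "P = (\<lambda>s. \<Sum>j<N. a (Suc j) * of_nat (Suc j) powr (- s))"
  define S where "S = (\<Sum>j<N. norm (a (Suc j)))"
  have S0: "S \<ge> 0" by (simp add: S_def sum_nonneg)
  define H where "H = (\<lambda>s. (L s - P s) * of_real q powr s)"
  have holP: "P holomorphic_on UNIV" unfolding P_def by (intro holomorphic_intros)
  have holH: "H holomorphic_on UNIV" unfolding H_def
    by (intro holomorphic_intros hol holP) (use qQ in auto)
  have nH: "norm (H s) = norm (L s - P s) * q powr Re s" for s
    using qQ by (simp add: H_def norm_mult norm_powr_real_powr)
  have Pb: "norm (P s) * q powr Re s \<le> (\<Sum>j<N. norm (a (Suc j)) * (q / real (Suc j)) powr Re s)" for s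
  proof -
    have "norm (P s) \<le> (\<Sum>j<N. norm (a (Suc j)) * real (Suc j) powr (- Re s))"
      unfolding P_def
    proof (rule order_trans[OF norm_sum sum_mono])
      fix j
      have "norm (of_nat (Suc j) powr (- s) :: complex) = real (Suc j) powr (- Re s)"
        by (subst norm_powr_real_powr) auto
      thus "norm (a (Suc j) * of_nat (Suc j) powr (- s)) \<le> norm (a (Suc j)) * real (Suc j) powr (- Re s)"
        by (simp add: norm_mult)
    qed
    hence "norm (P s) * q powr Re s \<le> (\<Sum>j<N. norm (a (Suc j)) * real (Suc j) powr (- Re s)) * q powr Re s"
      by (rule mult_right_mono) simp
    also have "\<dots> = (\<Sum>j<N. norm (a (Suc j)) * (q / real (Suc j)) powr Re s)"
      unfolding sum_distrib_right
    proof (rule sum.cong)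
      fix j
      have "real (Suc j) powr (- Re s) * q powr Re s = (q / real (Suc j)) powr Re s"
        using qQ powr_divide[of q "real (Suc j)" "Re s"] by (simp add: powr_minus divide_inverse mult.commute)
      thus "norm (a (Suc j)) * real (Suc j) powr - Re s * q powr Re s = norm (a (Suc j)) * (q / real (Suc j)) powr Re s"
        by (simp add: mult.assoc)
    qed simp
    finally show ?thesis .
  qed
  have Hleft: "norm (H s) \<le> D * Q * (q / Q\<^sup>2) powr Re s + (\<Sum>j<N. norm (a (Suc j)) * (q / real (Suc j)) powr Re s)"
    if "Re s \<le> -2" for s
  proof -
    have "norm (H s) \<le> (norm (L s) + norm (P s)) * q powr Re s"
      unfolding nH by (intro mult_right_mono norm_triangle_ineq4) auto
    also have "\<dots> = norm (L s) * q powr Re s + norm (P s) * q powr Re s" by (simp add: distrib_right)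
    also have "norm (L s) * q powr Re s \<le> (D * Q powr (1 - 2 * Re s)) * q powr Re s"
      by (intro mult_right_mono left that) auto
    also have "\<dots> = D * Q * (q / Q\<^sup>2) powr Re s"
    proof -
      have "Q powr (1 - 2 * Re s) = Q * Q powr (- (2 * Re s))" using powr_add[of Q 1 "- (2 * Re s)"] Q by simp
      moreover have "Q powr (- (2 * Re s)) = (Q\<^sup>2) powr (- Re s)"
        using powr_powr[of Q 2 "- Re s"] Q by simp
      moreover have "(Q\<^sup>2) powr (- Re s) * q powr Re s = (q / Q\<^sup>2) powr Re s"
        using qQ Q powr_divide[of q "Q\<^sup>2" "Re s"] by (simp add: powr_minus divide_inverse mult.commute)
      ultimately show ?thesis by (simp add: mult.assoc)
    qed
    finally show ?thesis using Pb[of s] by linarith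
  qed
  have rat: "(q / y) powr x \<le> 1" if "0 < y" "y \<le> q" "x \<le> 0" for x y
    using powr_mono2'[of "-x" 1 "q / y"] that qQ powr_mono[of x 0 "q / y"] by simp
  have Hb: "norm (H s) \<le> D * Q + S + D * q ^ 3 + \<bar>K\<bar> * q ^ 3 + S * q ^ 3 * q ^ 3" for s
  proof -
    have q3: "q ^ 3 \<ge> 1" using qQ by (intro one_le_power) auto
    consider "Re s \<ge> 3" | "-2 \<le> Re s" "Re s \<le> 3" | "Re s \<le> -2" by linarith
    hence "norm (H s) \<le> D * q ^ 3 \<or> norm (H s) \<le> \<bar>K\<bar> * q ^ 3 + S * q ^ 3 * q ^ 3 \<or> norm (H s) \<le> D * Q + S"
    proof cases
      case 1
      have "norm (L s - P s) \<le> D * q powr (3 - Re s)" using tail[OF 1, of N] by (simp add: P_def q_def)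
      hence "norm (H s) \<le> D * q powr (3 - Re s) * q powr Re s" unfolding nH by (rule mult_right_mono) simp
      also have "\<dots> = D * q ^ 3" using qQ by (simp add: mult.assoc flip: powr_add)
      finally show ?thesis by blast
    next
      case 2
      have "norm (H s) \<le> (norm (L s) + norm (P s)) * q powr Re s"
        unfolding nH by (intro mult_right_mono norm_triangle_ineq4) auto
      also have "\<dots> = norm (L s) * q powr Re s + norm (P s) * q powr Re s" by (simp add: distrib_right)
      also have "norm (L s) * q powr Re s \<le> \<bar>K\<bar> * q ^ 3"
      proof (rule mult_mono)
        show "norm (L s) \<le> \<bar>K\<bar>" using strip[OF 2] by simp
        have "q powr Re s \<le> q powr 3" using 2 qQ by (intro powr_mono) auto
        thus "q powr Re s \<le> q ^ 3" using qQ by simp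
      qed auto
      also have "norm (P s) * q powr Re s \<le> S * (q ^ 3 * q ^ 3)"
      proof -
        have "(\<Sum>j<N. norm (a (Suc j)) * (q / real (Suc j)) powr Re s) \<le> (\<Sum>j<N. norm (a (Suc j)) * (q ^ 3 * q ^ 3))"
        proof (rule sum_mono, rule mult_left_mono)
          fix j assume j: "j \<in> {..<N}"
          have jq: "1 \<le> q / real (Suc j)" "q / real (Suc j) \<le> q" using j qQ by (auto simp: q_def divide_simps)
          have "(q / real (Suc j)) powr Re s \<le> (q / real (Suc j)) powr 3" using 2 jq by (intro powr_mono) auto
          also have "\<dots> \<le> q powr 3" using jq by (intro powr_mono2) auto
          also have "\<dots> = q ^ 3" using qQ by simp
          also have "\<dots> \<le> q ^ 3 * q ^ 3" using mult_left_mono[OF q3, of "q ^ 3"] q3 qQ(2) by simp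
          finally show "(q / real (Suc j)) powr Re s \<le> q ^ 3 * q ^ 3" .
        qed simp
        thus ?thesis using Pb[of s] by (simp add: S_def sum_distrib_right)
      qed
      finally show ?thesis by (simp add: mult.assoc)
    next
      case 3
      have "D * Q * (q / Q\<^sup>2) powr Re s \<le> D * Q * 1"
        using 3 D(1) Q qQ by (intro mult_left_mono rat) auto
      moreover have "(\<Sum>j<N. norm (a (Suc j)) * (q / real (Suc j)) powr Re s) \<le> (\<Sum>j<N. norm (a (Suc j)) * 1)"
        using 3 by (intro sum_mono mult_left_mono rat) (auto simp: q_def)
      ultimately show ?thesis using Hleft[OF 3] by (simp add: S_def)
    qed
    moreover have "D * q ^ 3 \<ge> 0" "\<bar>K\<bar> * q ^ 3 \<ge> 0" "S * q ^ 3 * q ^ 3 \<ge> 0" "D * Q \<ge> 0"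
      using D(1) S0 Q qQ by auto
    ultimately show ?thesis using S0 by linarith
  qed
  have "H constant_on UNIV"
    by (rule Liouville_theorem[OF holH]) (use Hb in \<open>auto simp: bounded_iff\<close>)
  then obtain \<kappa> where \<kappa>: "\<And>s. H s = \<kappa>" by (auto simp: constant_on_def)
  have decay: "((\<lambda>x::real. (q / y) powr (- x)) \<longlongrightarrow> 0) at_top" if "0 < y" "y < q" for y
  proof -
    have "(q / y) powr (- x) = (y / q) powr x" for x
      using that qQ by (simp add: powr_minus powr_divide)
    thus ?thesis using powr_tendsto_0[of "y / q"] that qQ by simp
  qed
  have "((\<lambda>x. D * Q * (q / Q\<^sup>2) powr (- x) + (\<Sum>j<N. norm (a (Suc j)) * (q / real (Suc j)) powr (- x)))
      \<longlongrightarrow> D * Q * 0 + (\<Sum>j<N. norm (a (Suc j)) * 0)) at_top"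
    using Q qQ by (intro tendsto_add tendsto_mult tendsto_const tendsto_sum decay) (auto simp: q_def)
  hence lim: "((\<lambda>x. D * Q * (q / Q\<^sup>2) powr (- x) + (\<Sum>j<N. norm (a (Suc j)) * (q / real (Suc j)) powr (- x))) \<longlongrightarrow> 0) at_top"
    by simp
  have "norm \<kappa> \<le> 0"
  proof (rule tendsto_lowerbound[OF lim])
    show "eventually (\<lambda>x. norm \<kappa> \<le> D * Q * (q / Q\<^sup>2) powr (- x) + (\<Sum>j<N. norm (a (Suc j)) * (q / real (Suc j)) powr (- x))) at_top"
      using eventually_ge_at_top[of 2]
    proof eventually_elim
      case (elim x)
      thus ?case using Hleft[of "- of_real x"] \<kappa>[of "- of_real x"] by simp
    qed
  qed simp
  hence "L s = P s" for s using \<kappa>[of s] qQ by (simp add: H_def)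
  thus ?thesis using that[of a N] by (simp add: P_def)
qed

section \<open>Coefficients, Euler factors and the logarithm of a Dirichlet series\<close>

lemma poly_lead_le_of_roots:
  fixes q :: "complex poly"
  assumes "\<And>x. poly q x = 0 \<Longrightarrow> norm x \<ge> \<rho>" "\<rho> \<ge> 0"
  shows "norm (lead_coeff q) * \<rho> ^ degree q \<le> norm (coeff q 0)"
  using assms
proof (induction "degree q" arbitrary: q)
  case 0
  then show ?case by simp
next
  case (Suc n)
  hence "\<not> constant (poly q)" by (simp add: constant_degree)
  then obtain r where r: "poly q r = 0" using fundamental_theorem_of_algebra by blast
  then obtain q' where q': "q = [:-r, 1:] * q'" by (auto simp: poly_eq_0_iff_dvd)
  have "q' \<noteq> 0" using Suc.hyps(2) q' by auto
  hence deg: "degree q = Suc (degree q')" unfolding q' by (subst degree_mult_eq) auto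
  have IH: "norm (lead_coeff q') * \<rho> ^ degree q' \<le> norm (coeff q' 0)"
    using Suc.hyps deg Suc.prems by (intro Suc.hyps(1)) (auto simp: q')
  have "norm r \<ge> \<rho>" using Suc.prems(1) r by blast
  have "norm (lead_coeff q) * \<rho> ^ degree q = \<rho> * (norm (lead_coeff q') * \<rho> ^ degree q')"
  proof -
    have "lead_coeff q = lead_coeff q'" unfolding q' lead_coeff_mult by simp
    thus ?thesis using deg by simp
  qed
  also have "\<dots> \<le> norm r * norm (coeff q' 0)"
    using \<open>norm r \<ge> \<rho>\<close> IH Suc.prems(2) by (intro mult_mono) auto
  also have "\<dots> = norm (coeff q 0)" by (simp add: q' norm_mult)
  finally show ?case .
qed

text \<open>
  The recursion is the coefficient form of \<open>L' = L (log L)'\<close>. If \<open>b\<close> lives on prime powers, only divisors \<open>d\<close> of \<open>u\<close>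
  or of \<open>v\<close> contribute to it at \<open>u v\<close>, and by induction on \<open>u v\<close> the two parts add up to
  \<open>a u * a v * (ln u + ln v)\<close>.
\<close>
lemma multiplicative_of_log_recursion:
  fixes a b :: "nat \<Rightarrow> complex"
  assumes rec: "\<And>k. k \<ge> 1 \<Longrightarrow> a k * of_real (ln k) = (\<Sum>d | d dvd k. a (k div d) * b d * of_real (ln d))"
    and b: "\<And>j. j \<ge> 1 \<Longrightarrow> \<not> primepow j \<Longrightarrow> b j = 0" and a1: "a 1 = 1"
    and uv: "u \<ge> 1" "v \<ge> 1" "coprime u v"
  shows "a (u * v) = a u * a v"
  using uv
proof (induction "u * v" arbitrary: u v rule: less_induct)
  case less
  show ?case
  proof (cases "u * v = 1")
    case True
    thus ?thesis using a1 by simp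
  next
    case False
    define t where "t = (\<lambda>k d. a (k div d) * b d * of_real (ln (real d)))"
    have uv1: "u * v > 1" using False less.prems by (metis less_one linorder_neqE_nat mult_is_0 not_one_le_zero)
    have fin: "finite {d. d dvd u * v}" "finite {d. d dvd u}" "finite {d. d dvd v}"
      using less.prems by (auto intro!: finite_divisors_nat)
    have pp: "d dvd u \<or> d dvd v" if "primepow d" "d dvd u * v" for d
    proof -
      obtain p i where pi: "prime p" "d = p ^ i" using \<open>primepow d\<close> by (auto simp: primepow_def)
      show ?thesis
      proof (cases "p dvd u")
        case True
        hence "coprime p v" using less.prems(3) by (meson coprime_common_divisor pi(1) prime_imp_coprime not_prime_unit)
        hence "coprime d v" by (simp add: pi)
        thus ?thesis using that(2) by (simp add: coprime_dvd_mult_left_iff)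
      next
        case False
        hence "coprime d u" using pi by (simp add: prime_imp_coprime)
        thus ?thesis using that(2) by (simp add: coprime_dvd_mult_right_iff)
      qed
    qed
    have tu: "t (u * v) d = t u d * a v" if du: "d dvd u" for d
    proof (cases "d = 1 \<or> d = 0")
      case False
      obtain e where e: "u = d * e" using du by (elim dvdE)
      have e1: "e \<ge> 1" "d > 1" using less.prems e False by (auto simp: Suc_leI)
      have "a (e * v) = a e * a v"
      proof (rule less.hyps)
        show "e * v < u * v" using e e1 less.prems by simp
        show "coprime e v" using less.prems(3) e by simp
      qed (use e1 less.prems in auto)
      moreover have "u * v div d = e * v" "u div d = e" using e e1 by simp_all
      ultimately show ?thesis by (simp add: t_def)
    qed (auto simp: t_def)
    have tv: "t (u * v) d = a u * t v d" if dv: "d dvd v" for d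
    proof (cases "d = 1 \<or> d = 0")
      case False
      obtain e where e: "v = d * e" using dv by (elim dvdE)
      have e1: "e \<ge> 1" "d > 1" using less.prems e False by (auto simp: Suc_leI)
      have "a (u * e) = a u * a e"
      proof (rule less.hyps)
        show "u * e < u * v" using e e1 less.prems by simp
        show "coprime u e" using less.prems(3) e by simp
      qed (use e1 less.prems in auto)
      moreover have "u * v div d = u * e" using e e1 by (simp add: mult.left_commute)
      moreover have "v div d = e" using e e1 by simp
      ultimately show ?thesis by (simp add: t_def)
    qed (auto simp: t_def)
    have t0: "t (u * v) d = 0" if "d dvd u * v" "\<not> (d dvd u \<or> d dvd v)" for d
    proof -
      have "d \<ge> 1" using that uv1 by (metis dvd_0_left_iff less_one not_le not_less0)
      thus ?thesis using that pp b by (auto simp: t_def)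
    qed
    have inter: "t k d = 0" if "d dvd u" "d dvd v" for d k
    proof -
      have "d = 1" using that less.prems(3) coprime_common_divisor_nat by auto
      thus ?thesis by (simp add: t_def)
    qed
    have "a (u * v) * of_real (ln (real (u * v))) = (\<Sum>d | d dvd u * v. t (u * v) d)"
      unfolding t_def by (rule rec) (use uv1 in linarith)
    also have "\<dots> = (\<Sum>d \<in> {d. d dvd u} \<union> {d. d dvd v}. t (u * v) d)"
      by (rule sum.mono_neutral_right) (use fin t0 in \<open>auto intro: dvd_mult dvd_mult2\<close>)
    also have "\<dots> = (\<Sum>d | d dvd u. t (u * v) d) + (\<Sum>d | d dvd v. t (u * v) d)"
      by (rule sum.union_inter_neutral) (use fin inter in auto)
    also have "\<dots> = (\<Sum>d | d dvd u. t u d) * a v + a u * (\<Sum>d | d dvd v. t v d)"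
      using tu tv by (simp add: sum_distrib_left sum_distrib_right)
    also have "(\<Sum>d | d dvd u. t u d) = a u * of_real (ln u)" using rec[of u] less.prems by (simp add: t_def)
    also have "(\<Sum>d | d dvd v. t v d) = a v * of_real (ln v)" using rec[of v] less.prems by (simp add: t_def)
    also have "a u * of_real (ln u) * a v + a u * (a v * of_real (ln v)) = a u * a v * of_real (ln (real (u * v)))"
      using less.prems by (simp add: ln_mult algebra_simps)
    finally have "(a (u * v) - a u * a v) * of_real (ln (real (u * v))) = 0" by (simp add: algebra_simps)
    moreover have "ln (real (u * v)) > 0" using uv1 by (intro ln_gt_zero) linarith
    ultimately show ?thesis by simp
  qed
qed

text \<open>
  If all local factors were smaller than \<open>sqrt (p ^ v)\<close>, their product would be smaller than \<open>sqrt M\<close>. The induction splits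
  off one prime at a time.
\<close>
lemma large_local_factor:
  fixes a :: "nat \<Rightarrow> complex"
  assumes mult: "\<And>u v. u \<ge> 1 \<Longrightarrow> v \<ge> 1 \<Longrightarrow> coprime u v \<Longrightarrow> a (u * v) = a u * a v" and a1: "a 1 = 1"
    and M: "M \<ge> 2" "norm (a M) \<ge> sqrt M"
  obtains p where "prime p" "p dvd M" "norm (a (p ^ multiplicity p M)) \<ge> sqrt (real (p ^ multiplicity p M))"
  using M
proof (induction M arbitrary: thesis rule: less_induct)
  case (less M)
  obtain p where p: "prime p" "p dvd M" using less.prems(2) by (metis prime_factor_nat numeral_le_one_iff semiring_norm(69))
  define v where "v = multiplicity p M"
  have "M \<noteq> 0" using less.prems by auto
  then obtain M' where M': "M = p ^ v * M'" "\<not> p dvd M'"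
    using multiplicity_decompose'[of M p] p(1) unfolding v_def by (metis not_prime_unit)
  have v: "v > 0"
    using p \<open>M \<noteq> 0\<close> multiplicity_eq_zero_iff[of M p] prime_gt_1_nat[OF p(1)] by (auto simp: v_def)
  have "M' \<noteq> 0" using M'(1) \<open>M \<noteq> 0\<close> by (metis mult_0_right)
  hence M'1: "M' \<ge> 1" by simp
  have cop: "coprime (p ^ v) M'" using M'(2) p(1) by (simp add: prime_imp_coprime)
  have pv: "p ^ v > 1" using p(1) v by (metis one_less_power prime_gt_1_nat)
  have aM: "a M = a (p ^ v) * a M'" unfolding M'(1) by (rule mult) (use pv M'1 cop in auto)
  show ?case
  proof (cases "norm (a (p ^ v)) \<ge> sqrt (real (p ^ v))")
    case True
    thus ?thesis using less.prems(1) p v_def by blast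
  next
    case False
    have "sqrt (real (p ^ v)) * sqrt (real M') = sqrt M" by (simp add: M'(1) real_sqrt_mult)
    also have "\<dots> \<le> norm (a (p ^ v)) * norm (a M')" using less.prems(3) aM by (simp add: norm_mult)
    finally have le: "sqrt (real (p ^ v)) * sqrt (real M') \<le> norm (a (p ^ v)) * norm (a M')" .
    have aM'0: "norm (a M') > 0"
    proof (rule ccontr)
      assume "\<not> ?thesis"
      hence "sqrt (real (p ^ v)) * sqrt (real M') \<le> 0" using le by simp
      moreover have "sqrt (real (p ^ v)) * sqrt (real M') > 0" using prime_gt_0_nat[OF p(1)] M'1 by (intro mult_pos_pos) auto
      ultimately show False by linarith
    qed
    have "norm (a (p ^ v)) * norm (a M') < sqrt (real (p ^ v)) * norm (a M')"
      using False aM'0 by (intro mult_strict_right_mono) auto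
    hence "sqrt (real (p ^ v)) * sqrt (real M') < sqrt (real (p ^ v)) * norm (a M')" using le by linarith
    hence lt: "sqrt (real M') < norm (a M')"
    proof -
      have "sqrt (real (p ^ v)) > 0" using prime_gt_0_nat[OF p(1)] by simp
      thus "sqrt (real M') < norm (a M')"
        using \<open>sqrt (real (p ^ v)) * sqrt (real M') < sqrt (real (p ^ v)) * norm (a M')\<close>
        by (simp only: mult_less_cancel_left_pos)
    qed
    have "M' \<noteq> 1"
    proof
      assume "M' = 1"
      thus False using lt a1 by simp
    qed
    hence M'2: "M' \<ge> 2" using M'1 by linarith
    have M'M: "M' < M" using M'(1) pv M'1 by simp
    obtain p' where p': "prime p'" "p' dvd M'" "norm (a (p' ^ multiplicity p' M')) \<ge> sqrt (real (p' ^ multiplicity p' M'))"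
      using less.IH[OF M'M _ M'2] lt by auto
    have "p' \<noteq> p" using p'(2) M'(2) by auto
    hence "multiplicity p' (p ^ v) = 0" using p(1) p'(1) by (intro not_dvd_imp_multiplicity_0) (metis prime_dvd_power primes_dvd_imp_eq)
    hence "multiplicity p' M = multiplicity p' M'"
      unfolding M'(1) using p'(1) M'1 pv prime_gt_0_nat[OF p(1)] by (subst prime_elem_multiplicity_mult_distrib) auto
    moreover have "p' dvd M" using p'(2) M'(1) by simp
    ultimately show ?thesis using less.prems(1) p' by metis
  qed
qed

text \<open>
  For \<open>A x = \<Sum>i. a (p ^ i) x ^ i\<close> and \<open>B x = \<Sum>i. b (p ^ i) x ^ i\<close> the recursion says \<open>A' = A B'\<close>. Hence \<open>A\<close> is a
  constant times \<open>exp B\<close> in the disc of radius \<open>p powr (- \<theta>)\<close>, where \<open>B\<close> converges, and has no zero there. So all roots of the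
  polynomial \<open>A\<close> of degree \<open>v\<close> have norm at least \<open>p powr (- \<theta>)\<close>, and their product is the quotient of the constant
  term 1 and the leading coefficient, up to sign.
\<close>
lemma local_factor_small:
  fixes a b :: "nat \<Rightarrow> complex" and c \<theta> :: real
  assumes p: "prime p" and v: "\<And>i. i > v \<Longrightarrow> a (p ^ i) = 0" "a (p ^ v) \<noteq> 0" and a1: "a 1 = 1"
    and rec: "\<And>k. k \<ge> 1 \<Longrightarrow> a k * of_real (ln k) = (\<Sum>d | d dvd k. a (k div d) * b d * of_real (ln d))"
    and bb: "\<And>j. j \<ge> 1 \<Longrightarrow> norm (b j) \<le> c * real j powr \<theta>"
  shows "norm (a (p ^ v)) \<le> (real p powr \<theta>) ^ v"
proof -
  define A where "A = (\<Sum>i\<le>v. monom (a (p ^ i)) i)"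
  define B where "B = Abs_fps (\<lambda>i. b (p ^ i))"
  have p1: "real p > 1" using prime_gt_1_nat[OF p] by simp
  have cA: "coeff A i = a (p ^ i)" for i
    using v(1)[of i] by (simp add: A_def coeff_sum sum.If_cases not_le split: if_splits)
  define \<rho> where "\<rho> = real p powr (- \<theta>)"
  have \<rho>0: "\<rho> > 0" using p1 by (simp add: \<rho>_def)
  have ode: "fps_deriv (fps_of_poly A) = fps_of_poly A * fps_deriv B"
  proof (rule fps_ext)
    fix n
    have lnp: "ln (real p) \<noteq> 0" using p1 by auto
    have divs: "{d. d dvd p ^ Suc n} = (\<lambda>i. p ^ i) ` {..Suc n}"
      using divides_primepow_nat[OF p, of _ "Suc n"] by (auto simp: image_iff atMost_def)
    have inj: "inj_on (\<lambda>i. p ^ i) {..Suc n}"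
      using prime_gt_1_nat[OF p] by (auto intro!: inj_onI dest: power_inject_exp[THEN iffD1, rotated])
    have "a (p ^ Suc n) * of_real (ln (real (p ^ Suc n))) = (\<Sum>d | d dvd p ^ Suc n. a (p ^ Suc n div d) * b d * of_real (ln d))"
      by (rule rec) (use prime_gt_0_nat[OF p] in \<open>simp add: Suc_le_eq del: power_Suc\<close>)
    also have "\<dots> = (\<Sum>i\<le>Suc n. a (p ^ Suc n div p ^ i) * b (p ^ i) * of_real (ln (real (p ^ i))))"
      unfolding divs by (subst sum.reindex[OF inj]) simp
    also have "\<dots> = (\<Sum>i\<le>Suc n. a (p ^ (Suc n - i)) * b (p ^ i) * (of_nat i * of_real (ln p)))"
    proof (rule sum.cong)
      fix i assume i: "i \<in> {..Suc n}"
      have "p ^ Suc n div p ^ i = p ^ (Suc n - i)" using i prime_gt_0_nat[OF p] by (intro power_diff[symmetric]) auto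
      thus "a (p ^ Suc n div p ^ i) * b (p ^ i) * of_real (ln (real (p ^ i))) = a (p ^ (Suc n - i)) * b (p ^ i) * (of_nat i * of_real (ln p))"
        using p1 by (simp add: ln_realpow)
    qed simp
    also have "\<dots> = (\<Sum>i\<le>n. a (p ^ (n - i)) * b (p ^ Suc i) * (of_nat (Suc i) * of_real (ln p)))"
      by (subst sum.atMost_Suc_shift) simp
    also have "\<dots> = (\<Sum>i\<le>n. a (p ^ (n - i)) * (of_nat (Suc i) * b (p ^ Suc i))) * of_real (ln p)"
      unfolding sum_distrib_right by (rule sum.cong) (simp_all only: mult_ac)
    also have "a (p ^ Suc n) * of_real (ln (real (p ^ Suc n))) = a (p ^ Suc n) * of_nat (Suc n) * of_real (ln p)"
      using ln_realpow[of "real p" "Suc n"] p1 by (simp del: power_Suc of_nat_Suc)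
    finally have "(a (p ^ Suc n) * of_nat (Suc n)) * of_real (ln p) = (\<Sum>i\<le>n. a (p ^ (n - i)) * (of_nat (Suc i) * b (p ^ Suc i))) * of_real (ln p)" .
    hence "a (p ^ Suc n) * of_nat (Suc n) = (\<Sum>i\<le>n. a (p ^ (n - i)) * (of_nat (Suc i) * b (p ^ Suc i)))"
      using lnp by simp
    also have "\<dots> = (\<Sum>i\<le>n. a (p ^ i) * (of_nat (Suc (n - i)) * b (p ^ Suc (n - i))))"
      by (subst sum.nat_diff_reindex[symmetric, of _ "Suc n", unfolded lessThan_Suc_atMost]) (auto intro!: sum.cong)
    finally have "a (p ^ Suc n) * of_nat (Suc n) = (\<Sum>i\<le>n. a (p ^ i) * (of_nat (Suc (n - i)) * b (p ^ Suc (n - i))))" .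
    thus "fps_nth (fps_deriv (fps_of_poly A)) n = fps_nth (fps_of_poly A * fps_deriv B) n"
    proof -
      have "fps_nth (fps_deriv (fps_of_poly A)) n = of_nat (Suc n) * a (p ^ Suc n)"
        by (simp add: cA del: power_Suc of_nat_Suc)
      moreover have "fps_nth (fps_of_poly A * fps_deriv B) n = (\<Sum>i\<le>n. a (p ^ i) * (of_nat (Suc (n - i)) * b (p ^ Suc (n - i))))"
        by (simp add: fps_mult_nth atLeast0AtMost cA B_def del: power_Suc of_nat_Suc)
      ultimately show ?thesis
        using \<open>a (p ^ Suc n) * of_nat (Suc n) = (\<Sum>i\<le>n. a (p ^ i) * (of_nat (Suc (n - i)) * b (p ^ Suc (n - i))))\<close>
        by (simp only: mult.commute)
    qed
  qed
  have rad: "fps_conv_radius B \<ge> ereal \<rho>"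
    unfolding fps_conv_radius_def
  proof (rule conv_radius_geI_ex)
    fix r :: real assume r: "r > 0" "ereal r < ereal \<rho>"
    have "summable (\<lambda>i. c * (r / \<rho>) ^ i)"
      using r \<rho>0 by (intro summable_mult summable_geometric) auto
    moreover have "norm (fps_nth B i * of_real r ^ i) \<le> c * (r / \<rho>) ^ i" for i
    proof -
      have "real (p ^ i) powr \<theta> = (1 / \<rho>) ^ i"
      proof -
        have "real (p ^ i) powr \<theta> = (real p powr real i) powr \<theta>" using p1 by (simp add: powr_realpow)
        also have "\<dots> = (real p powr \<theta>) powr real i" by (simp add: powr_powr mult.commute)
        also have "\<dots> = (real p powr \<theta>) ^ i" using p1 by (simp add: powr_realpow)
        also have "real p powr \<theta> = 1 / \<rho>" by (simp add: \<rho>_def powr_minus_divide)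
        finally show ?thesis .
      qed
      hence "norm (b (p ^ i)) \<le> c * (1 / \<rho>) ^ i" using bb[of "p ^ i"] prime_gt_0_nat[OF p] by simp
      hence "norm (b (p ^ i)) * r ^ i \<le> c * (1 / \<rho>) ^ i * r ^ i" using r by (intro mult_right_mono) auto
      thus ?thesis using r by (simp add: B_def norm_mult norm_power power_divide)
    qed
    ultimately have "summable (\<lambda>i. fps_nth B i * of_real r ^ i)" by (rule summable_comparison_test'[where N = 0])
    thus "\<exists>z. norm z = r \<and> summable (\<lambda>i. fps_nth B i * z ^ i)" using r by (intro exI[of _ "of_real r"]) auto
  qed
  have noroot: "norm x \<ge> \<rho>" if root: "poly A x = 0" for x
  proof (rule ccontr)
    assume "\<not> norm x \<ge> \<rho>"
    hence x: "norm x < \<rho>" by simp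
    define W where "W = (\<lambda>z. poly A z * exp (- eval_fps B z))"
    have inr: "ereal (norm z) < fps_conv_radius B" if "norm z < \<rho>" for z
      using that rad by (meson ereal_less_eq(3) less_ereal.simps(1) order_less_le_trans)
    have "(W has_field_derivative 0) (at z within ball 0 \<rho>)" if z: "z \<in> ball 0 \<rho>" for z
    proof -
      have zB: "ereal (norm z) < fps_conv_radius B" using inr z by simp
      have dB: "(eval_fps B has_field_derivative eval_fps (fps_deriv B) z) (at z within ball 0 \<rho>)"
        by (rule has_field_derivative_eval_fps[OF zB])
      have "poly (pderiv A) z = eval_fps (fps_deriv (fps_of_poly A)) z" by (simp add: fps_of_poly_pderiv[symmetric])
      also have "\<dots> = poly A z * eval_fps (fps_deriv B) z"
        unfolding ode using zB less_le_trans[OF zB fps_conv_radius_deriv] by (subst eval_fps_mult) auto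
      finally have dA: "poly (pderiv A) z = poly A z * eval_fps (fps_deriv B) z" .
      show ?thesis unfolding W_def
        by (rule derivative_eq_intros dB poly_DERIV[THEN DERIV_subset] refl subset_UNIV | simp add: dA)+
    qed
    then obtain w where "\<And>z. z \<in> ball 0 \<rho> \<Longrightarrow> W z = w"
      using has_field_derivative_zero_constant[OF convex_ball, of 0 \<rho> W] by blast
    hence "W x = W 0" using x \<rho>0 by simp
    moreover have "poly A 0 = 1" using cA[of 0] a1 by (simp add: poly_0_coeff_0)
    ultimately show False using root by (simp add: W_def)
  qed
  have deg: "degree A = v"
  proof (rule antisym)
    show "degree A \<le> v" by (rule degree_le) (use cA v in auto)
    show "v \<le> degree A" by (rule le_degree) (use cA v in auto)
  qed
  have "norm (lead_coeff A) * \<rho> ^ degree A \<le> norm (coeff A 0)"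
    by (rule poly_lead_le_of_roots) (use noroot \<rho>0 in auto)
  hence "norm (a (p ^ v)) * \<rho> ^ v \<le> 1" using cA a1 deg by simp
  moreover have "\<rho> * real p powr \<theta> = 1" using p1 by (simp add: \<rho>_def flip: powr_add)
  hence "\<rho> ^ v * (real p powr \<theta>) ^ v = 1" by (metis power_mult_distrib power_one)
  ultimately have "norm (a (p ^ v)) * (\<rho> ^ v * (real p powr \<theta>) ^ v) \<le> 1 * (real p powr \<theta>) ^ v"
    unfolding mult.assoc[symmetric] by (intro mult_right_mono) auto
  thus ?thesis using \<open>\<rho> ^ v * _ = 1\<close> by simp
qed

text \<open>
  Multiplication of a Dirichlet series by \<open>m powr (- s)\<close> moves the coefficient at \<open>j\<close> to \<open>m * j\<close>.
\<close>
lemma sums_dilate: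
  fixes \<beta> :: "nat \<Rightarrow> complex"
  assumes m: "m \<ge> 1" and B: "(\<lambda>j. \<beta> (Suc j) * of_nat (Suc j) powr (- s)) sums B"
  shows "(\<lambda>i. (if m dvd Suc i then \<beta> (Suc i div m) else 0) * of_nat (Suc i) powr (- s)) sums (of_nat m powr (- s) * B)"
proof -
  define g where "g = (\<lambda>j. m * Suc j - 1)"
  have g: "Suc (g j) = m * Suc j" for j using m by (simp add: g_def)
  have "strict_mono g"
  proof (rule strict_monoI)
    fix i j :: nat assume "i < j"
    hence "Suc (g i) < Suc (g j)" unfolding g using m by simp
    thus "g i < g j" by simp
  qed
  moreover have "(if m dvd Suc i then \<beta> (Suc i div m) else 0) * of_nat (Suc i) powr (- s) = 0" if "i \<notin> range g" for i
  proof -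
    have "\<not> m dvd Suc i"
    proof
      assume "m dvd Suc i"
      then obtain k where k: "Suc i = m * k" by (elim dvdE)
      hence "k > 0" by (cases k) auto
      then obtain j where "k = Suc j" by (cases k) auto
      hence "Suc i = Suc (g j)" using k g by simp
      thus False using that by auto
    qed
    thus ?thesis by simp
  qed
  ultimately have iff: "(\<lambda>j. (if m dvd Suc (g j) then \<beta> (Suc (g j) div m) else 0) * of_nat (Suc (g j)) powr (- s)) sums (of_nat m powr (- s) * B) \<longleftrightarrow>
     (\<lambda>i. (if m dvd Suc i then \<beta> (Suc i div m) else 0) * of_nat (Suc i) powr (- s)) sums (of_nat m powr (- s) * B)"
    by (rule sums_mono_reindex)
  have eq: "(if m dvd Suc (g j) then \<beta> (Suc (g j) div m) else 0) * of_nat (Suc (g j)) powr (- s) =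
      of_nat m powr (- s) * (\<beta> (Suc j) * of_nat (Suc j) powr (- s))" for j
  proof -
    have 1: "of_nat (m * Suc j) powr (- s) = (of_nat m powr (- s) * of_nat (Suc j) powr (- s) :: complex)"
      unfolding of_nat_mult by (rule powr_times_real) simp_all
    have 2: "m * Suc j div m = Suc j" using m by simp
    show ?thesis unfolding g 1 2 by (simp only: dvd_triv_left if_True mult_ac)
  qed
  show ?thesis unfolding iff[symmetric] eq by (rule sums_mult[OF B])
qed

lemma has_field_derivative_nat_powr:
  assumes "n > 0"
  shows "((\<lambda>s. of_nat n powr (- s)) has_field_derivative
     - (of_real (ln (real n)) * of_nat n powr (- z :: complex))) (at z)"
proof -
  have n: "(of_nat n :: complex) \<noteq> 0" using assms by simp
  have "((\<lambda>s. of_nat n powr (- s)) has_field_derivative (Ln (of_nat n) * of_nat n powr (- z)) * (- 1)) (at z)"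
    by (rule DERIV_chain2[OF has_field_derivative_powr_right[OF n]]) (auto intro!: derivative_eq_intros)
  thus ?thesis using assms by (simp add: Ln_of_nat)
qed

lemma deriv_dirichlet_series:
  fixes b :: "nat \<Rightarrow> complex"
  assumes c: "\<And>j. j \<ge> 1 \<Longrightarrow> norm (b j) \<le> c * real j"
    and l: "\<And>s. Re s > 1 \<Longrightarrow> (\<lambda>j. b (Suc j) * of_nat (Suc j) powr (- s)) sums l s"
    and s: "Re s > 4"
  shows "l field_differentiable (at s)"
    "(\<lambda>j. (b (Suc j) * of_real (ln (real (Suc j)))) * of_nat (Suc j) powr (- s)) sums (- deriv l s)"
proof -
  obtain D where D: "D \<ge> 0" "\<And>s l N. Re s \<ge> 3 \<Longrightarrow> (\<lambda>j. b (Suc j) * of_nat (Suc j) powr (- s)) sums l \<Longrightarrow>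
       norm (l - (\<Sum>j<N. b (Suc j) * of_nat (Suc j) powr (- s))) \<le> D * real (Suc N) powr (3 - Re s)"
    using dirichlet_tail[OF c] by blast
  define U where "U = {s. Re s > 4}"
  have U: "open U" "s \<in> U" using s by (auto simp: U_def open_halfspace_Re_gt)
  define f where "f = (\<lambda>n s. \<Sum>j<n. b (Suc j) * of_nat (Suc j) powr (- s))"
  have fd: "(f n has_field_derivative (\<Sum>j<n. - (b (Suc j) * of_real (ln (real (Suc j))) * of_nat (Suc j) powr (- z)))) (at z)" for n z
  proof -
    have "((\<lambda>s. b (Suc j) * of_nat (Suc j) powr (- s)) has_field_derivative
       - (b (Suc j) * of_real (ln (real (Suc j))) * of_nat (Suc j) powr (- z))) (at z)" for j
      using DERIV_cmult[OF has_field_derivative_nat_powr[of "Suc j" z], of "b (Suc j)"]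
      by (simp only: mult_minus_right mult.assoc)
    thus ?thesis unfolding f_def by (intro DERIV_sum)
  qed
  have lim: "uniform_limit U f l sequentially"
  proof (rule uniform_limitI)
    fix e :: real assume e: "e > 0"
    have "eventually (\<lambda>n. D / real (Suc n) < e) sequentially"
    proof (rule order_tendstoD)
      show "(\<lambda>n. D / real (Suc n)) \<longlonglongrightarrow> 0"
        using tendsto_mult[OF tendsto_const[of D] LIMSEQ_inverse_real_of_nat] unfolding divide_inverse by simp
    qed (rule e)
    thus "eventually (\<lambda>n. \<forall>x\<in>U. dist (f n x) (l x) < e) sequentially"
    proof eventually_elim
      case (elim n)
      show ?case
      proof
        fix x assume x: "x \<in> U"
        have "norm (l x - f n x) \<le> D * real (Suc n) powr (3 - Re x)"
          using D(2)[OF _ l, of x n] x by (simp add: U_def f_def)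
        also have "\<dots> \<le> D * real (Suc n) powr (-1)" using x D(1) by (intro mult_left_mono powr_mono) (auto simp: U_def)
        also have "\<dots> = D / real (Suc n)" by (simp add: powr_minus_divide)
        finally show "dist (f n x) (l x) < e" using elim by (simp add: dist_norm norm_minus_commute)
      qed
    qed
  qed
  have holf: "f n holomorphic_on U" for n
    unfolding holomorphic_on_def field_differentiable_def
    using has_field_derivative_at_within[OF fd] by blast
  have "l holomorphic_on U"
  proof (rule holomorphic_uniform_sequence[OF U(1) holf])
    fix x assume "x \<in> U"
    then obtain d where "d > 0" "cball x d \<subseteq> U" using U(1) open_contains_cball by blast
    thus "\<exists>d>0. cball x d \<subseteq> U \<and> uniform_limit (cball x d) f l sequentially"
      using uniform_limit_on_subset[OF lim] by blast
  qed
  thus "l field_differentiable (at s)" using U holomorphic_on_imp_differentiable_at by blast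
  have "(\<lambda>n. deriv (f n) s) \<longlonglongrightarrow> deriv l s"
    by (rule deriv_complex_uniform_limit[OF lim _ _ U]) (auto intro: always_eventually holf)
  hence "(\<lambda>n. - deriv (f n) s) \<longlonglongrightarrow> - deriv l s" by (rule tendsto_minus)
  moreover have "- deriv (f n) s = (\<Sum>j<n. (b (Suc j) * of_real (ln (real (Suc j)))) * of_nat (Suc j) powr (- s))" for n
    using DERIV_imp_deriv[OF fd[of n s]] by (simp add: sum_negf)
  ultimately show "(\<lambda>j. (b (Suc j) * of_real (ln (real (Suc j)))) * of_nat (Suc j) powr (- s)) sums (- deriv l s)"
    unfolding sums_def by simp
qed

text \<open>
  Compare coefficients in \<open>L' = L l'\<close>, where \<open>l\<close> is the Dirichlet series with coefficients \<open>b\<close> and \<open>exp l = L\<close>. As \<open>L\<close> is a Dirichlet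
  polynomial, the product is a finite sum of dilated series, so no rearrangement of double series is needed. Uniqueness
  of coefficients holds because a non-trivial Dirichlet series does not vanish far to the right.
\<close>
lemma log_recursion:
  fixes L :: "complex \<Rightarrow> complex" and a b :: "nat \<Rightarrow> complex"
  assumes La: "\<And>s. L s = (\<Sum>j<N. a (Suc j) * of_nat (Suc j) powr (- s))" and a0: "\<And>j. j > N \<Longrightarrow> a j = 0"
    and b: "\<And>j. j \<ge> 1 \<Longrightarrow> norm (b j) \<le> c * real j powr \<theta>" and \<theta>: "\<theta> \<le> 1 / 2"
    and l: "\<And>s. Re s > 1 \<Longrightarrow> (\<lambda>j. b (Suc j) * of_nat (Suc j) powr (- s)) sums l s \<and> exp (l s) = L s"
    and k: "k \<ge> 1"
  shows "a k * of_real (ln (real k)) = (\<Sum>d | d dvd k. a (k div d) * b d * of_real (ln (real d)))"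
proof -
  have c0: "c \<ge> 0" using order_trans[OF norm_ge_zero b[of 1]] by simp
  have bl: "norm (b j) * real j powr (1/2) \<le> c * real j" if j: "j \<ge> 1" for j
  proof -
    have "norm (b j) * real j powr (1/2) \<le> (c * real j powr \<theta>) * real j powr (1/2)" using b[OF j] by (intro mult_right_mono) auto
    also have "\<dots> \<le> (c * real j powr (1/2)) * real j powr (1/2)"
      using c0 j \<theta> by (intro mult_right_mono mult_left_mono powr_mono) auto
    also have "\<dots> = c * (real j powr (1/2) * real j powr (1/2))" by (simp only: mult.assoc)
    also have "real j powr (1/2) * real j powr (1/2) = real j" by (simp add: powr_half_sqrt)
    finally show ?thesis .
  qed
  have b1: "norm (b j) \<le> c * real j" if j: "j \<ge> 1" for j
  proof -
    have "1 \<le> real j powr (1/2)" using j by (intro ge_one_powr_ge_zero) auto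
    hence "norm (b j) * 1 \<le> norm (b j) * real j powr (1/2)" by (intro mult_left_mono) auto
    thus ?thesis using bl[OF j] by simp
  qed
  define \<beta> where "\<beta> = (\<lambda>j. b j * of_real (ln (real j)))"
  have \<beta>b: "norm (\<beta> j) \<le> 2 * c * real j" if j: "j \<ge> 1" for j
  proof -
    have "ln (real j) = 2 * ln (real j powr (1/2))" using j by (simp add: ln_powr)
    also have "\<dots> \<le> 2 * real j powr (1/2)"
    proof -
      have "real j powr (1/2) > 0" using j by simp
      thus ?thesis using ln_le_minus_one[of "real j powr (1/2)"] by linarith
    qed
    finally have "norm (b j) * ln (real j) \<le> norm (b j) * (2 * real j powr (1/2))" by (intro mult_left_mono) auto
    moreover have "ln (real j) \<ge> 0" using j by simp
    ultimately have "norm (\<beta> j) \<le> norm (b j) * (2 * real j powr (1/2))" by (simp add: \<beta>_def norm_mult)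
    also have "\<dots> = 2 * (norm (b j) * real j powr (1/2))" by (simp only: mult_ac)
    finally show ?thesis using bl[OF j] by linarith
  qed
  \<comment> \<open>\<open>e k\<close> is the coefficient of \<open>L' - L l'\<close> at \<open>k\<close>\<close>
  define e where "e = (\<lambda>k. (\<Sum>m\<in>{1..N}. a m * (if m dvd k then \<beta> (k div m) else 0)) - a k * of_real (ln (real k)))"
  have sums0: "(\<lambda>i. e (Suc i) * of_nat (Suc i) powr (- s)) sums 0" if s: "Re s > 4" for s
  proof -
    have lsum: "\<And>s. Re s > 1 \<Longrightarrow> (\<lambda>j. b (Suc j) * of_nat (Suc j) powr (- s)) sums l s" using l by blast
    have B: "(\<lambda>j. \<beta> (Suc j) * of_nat (Suc j) powr (- s)) sums (- deriv l s)"
      unfolding \<beta>_def using deriv_dirichlet_series(2)[OF b1 lsum s] by simp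
    have ld: "(l has_field_derivative deriv l s) (at s)"
      using deriv_dirichlet_series(1)[OF b1 lsum s] by (simp add: DERIV_deriv_iff_field_differentiable)
    have ev: "eventually (\<lambda>z. exp (l z) = L z) (nhds s)"
    proof -
      have "open {z. Re z > 1}" by (simp add: open_halfspace_Re_gt)
      hence "eventually (\<lambda>z. z \<in> {z. Re z > 1}) (nhds s)" by (rule eventually_nhds_in_open) (use s in simp)
      thus ?thesis by eventually_elim (use l in auto)
    qed
    have "((\<lambda>z. exp (l z)) has_field_derivative exp (l s) * deriv l s) (at s)"
      by (rule DERIV_chain2[OF DERIV_exp ld])
    hence "(L has_field_derivative exp (l s) * deriv l s) (at s)"
      using DERIV_cong_ev[OF refl ev refl] by simp
    hence D1: "(L has_field_derivative L s * deriv l s) (at s)" using l[of s] s by simp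
    have "((\<lambda>s. \<Sum>j<N. a (Suc j) * of_nat (Suc j) powr (- s)) has_field_derivative
        (\<Sum>j<N. - (a (Suc j) * of_real (ln (real (Suc j))) * of_nat (Suc j) powr (- s)))) (at s)"
    proof (intro DERIV_sum)
      fix j
      show "((\<lambda>s. a (Suc j) * of_nat (Suc j) powr (- s)) has_field_derivative
          - (a (Suc j) * of_real (ln (real (Suc j))) * of_nat (Suc j) powr (- s))) (at s)"
        using DERIV_cmult[OF has_field_derivative_nat_powr[of "Suc j" s], of "a (Suc j)"]
        by (simp only: mult_minus_right mult.assoc)
    qed
    hence D2: "(L has_field_derivative (\<Sum>j<N. - (a (Suc j) * of_real (ln (real (Suc j))) * of_nat (Suc j) powr (- s)))) (at s)"
      using La by presburger
    have A1: "(\<Sum>j<N. a (Suc j) * of_real (ln (real (Suc j))) * of_nat (Suc j) powr (- s)) = L s * (- deriv l s)"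
      using DERIV_unique[OF D1 D2] by (simp add: sum_negf)
    have fin: "(\<lambda>i. a (Suc i) * of_real (ln (real (Suc i))) * of_nat (Suc i) powr (- s)) sums (L s * (- deriv l s))"
      unfolding A1[symmetric] by (rule sums_finite) (auto simp: a0)
    have "(\<lambda>i. \<Sum>m\<in>{1..N}. a m * ((if m dvd Suc i then \<beta> (Suc i div m) else 0) * of_nat (Suc i) powr (- s)))
        sums (\<Sum>m\<in>{1..N}. a m * (of_nat m powr (- s) * (- deriv l s)))"
      by (intro sums_sum sums_mult sums_dilate B) auto
    also have "(\<Sum>m\<in>{1..N}. a m * (of_nat m powr (- s) * (- deriv l s))) = (\<Sum>m\<in>{1..N}. a m * of_nat m powr (- s)) * (- deriv l s)"
      by (simp only: sum_distrib_right mult.assoc)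
    also have "(\<Sum>m\<in>{1..N}. a m * of_nat m powr (- s)) = L s"
      unfolding La by (rule sum.reindex_bij_witness[of _ Suc "\<lambda>m. m - 1"]) auto
    finally have "(\<lambda>i. \<Sum>m\<in>{1..N}. a m * ((if m dvd Suc i then \<beta> (Suc i div m) else 0) * of_nat (Suc i) powr (- s))) sums (L s * (- deriv l s))" .
    from sums_diff[OF this fin] show ?thesis
      by (simp add: e_def sum_distrib_right mult.assoc left_diff_distrib del: of_nat_Suc)
  qed
  define S where "S = (\<Sum>m\<in>{1..N}. norm (a m))"
  have S0: "S \<ge> 0" by (simp add: S_def sum_nonneg)
  have eb: "norm (e j) \<le> (S * (2 * c) + S) * real j" if j: "j \<ge> 1" for j
  proof -
    have 1: "norm (\<Sum>m\<in>{1..N}. a m * (if m dvd j then \<beta> (j div m) else 0)) \<le> (\<Sum>m\<in>{1..N}. norm (a m) * (2 * c * real j))"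
    proof (rule order_trans[OF norm_sum sum_mono])
      fix m assume m: "m \<in> {1..N}"
      have "norm (if m dvd j then \<beta> (j div m) else 0) \<le> 2 * c * real j"
      proof (cases "m dvd j")
        case True
        have "j div m \<ge> 1" using True j m by (auto simp: Suc_le_eq div_greater_zero_iff dvd_imp_le)
        hence "norm (\<beta> (j div m)) \<le> 2 * c * real (j div m)" by (rule \<beta>b)
        also have "\<dots> \<le> 2 * c * real j" using c0 by (intro mult_left_mono) auto
        finally show ?thesis using True by simp
      qed (use c0 in simp)
      thus "norm (a m * (if m dvd j then \<beta> (j div m) else 0)) \<le> norm (a m) * (2 * c * real j)"
        unfolding norm_mult by (rule mult_left_mono) simp
    qed
    have 2: "norm (a j * of_real (ln (real j))) \<le> S * real j"
    proof -
      have "norm (a j) \<le> S"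
      proof (cases "j \<le> N")
        case True thus ?thesis unfolding S_def using j by (intro member_le_sum) auto
      qed (use a0 S0 in simp)
      moreover have "\<bar>ln (real j)\<bar> \<le> real j" using j ln_le_minus_one[of "real j"] by simp
      ultimately show ?thesis unfolding norm_mult norm_of_real by (intro mult_mono S0) auto
    qed
    have "norm (e j) \<le> norm (\<Sum>m\<in>{1..N}. a m * (if m dvd j then \<beta> (j div m) else 0)) + norm (a j * of_real (ln (real j)))"
      unfolding e_def by (rule norm_triangle_ineq4)
    also have "\<dots> \<le> (\<Sum>m\<in>{1..N}. norm (a m) * (2 * c * real j)) + S * real j" using 1 2 by linarith
    also have "\<dots> = (S * (2 * c) + S) * real j" unfolding sum_distrib_right[symmetric] S_def[symmetric] by (simp add: algebra_simps)
    finally show ?thesis .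
  qed
  have "e k = 0"
  proof (rule ccontr)
    assume "e k \<noteq> 0"
    hence ex: "\<exists>j\<ge>1. e j \<noteq> 0" using k by blast
    show False
    proof (rule dirichlet_series_ln_norm_bound[OF eb ex])
      fix \<sigma>0 K assume *: "\<And>s l. Re s \<ge> \<sigma>0 \<Longrightarrow> (\<lambda>j. e (Suc j) * of_nat (Suc j) powr (- s)) sums l \<Longrightarrow> l \<noteq> 0 \<and> \<bar>ln (norm l)\<bar> \<le> K * Re s"
      define s where "s = complex_of_real (max \<sigma>0 5)"
      have "Re s \<ge> \<sigma>0" "Re s > 4" by (auto simp: s_def)
      from *[OF this(1) sums0[OF this(2)]] show False by simp
    qed
  qed
  hence "a k * of_real (ln (real k)) = (\<Sum>m\<in>{1..N}. a m * (if m dvd k then \<beta> (k div m) else 0))" by (simp add: e_def)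
  also have "\<dots> = (\<Sum>m\<in>{m\<in>{1..N}. m dvd k}. a m * \<beta> (k div m))"
    by (rule sum.mono_neutral_cong_right) auto
  also have "\<dots> = (\<Sum>m | m dvd k. a m * \<beta> (k div m))"
  proof (rule sum.mono_neutral_left)
    show "finite {m. m dvd k}" using k by (intro finite_divisors_nat) auto
    show "\<forall>m\<in>{m. m dvd k} - {m \<in> {1..N}. m dvd k}. a m * \<beta> (k div m) = 0"
    proof
      fix m assume m: "m \<in> {m. m dvd k} - {m \<in> {1..N}. m dvd k}"
      hence "m \<noteq> 0" using k by auto
      hence "m > N" using m by auto
      thus "a m * \<beta> (k div m) = 0" by (simp add: a0)
    qed
  qed auto
  also have "\<dots> = (\<Sum>d | d dvd k. a (k div d) * \<beta> d)"
    by (rule sum.reindex_bij_witness[of _ "\<lambda>d. k div d" "\<lambda>d. k div d"]) (use k in \<open>auto simp: div_div_eq_right dvd_div_eq_mult\<close>)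
  finally show ?thesis by (simp add: \<beta>_def mult.assoc)
qed

text \<open>
  \<open>L\<close> is a Dirichlet polynomial with coefficients \<open>a j\<close>; let \<open>M\<close> be the last index with \<open>a M \<noteq> 0\<close>. For \<open>x \<rightarrow> \<infinity>\<close>, \<open>|L (- x)|\<close> behaves like
  \<open>|a M| M powr x\<close> and, by the functional equation, like \<open>Q powr (1 + 2 x)\<close>. Hence \<open>M = Q\<^sup>2\<close> and \<open>|a M| = sqrt M\<close>. If
  \<open>M \<ge> 2\<close>, some local factor \<open>p ^ v\<close> of \<open>M\<close> has \<open>|a (p ^ v)| \<ge> sqrt (p ^ v)\<close>, whereas \<open>\<theta> < 1/2\<close> forces
  \<open>|a (p ^ v)| \<le> (p powr \<theta>) ^ v < sqrt (p ^ v)\<close>.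
\<close>
lemma degree_zero_constant:
  assumes L: "L_function L" and Q: "Q > 0" and \<omega>: "norm \<omega> = 1"
    and fe: "\<forall>s. completed_L L Q 0 \<mu> \<nu> s = \<omega> * cnj (completed_L L Q 0 \<mu> \<nu> (1 - cnj s))"
  shows "L constant_on UNIV"
proof (rule ccontr)
  assume nc: "\<not> L constant_on UNIV"
  have eq: "norm (L s) = norm (L (1 - cnj s)) * Q powr (1 - 2 * Re s)" if "s \<noteq> 0" "s \<noteq> 1" for s
    by (rule degree_zero_entire(2)[OF L Q \<omega> fe that])
  obtain N a0 where La0: "\<And>s. L s = (\<Sum>j<N. a0 (Suc j) * of_nat (Suc j) powr (- s))"
    using degree_zero_dirichlet_polynomial[OF L Q \<omega> fe] by metis
  define a where "a = (\<lambda>j. if 1 \<le> j \<and> j \<le> N then a0 j else 0)"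
  have La: "L s = (\<Sum>j<N. a (Suc j) * of_nat (Suc j) powr (- s))" for s
    unfolding La0 by (rule sum.cong) (auto simp: a_def)
  have aN: "a j = 0" if "j > N" for j using that by (simp add: a_def)
  define J where "J = {j. a j \<noteq> 0}"
  have J: "finite J" "J \<subseteq> {1..N}" by (rule finite_subset[of _ "{1..N}"]) (auto simp: J_def a_def)
  have "J \<noteq> {}"
  proof
    assume "J = {}"
    hence "L s = 0" for s unfolding La by (auto simp: J_def)
    thus False using nc by (auto simp: constant_on_def)
  qed
  define M where "M = Max J"
  have MJ: "M \<in> J" unfolding M_def using J(1) \<open>J \<noteq> {}\<close> by (rule Max_in)
  have M1: "M \<ge> 1" "M \<le> N" "a M \<noteq> 0" using MJ J(2) by (auto simp: J_def)
  have aM0: "a j = 0" if "j > M" for j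
  proof (rule ccontr)
    assume "a j \<noteq> 0"
    hence "j \<le> M" unfolding M_def using J(1) by (intro Max_ge) (auto simp: J_def)
    thus False using that by simp
  qed
  have decay: "((\<lambda>x::real. t powr x) \<longlongrightarrow> 0) at_top" if "0 < t" "t < 1" for t :: real
    using that by (rule powr_tendsto_0)
  have L1: "((\<lambda>x::real. L (of_real x)) \<longlongrightarrow> 1) at_top"
  proof (rule tendstoI)
    fix e :: real assume "e > 0"
    then obtain \<sigma>1 where "\<And>s. Re s \<ge> \<sigma>1 \<Longrightarrow> norm (L s - 1) < e" using L_function_tends_1[OF L] by metis
    thus "eventually (\<lambda>x. dist (L (of_real x)) 1 < e) at_top"
      by (intro eventually_mono[OF eventually_ge_at_top[of \<sigma>1]]) (auto simp: dist_norm)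
  qed
  have npow: "norm (of_nat (Suc j) powr (- of_real x) :: complex) = real (Suc j) powr (- x)" for j x
    by (subst norm_powr_real_powr) auto
  have a1: "a 1 = 1"
  proof -
    have "((\<lambda>x::real. \<Sum>j<N. a (Suc j) * of_nat (Suc j) powr (- of_real x)) \<longlongrightarrow> (\<Sum>j<N. if j = 0 then a 1 else 0)) at_top"
    proof (rule tendsto_sum)
      fix j
      show "((\<lambda>x::real. a (Suc j) * of_nat (Suc j) powr (- of_real x)) \<longlongrightarrow> (if j = 0 then a 1 else 0)) at_top"
      proof (cases "j = 0")
        case False
        have "((\<lambda>x. (1 / real (Suc j)) powr x) \<longlongrightarrow> 0) at_top" using False by (intro decay) auto
        hence "((\<lambda>x. real (Suc j) powr (- x)) \<longlongrightarrow> 0) at_top" by (simp add: powr_minus_divide powr_divide)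
        hence "((\<lambda>x. norm (of_nat (Suc j) powr (- of_real x) :: complex)) \<longlongrightarrow> 0) at_top" unfolding npow .
        hence "((\<lambda>x::real. of_nat (Suc j) powr (- of_real x) :: complex) \<longlongrightarrow> 0) at_top" by (rule tendsto_norm_zero_cancel)
        from tendsto_mult[OF tendsto_const this, of "a (Suc j)"] show ?thesis using False by simp
      qed simp
    qed
    hence "((\<lambda>x::real. L (of_real x)) \<longlongrightarrow> (\<Sum>j<N. if j = 0 then a 1 else 0)) at_top" unfolding La .
    hence "(\<Sum>j<N. if j = 0 then a 1 else 0) = 1"
      using L1 tendsto_unique[OF trivial_limit_at_top_linorder] by blast
    thus ?thesis using M1 by (simp add: sum.delta split: if_splits)
  qed
  have left: "((\<lambda>x::real. norm (L (- of_real x)) / real M powr x) \<longlongrightarrow> norm (a M)) at_top"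
  proof -
    have "((\<lambda>x::real. \<Sum>j<N. a (Suc j) * of_real ((real (Suc j) / real M) powr x)) \<longlongrightarrow> (\<Sum>j<N. if j = M - 1 then a M else 0)) at_top"
    proof (rule tendsto_sum)
      fix j
      show "((\<lambda>x::real. a (Suc j) * of_real ((real (Suc j) / real M) powr x)) \<longlongrightarrow> (if j = M - 1 then a M else 0)) at_top"
      proof (cases "Suc j" M rule: linorder_cases)
        case less
        have "((\<lambda>x. (real (Suc j) / real M) powr x) \<longlongrightarrow> 0) at_top" using less by (intro decay) auto
        from tendsto_mult[OF tendsto_const tendsto_of_real[OF this], of "a (Suc j)"] show ?thesis using less by auto
      next
        case equal
        show ?thesis unfolding equal[symmetric] by (simp del: of_nat_Suc)
      next
        case greater
        thus ?thesis using aM0[of "Suc j"] M1(1) by auto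
      qed
    qed
    also have "(\<Sum>j<N. if j = M - 1 then a M else 0) = a M" using M1 by (simp add: sum.delta)
    finally have 1: "((\<lambda>x::real. norm (\<Sum>j<N. a (Suc j) * of_real ((real (Suc j) / real M) powr x))) \<longlongrightarrow> norm (a M)) at_top"
      by (rule tendsto_norm)
    have "norm (\<Sum>j<N. a (Suc j) * of_real ((real (Suc j) / real M) powr x)) = norm (L (- of_real x)) / real M powr x" for x
    proof -
      have "of_nat (Suc j) powr (of_real x) = complex_of_real (real (Suc j) powr x)" for j
        using powr_of_real[of "real (Suc j)" x] by simp
      hence "L (- of_real x) = (\<Sum>j<N. a (Suc j) * of_real (real (Suc j) powr x))" unfolding La by simp
      moreover have pm: "(real (Suc j) / real M) powr x * real M powr x = real (Suc j) powr x" for j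
        using M1 by (simp add: powr_divide del: of_nat_Suc)
      ultimately have "L (- of_real x) = (\<Sum>j<N. a (Suc j) * of_real ((real (Suc j) / real M) powr x * real M powr x))" by simp
      also have "\<dots> = (\<Sum>j<N. a (Suc j) * of_real ((real (Suc j) / real M) powr x)) * of_real (real M powr x)"
        unfolding sum_distrib_right by (intro sum.cong refl) (simp only: mult.assoc of_real_mult)
      finally show ?thesis using M1 by (simp add: norm_mult)
    qed
    thus ?thesis using 1 by simp
  qed
  \<comment> \<open>comparison of the two asymptotic formulas: \<open>t powr x\<close> has a positive limit, which forces \<open>t = 1\<close>\<close>
  define t where "t = Q\<^sup>2 / real M"
  have t0: "t > 0" using Q M1 by (simp add: t_def)
  have lim_t: "((\<lambda>x. t powr x) \<longlongrightarrow> norm (a M) / Q) at_top"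
  proof -
    have sh: "filterlim (\<lambda>x::real. 1 + x) at_top at_top" by (rule filterlim_tendsto_add_at_top[OF tendsto_const filterlim_ident])
    have "((\<lambda>x. norm (L (of_real (1 + x))) * Q) \<longlongrightarrow> norm (1::complex) * Q) at_top"
      by (intro tendsto_mult tendsto_norm tendsto_const filterlim_compose[OF L1 sh])
    from tendsto_divide[OF left this] Q
    have "((\<lambda>x. norm (L (- of_real x)) / real M powr x / (norm (L (of_real (1 + x))) * Q)) \<longlongrightarrow> norm (a M) / Q) at_top" by simp
    moreover have "eventually (\<lambda>x. norm (L (of_real (1 + x))) > 0) at_top"
      by (rule order_tendstoD[OF tendsto_norm[OF filterlim_compose[OF L1 sh]]]) simp
    hence "eventually (\<lambda>x. norm (L (- of_real x)) / real M powr x / (norm (L (of_real (1 + x))) * Q) = t powr x) at_top"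
      using eventually_gt_at_top[of 0]
    proof eventually_elim
      case (elim x)
      have "norm (L (- of_real x)) = norm (L (1 - cnj (- of_real x))) * Q powr (1 - 2 * Re (- of_real x))"
        using elim by (intro eq) (auto simp: complex_eq_iff)
      also have "1 - cnj (- of_real x) = of_real (1 + x)" by simp
      also have "Q powr (1 - 2 * Re (- of_real x)) = Q * (Q\<^sup>2) powr x"
        using Q powr_add[of Q 1 "2 * x"] powr_powr[of Q 2 x] by simp
      finally have "norm (L (- of_real x)) = norm (L (of_real (1 + x))) * (Q * (Q\<^sup>2) powr x)" .
      moreover have "t powr x = (Q\<^sup>2) powr x / real M powr x" unfolding t_def by (rule powr_divide)
      ultimately show ?case using elim Q by (simp add: field_simps)
    qed
    ultimately show ?thesis by (rule Lim_transform_eventually)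
  qed
  have aMpos: "norm (a M) / Q > 0" using M1 Q by simp
  have t1: "t = 1"
  proof (rule ccontr)
    assume "t \<noteq> 1"
    then consider "t < 1" | "t > 1" by linarith
    thus False
    proof cases
      case 1
      have "norm (a M) / Q = 0"
        using tendsto_unique[OF trivial_limit_at_top_linorder lim_t decay[OF t0 1]] .
      thus False using aMpos by linarith
    next
      case 2
      have "((\<lambda>x. (1 / t) powr x * t powr x) \<longlongrightarrow> 0 * (norm (a M) / Q)) at_top"
        by (intro tendsto_mult decay lim_t) (use 2 in auto)
      moreover have "(1 / t) powr x * t powr x = 1" for x using t0 by (simp add: powr_divide)
      ultimately have "((\<lambda>x::real. 1::real) \<longlongrightarrow> 0) at_top" by simp
      thus False using tendsto_unique[OF trivial_limit_at_top_linorder tendsto_const] by force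
    qed
  qed
  have QM: "Q\<^sup>2 = M" using t1 M1 by (simp add: t_def)
  have "((\<lambda>x::real. t powr x) \<longlongrightarrow> 1) at_top" unfolding t1 by simp
  hence "norm (a M) / Q = 1" by (rule tendsto_unique[OF trivial_limit_at_top_linorder lim_t])
  hence aMQ: "norm (a M) = sqrt M" using QM Q real_sqrt_abs[of Q] by (simp add: field_simps)
  have M2: "M \<ge> 2"
  proof (rule ccontr)
    assume "\<not> M \<ge> 2"
    hence "M = 1" using M1 by simp
    have "L s = a 1" for s
    proof -
      have "L s = (\<Sum>j\<in>{0}. a (Suc j) * of_nat (Suc j) powr (- s))"
        unfolding La by (rule sum.mono_neutral_right) (use M1 \<open>M = 1\<close> aM0 in auto)
      thus ?thesis by simp
    qed
    thus False using nc by (auto simp: constant_on_def)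
  qed
  obtain b \<theta> where \<theta>: "\<theta> < 1/2" and b: "\<forall>j\<ge>1. \<not> primepow j \<longrightarrow> b j = 0"
        "(\<lambda>j. norm (b j)) \<in> O(\<lambda>j. real j powr \<theta>)"
        "\<forall>s. Re s > 1 \<longrightarrow> (\<exists>l. (\<lambda>j. b (Suc j) * of_nat (Suc j) powr (- s)) sums l \<and> exp l = L s)"
    using L unfolding L_function_def by blast
  have "\<theta> \<le> 1" using \<theta> by simp
  then obtain c where c: "\<And>j. j \<ge> 1 \<Longrightarrow> norm (b j) \<le> c * real j powr \<theta>"
    using bigo_powr_linear_bound[OF b(2)] by metis
  obtain l where l: "\<And>s. Re s > 1 \<Longrightarrow> (\<lambda>j. b (Suc j) * of_nat (Suc j) powr (- s)) sums l s \<and> exp (l s) = L s"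
    using b(3) by metis
  have \<theta>2: "\<theta> \<le> 1 / 2" using \<theta> by simp
  have rec: "a k * of_real (ln (real k)) = (\<Sum>d | d dvd k. a (k div d) * b d * of_real (ln (real d)))" if "k \<ge> 1" for k
    by (rule log_recursion[OF La aN c \<theta>2 l that])
  have mult: "a (u * v) = a u * a v" if "u \<ge> 1" "v \<ge> 1" "coprime u v" for u v
    by (rule multiplicative_of_log_recursion[OF rec _ a1 that]) (use b(1) in auto)
  have aMs: "norm (a M) \<ge> sqrt M" using aMQ by simp
  obtain p where p: "prime p" "p dvd M" "norm (a (p ^ multiplicity p M)) \<ge> sqrt (real (p ^ multiplicity p M))"
  proof (rule large_local_factor[of a M])
    show "a (u * v) = a u * a v" if "u \<ge> 1" "v \<ge> 1" "coprime u v" for u v by (rule mult[OF that])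
  qed (use a1 M2 aMs in blast)+
  define v where "v = multiplicity p M"
  have M0: "M \<noteq> 0" using M1 by simp
  obtain M' where M': "M = p ^ v * M'" "\<not> p dvd M'"
    using multiplicity_decompose'[of M p] p(1) M0 unfolding v_def by (metis not_prime_unit)
  have "M' \<noteq> 0" using M'(1) M0 by (metis mult_0_right)
  have p0: "p > 1" using prime_gt_1_nat[OF p(1)] .
  have v: "v > 0" using p(1,2) M0 multiplicity_eq_zero_iff[of M p] p0 by (auto simp: v_def)
  have pM: "a (p ^ i * M') = a (p ^ i) * a M'" for i
  proof (rule mult)
    show "coprime (p ^ i) M'" using M'(2) p(1) by (simp add: prime_imp_coprime)
  qed (use p0 \<open>M' \<noteq> 0\<close> in auto)
  have aM': "a M' \<noteq> 0" "a (p ^ v) \<noteq> 0" using pM[of v] M1(3) M'(1) by auto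
  \<comment> \<open>\<open>p ^ v\<close> is the top degree of the Euler factor, since a higher power of \<open>p\<close> would give a coefficient beyond \<open>M\<close>\<close>
  have high: "a (p ^ i) = 0" if i: "i > v" for i
  proof -
    have "p ^ v < p ^ i" using i p0 by (intro power_strict_increasing) auto
    hence "M < p ^ i * M'" using M'(1) \<open>M' \<noteq> 0\<close> by simp
    hence "a (p ^ i) * a M' = 0" using aM0 pM[of i] by simp
    thus ?thesis using aM' by simp
  qed
  have small: "norm (a (p ^ v)) \<le> (real p powr \<theta>) ^ v"
    by (rule local_factor_small[OF p(1) high aM'(2) a1 rec c])
  have "real p powr \<theta> < sqrt (real p)"
    using p0 \<theta> by (simp add: powr_half_sqrt[symmetric])
  hence "(real p powr \<theta>) ^ v < sqrt (real p) ^ v" using v by (intro power_strict_mono) auto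
  also have "\<dots> = sqrt (real (p ^ v))" by (simp add: real_sqrt_power)
  finally show False using small p(3) by (simp add: v_def)
qed

section \<open>Uniqueness from shared values\<close>

lemma finite_order_sub_power_bound:
  fixes F :: "complex \<Rightarrow> complex"
  assumes F: "\<And>z. norm z \<ge> R \<Longrightarrow> norm (F z) \<le> exp (C * norm z ^ k)" and C: "C \<ge> 0"
  obtains C' R' where "\<And>z. norm z \<ge> R' \<Longrightarrow> norm (F z - \<alpha> * (z - 1) ^ k0) \<le> exp (C' * norm z ^ (k + k0))"
proof -
  define C' where "C' = 1 + C + norm \<alpha> * 2 ^ k0"
  show ?thesis
  proof (rule that[of "max R 1" C'])
    fix z :: complex assume z: "norm z \<ge> max R 1"
    define P where "P = norm z ^ (k + k0)"
    have pw: "norm z ^ k \<le> P" "norm z ^ k0 \<le> P" "1 \<le> P"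
      using z by (auto simp: P_def intro: power_increasing one_le_power)
    have "norm (z - 1) \<le> 2 * norm z" using norm_triangle_ineq4[of z 1] z by simp
    hence "norm (\<alpha> * (z - 1) ^ k0) \<le> norm \<alpha> * (2 * norm z) ^ k0"
      by (simp only: norm_mult norm_power) (intro mult_left_mono power_mono, auto)
    also have "\<dots> = norm \<alpha> * 2 ^ k0 * norm z ^ k0" by (simp add: power_mult_distrib)
    also have "\<dots> \<le> norm \<alpha> * 2 ^ k0 * P" using pw by (intro mult_left_mono) auto
    also have "\<dots> \<le> exp (norm \<alpha> * 2 ^ k0 * P)" using exp_ge_add_one_self[of "norm \<alpha> * 2 ^ k0 * P"] by linarith
    finally have 1: "norm (\<alpha> * (z - 1) ^ k0) \<le> exp (norm \<alpha> * 2 ^ k0 * P)" .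
    have "norm (F z) \<le> exp (C * norm z ^ k)" using F z by auto
    also have "\<dots> \<le> exp (C * P)" using pw C by (auto intro: mult_left_mono)
    finally have 2: "norm (F z) \<le> exp (C * P)" .
    define x y where "x = C * P" and "y = norm \<alpha> * 2 ^ k0 * P"
    have xy: "x \<ge> 0" "y \<ge> 0" using C pw by (auto simp: x_def y_def)
    have "norm (F z - \<alpha> * (z - 1) ^ k0) \<le> exp x + exp y"
      using norm_triangle_ineq4[of "F z" "\<alpha> * (z - 1) ^ k0"] 1 2 by (simp add: x_def y_def)
    also have "\<dots> \<le> exp (x + y) + exp (x + y)" using xy by (intro add_mono) auto
    also have "\<dots> \<le> exp 1 * exp (x + y)" using exp_ge_add_one_self[of 1] by (simp add: mult_2[symmetric])
    also have "\<dots> = exp (1 + x + y)" by (simp add: exp_add)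
    also have "\<dots> \<le> exp (C' * P)" using pw by (simp add: C'_def x_def y_def algebra_simps)
    finally show "norm (F z - \<alpha> * (z - 1) ^ k0) \<le> exp (C' * norm z ^ (k + k0))" by (simp add: P_def)
  qed
qed

lemma nicely_meromorphic_eqI:
  assumes f: "f nicely_meromorphic_on UNIV" and g: "g nicely_meromorphic_on UNIV"
    and X: "finite X" and eq: "\<And>z. z \<notin> X \<Longrightarrow> f z = g z"
  shows "f = g"
proof
  fix z
  have ev: "eventually (\<lambda>w. f w = g w) (at z)"
  proof -
    have "eventually (\<lambda>w. w \<notin> X) (at z)"
      using islimpt_finite[OF X, of z] unfolding islimpt_iff_eventually not_not .
    thus ?thesis by eventually_elim (use eq in auto)
  qed
  hence pole: "is_pole f z \<longleftrightarrow> is_pole g z" by (intro is_pole_cong) auto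
  show "f z = g z"
  proof (cases "is_pole f z")
    case True
    hence "f z = 0" by (intro is_pole_zero_at_nicely_mero[OF f]) auto
    moreover have "g z = 0" by (rule is_pole_zero_at_nicely_mero[OF g]) (use True pole in auto)
    ultimately show ?thesis by simp
  next
    case False
    have "f analytic_on {z}" "g analytic_on {z}"
      using nicely_meromorphic_on_imp_analytic_at[OF f] nicely_meromorphic_on_imp_analytic_at[OF g] False pole by auto
    hence "(f \<longlongrightarrow> f z) (at z)" "(g \<longlongrightarrow> g z) (at z)" using analytic_at_imp_isCont isContD by blast+
    moreover from this(1) have "(g \<longlongrightarrow> f z) (at z)" using ev by (rule Lim_transform_eventually)
    ultimately show ?thesis using tendsto_unique[of "at z" g "f z" "g z"] by simp
  qed
qed

text \<open>
  The statement in the form in which it is proved: \<open>\<alpha>\<close> is shared with multiplicities, \<open>0\<close> and the finite set \<open>T\<close> are shared as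
  sets of points. The exceptional set \<open>X\<close> contains the poles of \<open>f\<close> and the possible pole 1 of \<open>L\<close>.
\<close>
theorem shared_values_unique:
  fixes f L :: "complex \<Rightarrow> complex" and \<alpha> e :: complex and T :: "complex set"
  assumes f: "f nicely_meromorphic_on UNIV" "\<not> f constant_on UNIV" "finite {z. is_pole f z}"
    and L: "L_function L" "\<not> L constant_on UNIV"
    and T: "finite T" "e \<in> T" "0 \<notin> T" "\<alpha> \<notin> T" and \<alpha>: "\<alpha> \<noteq> 0"
    and share_\<alpha>: "\<And>z. value_point f \<alpha> z \<longleftrightarrow> value_point L \<alpha> z"
      "\<And>z. value_point f \<alpha> z \<Longrightarrow> multiplicity_at f \<alpha> z = multiplicity_at L \<alpha> z"
    and share_T: "\<And>z. (\<exists>\<beta>\<in>T. value_point f \<beta> z) \<longleftrightarrow> (\<exists>\<beta>\<in>T. value_point L \<beta> z)"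
    and share_0: "\<And>z. value_point f 0 z \<longleftrightarrow> value_point L 0 z"
  shows "f = L"
proof (rule ccontr)
  assume neq: "f \<noteq> L"
  have nmL: "L nicely_meromorphic_on UNIV" using L(1) by (auto simp: L_function_def)
  define X where "X = {z. is_pole f z} \<union> {1}"
  have X: "finite X" using f(3) by (simp add: X_def)
  have anf: "f analytic_on {z}" if "z \<notin> X" for z
    using nicely_meromorphic_on_imp_analytic_at[OF f(1), of z] that by (auto simp: X_def)
  have anL: "L analytic_on {z}" if "z \<notin> X" for z
    using L_function_analytic[OF L(1), of z] that by (auto simp: X_def)
  have npL: "\<not> is_pole L z" if "z \<notin> X" for z
    using anL[OF that] analytic_at_imp_no_pole by blast
  have vf: "value_point f \<beta> z \<longleftrightarrow> f z = \<beta>" and vL: "value_point L \<beta> z \<longleftrightarrow> L z = \<beta>" if "z \<notin> X" for \<beta> z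
    using npL[OF that] that by (auto simp: value_point_def X_def)
  have s\<alpha>: "f z = \<alpha> \<longleftrightarrow> L z = \<alpha>" and s0: "f z = 0 \<longleftrightarrow> L z = 0" and sT: "f z \<in> T \<longleftrightarrow> L z \<in> T" if "z \<notin> X" for z
    using share_\<alpha>(1)[of z] share_0[of z] share_T[of z] vf[OF that] vL[OF that] by auto
  have frf: "frequently (\<lambda>w. f w - \<alpha> \<noteq> 0) (at z)" and frL: "frequently (\<lambda>w. L w - \<alpha> \<noteq> 0) (at z)" for z
    using nicely_meromorphic_frequently_neq[OF f(1,2), of \<alpha> z] nicely_meromorphic_frequently_neq[OF nmL L(2), of \<alpha> z] by simp_all
  have mf: "(\<lambda>z. f z - \<alpha>) meromorphic_on UNIV" and mL: "(\<lambda>z. L z - \<alpha>) meromorphic_on UNIV"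
    using f(1) nmL by (auto simp: nicely_meromorphic_on_def intro!: meromorphic_intros)
  have anf': "(\<lambda>z. f z - \<alpha>) analytic_on {z}" and anL': "(\<lambda>z. L z - \<alpha>) analytic_on {z}" if "z \<notin> X" for z
    using anf[OF that] anL[OF that] by (auto intro!: analytic_intros)
  have zo: "zorder (\<lambda>z. f z - \<alpha>) z = zorder (\<lambda>z. L z - \<alpha>) z" if z: "z \<notin> X" "f z - \<alpha> = 0" for z
  proof -
    have "zorder (\<lambda>z. f z - \<alpha>) z > 0" using zorder_pos_iff'[OF anf'[OF z(1)] frf] z(2) by simp
    moreover have "zorder (\<lambda>z. L z - \<alpha>) z > 0" using zorder_pos_iff'[OF anL'[OF z(1)] frL] z s\<alpha>[OF z(1)] by simp
    moreover have "nat (zorder (\<lambda>z. f z - \<alpha>) z) = nat (zorder (\<lambda>z. L z - \<alpha>) z)"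
      using share_\<alpha>(2)[of z] vf[OF z(1)] z(2) by (simp add: multiplicity_at_def)
    ultimately show ?thesis by linarith
  qed
  have zeros: "f z - \<alpha> = 0 \<longleftrightarrow> L z - \<alpha> = 0" if "z \<notin> X" for z using s\<alpha>[OF that] by simp
  obtain \<phi> k where \<phi>: "\<phi> holomorphic_on UNIV"
    "\<And>z. z \<notin> X \<Longrightarrow> f z - \<alpha> = (L z - \<alpha>) * (\<Prod>x\<in>X. (z - x) powi k x) * exp (\<phi> z)"
    using meromorphic_same_zeros_quotient[OF mf frf mL frL X anf' anL' zeros zo] by metis
  define F G where "F = (\<lambda>z. 1 - f z / \<alpha>)" and "G = (\<lambda>z. 1 - L z / \<alpha>)"
  have FG: "F z = G z * (\<Prod>x\<in>X. (z - x) powi k x) * exp (\<phi> z)" if "z \<notin> X" for z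
  proof -
    have FG_eq: "F z = - (f z - \<alpha>) / \<alpha>" "G z = - (L z - \<alpha>) / \<alpha>" using \<alpha> by (auto simp: F_def G_def field_simps)
    show ?thesis unfolding FG_eq \<phi>(2)[OF that] by (simp only: times_divide_eq_left mult_minus_left)
  qed
  have F01: "(F z = 0 \<longleftrightarrow> L z = \<alpha>) \<and> (F z = 1 \<longleftrightarrow> L z = 0)" and G01: "(G z = 0 \<longleftrightarrow> L z = \<alpha>) \<and> (G z = 1 \<longleftrightarrow> L z = 0)"
    if "z \<notin> X" for z
    using s\<alpha>[OF that] s0[OF that] \<alpha> by (auto simp: F_def G_def field_simps)
  obtain \<sigma>0 K0 where r0: "\<sigma>0 \<ge> 3" "\<And>s. Re s \<ge> \<sigma>0 \<Longrightarrow> L s \<noteq> 0 \<and> \<bar>ln (norm (L s - 0))\<bar> \<le> K0 * Re s"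
    using L_function_omits_value_right[OF L, of 0] by metis
  obtain \<sigma>\<alpha> K\<alpha> where r\<alpha>: "\<sigma>\<alpha> \<ge> 3" "\<And>s. Re s \<ge> \<sigma>\<alpha> \<Longrightarrow> L s \<noteq> \<alpha> \<and> \<bar>ln (norm (L s - \<alpha>))\<bar> \<le> K\<alpha> * Re s"
    using L_function_omits_value_right[OF L, of \<alpha>] by metis
  obtain \<sigma>1 where r1: "\<sigma>1 \<ge> 3" "\<And>s. Re s \<ge> \<sigma>1 \<Longrightarrow> norm (L s - 1) < 1 / 2"
    using L_function_tends_1[OF L(1), of "1/2"] by auto
  have half: "norm (L s) \<ge> 1 / 2" if "Re s \<ge> \<sigma>1" for s
    using r1(2)[OF that] norm_triangle_ineq2[of 1 "1 - L s"] by (simp add: norm_minus_commute)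
  obtain Q K \<mu> \<nu> \<omega> where Q: "Q > 0" and \<mu>: "\<forall>j\<in>{1..K}. \<mu> j > 0 \<and> Re (\<nu> j) \<ge> 0" and \<omega>: "norm \<omega> = 1"
    and fe: "\<forall>s. completed_L L Q K \<mu> \<nu> s = \<omega> * cnj (completed_L L Q K \<mu> \<nu> (1 - cnj s))"
    using L(1) unfolding L_function_def by blast
  have "K \<noteq> 0"
  proof
    assume "K = 0"
    thus False using degree_zero_constant[OF L(1) Q \<omega>] fe L(2) by blast
  qed
  hence K1: "K \<ge> 1" by simp
  obtain A1 where A1: "A1 \<ge> 0" "\<And>M. \<exists>B. \<forall>s. Re s \<le> - A1 \<longrightarrow> \<bar>Im s\<bar> \<ge> B \<longrightarrow> norm (L s) \<ge> M"
    using functional_equation_growth[OF L_function_analytic[OF L(1)] Q K1 \<mu> \<omega> fe half] by metis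
  obtain B1 where B1: "\<And>s. Re s \<le> - A1 \<Longrightarrow> \<bar>Im s\<bar> \<ge> B1 \<Longrightarrow> norm (L s) \<ge> norm \<alpha> + 1"
    using A1(2)[of "norm \<alpha> + 1"] by blast
  obtain RX where RX: "RX \<ge> 0" "\<And>x. x \<in> X \<Longrightarrow> norm x \<le> RX"
    using finite_imp_bounded[OF X] unfolding bounded_iff by (metis abs_ge_self abs_ge_zero order_trans)
  \<comment> \<open>outside the disc of radius \<open>A\<close>, all points with \<open>L = 0\<close> or \<open>L = \<alpha>\<close> lie in strips along the imaginary and the
    negative real axis\<close>
  define A where "A = \<bar>\<sigma>0\<bar> + \<bar>\<sigma>\<alpha>\<bar> + A1 + \<bar>B1\<bar> + RX + 1"
  have A: "A \<ge> 0" "A \<ge> \<sigma>0" "A \<ge> \<sigma>\<alpha>" "A \<ge> A1" "A \<ge> B1" "A \<ge> RX" "A \<ge> 1"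
    using A1(1) RX(1) by (auto simp: A_def)
  have notX: "z \<notin> X" if "norm z > A" for z using RX(2)[of z] that A by auto
  \<comment> \<open>\<open>F0\<close> and \<open>F1\<close> are \<open>L\<close> and \<open>L - \<alpha>\<close> with the pole at 1 removed; their zeros contain the exceptional points \<open>Z\<close>\<close>
  obtain F0 k0 kk C R where F0: "F0 holomorphic_on UNIV" "\<And>s. s \<noteq> 1 \<Longrightarrow> F0 s = (s - 1) ^ k0 * L s"
      "C \<ge> 0" "\<And>z. norm z \<ge> R \<Longrightarrow> norm (F0 z) \<le> exp (C * norm z ^ kk)"
    using L_function_order[OF L(1)] by metis
  define F1 where "F1 = (\<lambda>z. F0 z - \<alpha> * (z - 1) ^ k0)"
  have holF1: "F1 holomorphic_on UNIV" unfolding F1_def by (intro holomorphic_intros F0(1))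
  obtain C' R' where crude1: "\<And>z. norm z \<ge> R' \<Longrightarrow> norm (F1 z) \<le> exp (C' * norm z ^ (kk + k0))"
    using finite_order_sub_power_bound[OF F0(4,3)] unfolding F1_def by metis
  \<comment> \<open>a point where neither \<open>F0\<close> nor \<open>F1\<close> vanishes, as the zero count requires\<close>
  define p where "p = complex_of_real A"
  have p1: "Re p \<ge> \<sigma>0" "Re p \<ge> \<sigma>\<alpha>" "p \<noteq> 1" using A r0(1) by (auto simp: p_def complex_eq_iff A_def)
  have F0p: "F0 p \<noteq> 0" using F0(2)[OF p1(3)] r0(2)[OF p1(1)] p1(3) by auto
  have F1eq: "F1 s = (s - 1) ^ k0 * (L s - \<alpha>)" if "s \<noteq> 1" for s
    using F0(2)[OF that] by (simp add: F1_def algebra_simps)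
  have F1p: "F1 p \<noteq> 0" using F1eq[OF p1(3)] r\<alpha>(2)[OF p1(2)] p1(3) by auto
  obtain N0 where N0: "\<And>r. r \<ge> 1 \<Longrightarrow> finite {z. F0 z = 0 \<and> norm z \<le> r}"
     "\<And>r. r \<ge> 1 \<Longrightarrow> real (card {z. F0 z = 0 \<and> norm z \<le> r}) \<le> N0 * r ^ kk"
    by (rule card_zeros_polynomial_bound[OF F0(1) F0p F0(4)]) blast+
  obtain N1 where N1: "\<And>r. r \<ge> 1 \<Longrightarrow> finite {z. F1 z = 0 \<and> norm z \<le> r}"
     "\<And>r. r \<ge> 1 \<Longrightarrow> real (card {z. F1 z = 0 \<and> norm z \<le> r}) \<le> N1 * r ^ (kk + k0)"
    by (rule card_zeros_polynomial_bound[OF holF1 F1p crude1]) blast+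
  define Z where "Z = {z. (L z = 0 \<or> L z = \<alpha>) \<and> z \<notin> X}"
  have Zsub: "{z\<in>Z. norm z \<le> r} \<subseteq> {z. F0 z = 0 \<and> norm z \<le> r} \<union> {z. F1 z = 0 \<and> norm z \<le> r}" for r
    using F0(2) F1eq by (auto simp: Z_def X_def)
  have finZ: "finite {z\<in>Z. norm z \<le> r}" if "r \<ge> 1" for r
    using finite_subset[OF Zsub] N0(1)[OF that] N1(1)[OF that] by blast
  have cardZ: "real (card {z\<in>Z. norm z \<le> r}) \<le> (\<bar>N0\<bar> + \<bar>N1\<bar>) * r ^ (kk + k0)" if r: "r \<ge> 1" for r
  proof -
    have "card {z\<in>Z. norm z \<le> r} \<le> card ({z. F0 z = 0 \<and> norm z \<le> r} \<union> {z. F1 z = 0 \<and> norm z \<le> r})"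
      using N0(1)[OF r] N1(1)[OF r] by (intro card_mono Zsub) auto
    also have "\<dots> \<le> card {z. F0 z = 0 \<and> norm z \<le> r} + card {z. F1 z = 0 \<and> norm z \<le> r}" by (rule card_Un_le)
    finally have "real (card {z\<in>Z. norm z \<le> r}) \<le> N0 * r ^ kk + N1 * r ^ (kk + k0)"
      using N0(2)[OF r] N1(2)[OF r] by linarith
    also have "\<dots> \<le> \<bar>N0\<bar> * r ^ (kk + k0) + \<bar>N1\<bar> * r ^ (kk + k0)"
      using r by (intro add_mono mult_mono power_increasing) auto
    finally show ?thesis by (simp add: distrib_right)
  qed
  have om: "F z \<noteq> 0 \<and> F z \<noteq> 1" "G z \<noteq> 0 \<and> G z \<noteq> 1" if "norm z > A" "z \<notin> Z" for z
    using F01[OF notX[OF that(1)]] G01[OF notX[OF that(1)]] notX[OF that(1)] that(2) by (auto simp: Z_def)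
  have rightZ: "z \<notin> Z" if "Re z > A" for z using r0(2)[of z] r\<alpha>(2)[of z] that A by (auto simp: Z_def)
  have quad: "z \<notin> Z" if "\<bar>Re z\<bar> > A" "\<bar>Im z\<bar> > A" for z
  proof (cases "Re z > A")
    case False
    hence "norm (L z) \<ge> norm \<alpha> + 1" using that A by (intro B1) auto
    hence "norm (L z) > 0" "norm (L z) > norm \<alpha>" using norm_ge_zero[of \<alpha>] by linarith+
    thus ?thesis by (auto simp: Z_def)
  qed (rule rightZ)
  have an2: "F analytic_on {z}" "G analytic_on {z}" if "z \<notin> X" for z
    unfolding F_def G_def using \<alpha> by (auto intro!: analytic_intros anf anL that)
  have holF: "F holomorphic_on {z. norm z > A}" and holG: "G holomorphic_on {z. norm z > A}"
    by (rule analytic_imp_holomorphic, subst analytic_on_analytic_at, use an2 notX in blast)+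
  obtain n c where poly: "\<And>z. \<phi> z = (\<Sum>i\<le>n. c i * z ^ i)"
  proof (rule exponent_polynomial[where A = A and X = X and F = F and G = G and \<phi> = \<phi> and k = k and Z = Z and ?K0.0 = "\<bar>N0\<bar> + \<bar>N1\<bar>" and ?k0.0 = "kk + k0"])
    show "norm x \<le> A" if "x \<in> X" for x using RX(2)[OF that] A by linarith
  qed (use A X \<phi> holF holG FG notX om quad finZ cardZ in blast)+
  have nR: "norm z > A" if "Re z > A" for z using that complex_Re_le_cmod[of z] by linarith
  obtain c0 c1 where lin: "\<And>z. \<phi> z = c0 + c1 * z"
  proof (rule exponent_linear[where A = A and X = X and F = F and G = G and \<phi> = \<phi> and k = k and c = c and n = n and KG = "\<bar>K\<alpha>\<bar> + \<bar>ln (norm \<alpha>)\<bar>"])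
    show "norm x \<le> A" if "x \<in> X" for x using RX(2)[OF that] A by linarith
    show "F holomorphic_on {z. Re z > A}" by (rule holomorphic_on_subset[OF holF]) (use nR in auto)
    fix z assume z: "Re z > A"
    show "F z = G z * (\<Prod>x\<in>X. (z - x) powi k x) * exp (\<phi> z)" by (rule FG[OF notX[OF nR[OF z]]])
    show "F z \<noteq> 0 \<and> F z \<noteq> 1" by (rule om(1)[OF nR[OF z] rightZ[OF z]])
    have r: "L z \<noteq> \<alpha>" "\<bar>ln (norm (L z - \<alpha>))\<bar> \<le> K\<alpha> * Re z" using r\<alpha>(2)[of z] z A by auto
    have "norm (G z) = norm (L z - \<alpha>) / norm \<alpha>"
    proof -
      have "G z = - (L z - \<alpha>) / \<alpha>" using \<alpha> by (simp add: G_def field_simps)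
      thus ?thesis by (simp add: norm_divide norm_minus_commute)
    qed
    hence "ln (norm (G z)) = ln (norm (L z - \<alpha>)) - ln (norm \<alpha>)" using r(1) \<alpha> by (simp add: ln_div)
    hence "\<bar>ln (norm (G z))\<bar> \<le> K\<alpha> * Re z + \<bar>ln (norm \<alpha>)\<bar>" using r(2) by linarith
    also have "\<dots> \<le> \<bar>K\<alpha>\<bar> * norm z + \<bar>ln (norm \<alpha>)\<bar> * norm z"
    proof (rule add_mono)
      show "K\<alpha> * Re z \<le> \<bar>K\<alpha>\<bar> * norm z" using z A complex_Re_le_cmod[of z] by (intro mult_mono) auto
      have "1 \<le> norm z" using nR[OF z] A by linarith
      thus "\<bar>ln (norm \<alpha>)\<bar> \<le> \<bar>ln (norm \<alpha>)\<bar> * norm z" using mult_left_mono[of 1 "norm z" "\<bar>ln (norm \<alpha>)\<bar>"] by simp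
    qed
    finally show "\<bar>ln (norm (G z))\<bar> \<le> (\<bar>K\<alpha>\<bar> + \<bar>ln (norm \<alpha>)\<bar>) * norm z" by (simp add: distrib_right)
  next
    show "\<phi> z = (\<Sum>i\<le>n. c i * z ^ i)" for z by (rule poly)
  qed (use A X in blast)+
  define h where "h = (\<lambda>z. (\<Prod>x\<in>X. (z - x) powi k x) * exp (c0 + c1 * z))"
  have fh: "f z - \<alpha> = (L z - \<alpha>) * h z" if "z \<notin> X" for z using \<phi>(2)[OF that] by (simp add: h_def lin mult.assoc)
  have hnz: "h z \<noteq> 0" if "z \<notin> X" for z using that X by (auto simp: h_def)
  define a b where "a = - A1" and "b = \<sigma>0"
  \<comment> \<open>a second value \<open>e'\<close> such that \<open>L\<close> takes the values 0 and \<open>e'\<close> only where \<open>h\<close> takes one of finitely many values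
    that \<open>h\<close> takes rarely; if \<open>h\<close> is constant there are no such values at all\<close>
  have "\<exists>e' V. e' \<noteq> 0 \<and> finite V \<and> (\<forall>v\<in>V. v \<noteq> 0 \<and> (\<exists>z0. z0 \<notin> X \<and> h z0 \<noteq> v)) \<and>
      (\<forall>z. z \<notin> X \<longrightarrow> L z = 0 \<or> L z = e' \<longrightarrow> h z \<in> V)"
  proof (cases "\<exists>\<kappa>. \<forall>z. z \<notin> X \<longrightarrow> h z = \<kappa>")
    case True
    then obtain \<kappa> where \<kappa>: "\<And>z. z \<notin> X \<Longrightarrow> h z = \<kappa>" by blast
    have "infinite (UNIV :: complex set)" by (rule infinite_UNIV_char_0)
    then obtain z0 where "z0 \<notin> X" using X by (metis ex_new_if_finite)
    hence \<kappa>0: "\<kappa> \<noteq> 0" using hnz \<kappa> by auto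
    have \<kappa>1: "\<kappa> \<noteq> 1"
    proof
      assume "\<kappa> = 1"
      hence "f z = L z" if "z \<notin> X" for z using fh[OF that] \<kappa>[OF that] by simp
      hence "f = L" by (rule nicely_meromorphic_eqI[OF f(1) nmL X])
      thus False using neq by simp
    qed
    \<comment> \<open>where \<open>L = e'\<close> one would have \<open>f = 0\<close>, hence \<open>L = 0\<close>, which is excluded\<close>
    define e' where "e' = \<alpha> * (1 - 1 / \<kappa>)"
    have e'0: "e' \<noteq> 0" using \<alpha> \<kappa>0 \<kappa>1 by (simp add: e'_def field_simps)
    have no0: "L z \<noteq> 0" if "z \<notin> X" for z
    proof
      assume "L z = 0"
      hence "f z = 0" using s0[OF that] by simp
      thus False using fh[OF that] \<kappa>[OF that] \<open>L z = 0\<close> \<alpha> \<kappa>1 by simp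
    qed
    have "L z \<noteq> e'" if "z \<notin> X" for z
    proof
      assume "L z = e'"
      hence "f z - \<alpha> = (e' - \<alpha>) * \<kappa>" using fh[OF that] \<kappa>[OF that] by simp
      also have "\<dots> = - \<alpha>" using \<kappa>0 by (simp add: e'_def field_simps)
      finally have "f z = 0" by simp
      thus False using s0[OF that] no0[OF that] by simp
    qed
    thus ?thesis using e'0 no0 by (intro exI[of _ e'] exI[of _ "{}"]) auto
  next
    case False
    define V where "V = insert 1 ((\<lambda>\<beta>. (\<beta> - \<alpha>) / (e - \<alpha>)) ` T)"
    have e\<alpha>: "e - \<alpha> \<noteq> 0" using T by auto
    have "h z \<in> V" if z: "z \<notin> X" "L z = 0 \<or> L z = e" for z
    proof (cases "L z = 0")
      case True
      hence "f z = 0" using s0[OF z(1)] by simp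
      hence "h z = 1" using fh[OF z(1)] True \<alpha> by simp
      thus ?thesis by (simp add: V_def)
    next
      case False
      hence Le: "L z = e" using z(2) by simp
      hence "f z \<in> T" using sT[OF z(1)] T(2) by simp
      moreover have "h z = (f z - \<alpha>) / (e - \<alpha>)" using fh[OF z(1)] Le e\<alpha> by (simp add: field_simps)
      ultimately show ?thesis by (auto simp: V_def)
    qed
    moreover have "v \<noteq> 0" if "v \<in> V" for v using that T e\<alpha> by (auto simp: V_def)
    moreover have "\<exists>z0. z0 \<notin> X \<and> h z0 \<noteq> v" for v using False by blast
    moreover have "finite V" using T by (simp add: V_def)
    moreover have "e \<noteq> 0" using T by auto
    ultimately show ?thesis by (intro exI[of _ e] exI[of _ V]) blast
  qed
  then obtain e' V where e': "e' \<noteq> 0" and V: "finite V" "\<And>v. v \<in> V \<Longrightarrow> v \<noteq> 0" "\<And>v. v \<in> V \<Longrightarrow> \<exists>z0. z0 \<notin> X \<and> h z0 \<noteq> v"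
    and hV: "\<And>z. z \<notin> X \<Longrightarrow> L z = 0 \<or> L z = e' \<Longrightarrow> h z \<in> V" by blast
  define W where "W = (\<lambda>v T. {z. a - 1 \<le> Re z \<and> Re z \<le> b + 1 \<and> T \<le> Im z \<and> Im z \<le> T + 3 \<and> h z = v})"
  have "\<exists>M T0. \<forall>T\<ge>T0. finite (W v T) \<and> card (W v T) \<le> M" if v: "v \<in> V" for v
  proof -
    obtain z0 where z0: "z0 \<notin> X" "h z0 \<noteq> v" using V(3)[OF v] by blast
    show ?thesis
      by (rule sparse_solutions[OF X V(2)[OF v] z0(1) z0(2)[unfolded h_def], of "a - 1" "b + 1"])
         (unfold W_def h_def, blast)
  qed
  then obtain M T0 where MT: "\<And>v T. v \<in> V \<Longrightarrow> T \<ge> T0 v \<Longrightarrow> finite (W v T) \<and> card (W v T) \<le> M v" by metis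
  define T1 where "T1 = (\<Sum>v\<in>V. \<bar>T0 v\<bar>) + A + 1"
  have T1v: "T1 \<ge> T0 v" if "v \<in> V" for v
  proof -
    have "\<bar>T0 v\<bar> \<le> (\<Sum>v\<in>V. \<bar>T0 v\<bar>)" using that V(1) by (intro member_le_sum) auto
    thus ?thesis using A by (simp add: T1_def)
  qed
  have T1A: "T1 \<ge> A" using sum_nonneg[of V "\<lambda>v. \<bar>T0 v\<bar>"] by (simp add: T1_def)
  have up: "z \<notin> X" if "Im z > T1" for z
    using notX[of z] that T1A abs_Im_le_cmod[of z] by auto
  define Y where "Y = {z. h z \<in> V}"
  have Yeq: "{z\<in>Y. a - 1 \<le> Re z \<and> Re z \<le> b + 1 \<and> T \<le> Im z \<and> Im z \<le> T + 3} = (\<Union>v\<in>V. W v T)" for T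
    by (auto simp: Y_def W_def)
  \<comment> \<open>division by \<open>e'\<close> normalises the second value to 1\<close>
  obtain K' where K': "\<And>T. T \<ge> T1 \<Longrightarrow> \<exists>t\<in>{T+1..T+2}. \<bar>ln (norm (L (Complex a t) / e'))\<bar> \<le> K'"
  proof (rule omitted_values_crossing_bound[where L = "\<lambda>z. L z / e'" and Z = Y and a = a and b = b and ?T0.0 = T1 and M = "\<Sum>v\<in>V. M v" and K = "\<bar>K0 * b\<bar> + \<bar>ln (norm e')\<bar>"])
    show "a < b" using A1(1) r0(1) by (simp add: a_def b_def)
    have "L analytic_on {z. Im z > T1}" by (subst analytic_on_analytic_at) (use anL up in blast)
    thus "(\<lambda>z. L z / e') holomorphic_on {z. Im z > T1}"
      using e' by (intro holomorphic_intros analytic_imp_holomorphic) auto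
    fix T assume T: "T \<ge> T1"
    show "finite {z\<in>Y. a - 1 \<le> Re z \<and> Re z \<le> b + 1 \<and> T \<le> Im z \<and> Im z \<le> T + 3}"
      unfolding Yeq using V(1) MT T1v T by (intro finite_UN_I) (auto intro: order_trans)
    have "card (\<Union>v\<in>V. W v T) \<le> (\<Sum>v\<in>V. card (W v T))" by (rule card_UN_le[OF V(1)])
    also have "\<dots> \<le> (\<Sum>v\<in>V. M v)" by (rule sum_mono) (use MT[of _ T] order_trans[OF T1v T] in blast)
    finally show "card {z\<in>Y. a - 1 \<le> Re z \<and> Re z \<le> b + 1 \<and> T \<le> Im z \<and> Im z \<le> T + 3} \<le> (\<Sum>v\<in>V. M v)"
      unfolding Yeq .
  next
    fix z assume z: "Im z > T1" "z \<notin> Y"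
    show "L z / e' \<noteq> 0 \<and> L z / e' \<noteq> 1" using hV[OF up[OF z(1)]] z(2) e' by (auto simp: Y_def)
  next
    fix t :: real assume "t > T1"
    have r: "L (Complex b t) \<noteq> 0" "\<bar>ln (norm (L (Complex b t)))\<bar> \<le> K0 * b" using r0(2)[of "Complex b t"] by (auto simp: b_def)
    have "ln (norm (L (Complex b t) / e')) = ln (norm (L (Complex b t))) - ln (norm e')"
      using r(1) e' by (simp add: norm_divide ln_div)
    thus "\<bar>ln (norm (L (Complex b t) / e'))\<bar> \<le> \<bar>K0 * b\<bar> + \<bar>ln (norm e')\<bar>" using r(2) by linarith
  qed blast
  \<comment> \<open>on the line \<open>Re s = a\<close> the crossing bound contradicts the growth of \<open>L\<close>\<close>
  obtain B2 where B2: "\<And>s. Re s \<le> - A1 \<Longrightarrow> \<bar>Im s\<bar> \<ge> B2 \<Longrightarrow> norm (L s) \<ge> norm e' * exp (K' + 1)"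
    using A1(2) by blast
  obtain t where t: "t \<ge> max T1 B2" "\<bar>ln (norm (L (Complex a t) / e'))\<bar> \<le> K'"
  proof -
    obtain t where "t \<in> {max T1 \<bar>B2\<bar> + 1..max T1 \<bar>B2\<bar> + 2}" "\<bar>ln (norm (L (Complex a t) / e'))\<bar> \<le> K'"
      using K'[of "max T1 \<bar>B2\<bar>"] by auto
    thus ?thesis by (intro that[of t]) auto
  qed
  have t0: "t \<ge> 0" using t(1) T1A A by linarith
  have "norm (L (Complex a t)) \<ge> norm e' * exp (K' + 1)" by (rule B2) (use t t0 in \<open>auto simp: a_def\<close>)
  hence ge: "exp (K' + 1) \<le> norm (L (Complex a t) / e')" using e' by (simp add: norm_divide field_simps)
  have "norm (L (Complex a t) / e') > 0" using less_le_trans[OF exp_gt_zero ge] .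
  hence "K' + 1 \<le> ln (norm (L (Complex a t) / e'))" using ge by (simp add: ln_ge_iff)
  thus False using t(2) by linarith
qed

lemma fst_E_set: "z \<in> fst ` E_set f T k \<longleftrightarrow> (\<exists>\<beta>\<in>T. value_point f \<beta> z)"
proof
  assume "z \<in> fst ` E_set f T k"
  thus "\<exists>\<beta>\<in>T. value_point f \<beta> z" by (fastforce simp: E_set_def E_value_def)
next
  assume "\<exists>\<beta>\<in>T. value_point f \<beta> z"
  then obtain \<beta> where "\<beta> \<in> T" "value_point f \<beta> z" by blast
  hence "\<exists>p. (z, p) \<in> E_set f T k" by (auto simp: E_set_def E_value_def)
  thus "z \<in> fst ` E_set f T k" by force
qed

lemma share_value_points:
  assumes "share f g T k"
  shows "(\<exists>\<beta>\<in>T. value_point f \<beta> z) \<longleftrightarrow> (\<exists>\<beta>\<in>T. value_point g \<beta> z)"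
  using assms unfolding share_def fst_E_set[symmetric, where k = k] by simp

text \<open>
  With weight \<open>\<infinity>\<close> the counts are never truncated, so the second components are the multiplicities.
\<close>
lemma share_infinity_multiplicity:
  assumes "share f g {\<alpha>} \<infinity>" "value_point f \<alpha> z"
  shows "multiplicity_at f \<alpha> z = multiplicity_at g \<alpha> z"
proof -
  have "(z, enat (multiplicity_at f \<alpha> z)) \<in> E_set f {\<alpha>} \<infinity>"
    using assms(2) by (simp add: E_set_def E_value_def)
  hence "(z, enat (multiplicity_at f \<alpha> z)) \<in> E_set g {\<alpha>} \<infinity>"
    using assms(1) by (simp add: share_def)
  thus ?thesis by (simp add: E_set_def E_value_def)
qed

theorem theorem1p3:
  fixes n m :: nat and a b :: complex and P :: "complex poly" and S :: "complex set"
    and \<alpha> :: "nat \<Rightarrow> complex" and f L :: "complex \<Rightarrow> complex"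
  assumes "n > 0" and "m > 0" and "coprime n m" and "n > 2 * m"
    and "a \<noteq> 0" and "b \<noteq> 0"
    and "P = monom 1 n + monom a m + [:b:]"
    and "S = {w. poly P w = 0}"
    and "card S = n - 1"
    and "bij_betw \<alpha> {1..n - 1} S"
    and "order (\<alpha> 1) P > 1"
    and "\<forall>i\<in>{2..n - 1}. order (\<alpha> i) P = 1"
    and "f nicely_meromorphic_on UNIV" and "\<not> f constant_on UNIV"
    and "finite {z. is_pole f z}"
    and "L_function L" and "\<not> L constant_on UNIV"
    and "share_restricted f L [({\<alpha> 1}, \<infinity>), (\<alpha> ` {2..n - 1}, \<infinity>)]"
    and "share f L {0} 0"
  shows "f = L"
proof (rule shared_values_unique)
  \<comment> \<open>\<open>n \<ge> 3\<close> provides a simple zero \<open>\<alpha> 2\<close>, and \<open>b \<noteq> 0\<close> keeps 0 out of \<open>S\<close>\<close>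
  have n: "n \<ge> 3" using assms(2,4) by linarith
  have "poly P 0 \<noteq> 0" using assms(1,2,6,7) by (simp add: poly_monom zero_power)
  moreover have "poly P (\<alpha> i) = 0" if "i \<in> {1..n - 1}" for i
    using bij_betwE[OF assms(10)] that assms(8) by blast
  ultimately have nz: "\<alpha> i \<noteq> 0" if "i \<in> {1..n - 1}" for i using that by metis
  have inj: "inj_on \<alpha> {1..n - 1}" using assms(10) by (rule bij_betw_imp_inj_on)
  have sh1: "share f L {\<alpha> 1} \<infinity>" and sh2: "share f L (\<alpha> ` {2..n - 1}) \<infinity>"
    using assms(18) by (simp_all add: share_restricted_def)
  show "\<alpha> 1 \<noteq> 0" using n by (intro nz) auto
  show "\<alpha> 2 \<in> \<alpha> ` {2..n - 1}" using n by auto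
  show "0 \<notin> \<alpha> ` {2..n - 1}" using nz by force
  show "\<alpha> 1 \<notin> \<alpha> ` {2..n - 1}"
  proof
    assume "\<alpha> 1 \<in> \<alpha> ` {2..n - 1}"
    then obtain i where i: "i \<in> {2..n - 1}" "\<alpha> 1 = \<alpha> i" by auto
    have "1 = i" by (rule inj_onD[OF inj i(2)]) (use i n in auto)
    thus False using i by simp
  qed
  show "value_point f (\<alpha> 1) z \<longleftrightarrow> value_point L (\<alpha> 1) z" for z
    using share_value_points[OF sh1] by simp
  show "multiplicity_at f (\<alpha> 1) z = multiplicity_at L (\<alpha> 1) z" if "value_point f (\<alpha> 1) z" for z
    by (rule share_infinity_multiplicity[OF sh1 that])
  show "(\<exists>\<beta>\<in>\<alpha> ` {2..n - 1}. value_point f \<beta> z) \<longleftrightarrow> (\<exists>\<beta>\<in>\<alpha> ` {2..n - 1}. value_point L \<beta> z)" for z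
    by (rule share_value_points[OF sh2])
  show "value_point f 0 z \<longleftrightarrow> value_point L 0 z" for z
    using share_value_points[OF assms(19)] by simp
qed (use assms(13-17) in auto)

end
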